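(* Let $0<p<1$ and $0<q\le\infty$. Then $(H^{p,q},H^2)=H(2,q\ast2,1,1/p)$.
   Context: $\mathbb{D}$ is the open unit disk, $\mathbb{T}$ its boundary, $m$ normalized Lebesgue measure on $\mathbb{T}$, $H(\mathbb{D})$ the analytic functions on $\mathbb{D}$, $H^2$ the usual Hardy space on $\mathbb{D}$. $W$ is the space of complex sequences indexed by $\mathbb{N}_0=\{0,1,2,\dots\}$; $f(z)=\sum a_nz^n\in H(\mathbb{D})$ is identified with $\{a_n\}\in W$. For vector subspaces $E,X$ of $W$, $(E,X)=\{\lambda\in W:\{\lambda_nw_n\}\in X\text{ for all }w\in E\}$. $q\ast2=2$ if $q=\infty$; $q\ast2=\frac{2q}{q-2}$ if $2<q<\infty$; $q\ast2=\infty$ if $0<q\le2$. Hardy-Lorentz spaces: for measurable $f$ on $\mathbb{T}$ let $\lambda_f(s)=m(\{|f|>s\})$, $f^*(s)=\inf\{t\ge0:\lambda_f(t)\le s\}$, $\|f\|_{p,q}=(\int_0^1[f^*(s)s^{1/p}]^q\frac{ds}{s})^{1/q}$ for $0<q<\infty$ and $\|f\|_{p,\infty}=\sup_{s>0}f^*(s)s^{1/p}$. The Smirnov class $N^+$ consists of $f\in H(\mathbb{D})$ in the Nevanlinna class with $\lim_{r\to1^-}\int_{\mathbb{T}}\log^+|f(rz)|\,dm=\int_{\mathbb{T}}\log^+|f|\,dm$, where $f$ on $\mathbb{T}$ is the nontangential boundary function. $H^{p,q}$ is the set of $f\in N^+$ with $\|f\|_{p,q}<\infty$ for the boundary function. Mixed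 norm spaces: $M_p(r,f)=(\int_{\mathbb{T}}|f(rz)|^p\,dm(z))^{1/p}$. For $0<p<\infty$, $0<q\le\infty$, $0<\alpha<\infty$: $H(p,q,\alpha)$ is the set of $f\in H(\mathbb{D})$ with $(\int_0^1M_p(r,f)^q(1-r)^{q\alpha-1}dr)^{1/q}<\infty$ (if $q=\infty$: $\sup_{0<r<1}M_p(r,f)(1-r)^\alpha<\infty$). For $f=\sum a_nz^n$ and $\beta>0$: $f^{[\beta]}(z)=\sum\frac{\Gamma(n+\beta+1)}{n!}a_nz^n$, and $H(p,q,\alpha,\beta)=\{f\in H(\mathbb{D}):f^{[\beta]}\in H(p,q,\alpha)\}$. *)

theory Defs
  imports "HOL-Complex_Analysis.Complex_Analysis"
begin

section \<open>The unit circle with normalized Lebesgue measure\<close>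

definition circle_measure :: "complex measure" where
  "circle_measure =
     completion (distr (uniform_measure lborel {0..2 * pi}) (restrict_space borel (sphere 0 1)) cis)"

lemma space_circle_measure: "space circle_measure = sphere 0 1"
  by (simp add: circle_measure_def space_restrict_space)

lemma emeasure_circle_measure: "emeasure circle_measure (sphere 0 1) = 1"
proof -
  let ?U = "uniform_measure lborel {0..2 * pi}"
  let ?C = "restrict_space borel (sphere 0 1) :: complex measure"
  have c: "cis \<in> measurable ?U ?C"
  proof (rule measurable_restrict_space2)
    have "cis \<in> borel_measurable borel"
      by (intro borel_measurable_continuous_onI continuous_intros)
    then show "cis \<in> borel_measurable ?U"
      by (simp add: measurable_def)
  qed auto
  have s: "sphere 0 1 \<in> sets ?C"
    by (simp add: sets_restrict_space_iff)
  have "emeasure circle_measure (sphere 0 1) = emeasure (distr ?U ?C cis) (sphere 0 1)"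
    using s by (simp add: circle_measure_def)
  also have "\<dots> = emeasure ?U UNIV"
    using c s by (subst emeasure_distr) (auto simp: vimage_def)
  also have "\<dots> = 1"
    by (simp add: emeasure_uniform_measure ennreal_divide_self)
  finally show ?thesis .
qed


section \<open>Sequences, Taylor coefficients and coefficient multipliers\<close>

text \<open>
  Functions on the disk are total functions on the complex plane. Their values outside
  the open unit disk are irrelevant to all the notions below.
\<close>

definition disk_holomorphic :: "(complex \<Rightarrow> complex) set" where
  "disk_holomorphic = {f. f holomorphic_on ball 0 1}"

definition taylor_coeff :: "(complex \<Rightarrow> complex) \<Rightarrow> nat \<Rightarrow> complex" where
  "taylor_coeff f n = (deriv ^^ n) f 0 / fact n"

definition seq_space :: "(complex \<Rightarrow> complex) set \<Rightarrow> (nat \<Rightarrow> complex) set" where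
  "seq_space E = taylor_coeff ` E"

definition multipliers ::
    "(nat \<Rightarrow> complex) set \<Rightarrow> (nat \<Rightarrow> complex) set \<Rightarrow> (nat \<Rightarrow> complex) set" where
  "multipliers E X = {l. \<forall>w\<in>E. (\<lambda>n. l n * w n) \<in> X}"


section \<open>Exponents in the extended range\<close>

text \<open>Only used with positive exponents, whence the value at infinity.\<close>

definition ennpowr :: "ennreal \<Rightarrow> real \<Rightarrow> ennreal" where
  "ennpowr x a = (if x = \<infinity> then \<infinity> else ennreal (enn2real x powr a))"

definition star2 :: "ennreal \<Rightarrow> ennreal" where
  "star2 q = (if q = \<infinity> then 2 else if 2 < q then 2 * q / (q - 2) else \<infinity>)"


section \<open>The Smirnov class\<close>

definition log_plus :: "real \<Rightarrow> real" where
  "log_plus x = ln (max 1 x)"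

definition stolz_region :: "real \<Rightarrow> complex \<Rightarrow> complex set" where
  "stolz_region \<kappa> \<zeta> = {z \<in> ball 0 1. norm (z - \<zeta>) < \<kappa> * (1 - norm z)}"

definition has_nontangential_limit ::
    "(complex \<Rightarrow> complex) \<Rightarrow> complex \<Rightarrow> complex \<Rightarrow> bool" where
  "has_nontangential_limit f \<zeta> L \<longleftrightarrow>
     (\<forall>\<kappa>>1. (f \<longlongrightarrow> L) (at \<zeta> within stolz_region \<kappa> \<zeta>))"

text \<open>
  For f in the Nevanlinna class the nontangential limit exists almost everywhere, so the
  default value 0 is only used on a null set. As the measure on the circle is complete,
  the boundary function of such an f is then measurable.
\<close>

definition boundary_fun :: "(complex \<Rightarrow> complex) \<Rightarrow> complex \<Rightarrow> complex" where
  "boundary_fun f \<zeta> =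
     (if \<exists>L. has_nontangential_limit f \<zeta> L then THE L. has_nontangential_limit f \<zeta> L else 0)"

definition nevanlinna :: "(complex \<Rightarrow> complex) set" where
  "nevanlinna = {f \<in> disk_holomorphic.
     (SUP r\<in>{0<..<1}. \<integral>\<^sup>+\<zeta>. ennreal (log_plus (norm (f (of_real r * \<zeta>)))) \<partial>circle_measure) < \<infinity>}"

definition smirnov :: "(complex \<Rightarrow> complex) set" where
  "smirnov = {f \<in> nevanlinna.
     ((\<lambda>r. \<integral>\<^sup>+\<zeta>. ennreal (log_plus (norm (f (of_real r * \<zeta>)))) \<partial>circle_measure) \<longlongrightarrow>
      (\<integral>\<^sup>+\<zeta>. ennreal (log_plus (norm (boundary_fun f \<zeta>))) \<partial>circle_measure)) (at_left 1)}"


section \<open>Hardy and Hardy-Lorentz spaces\<close>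

definition distribution_fun :: "(complex \<Rightarrow> complex) \<Rightarrow> real \<Rightarrow> real" where
  "distribution_fun g s = measure circle_measure {\<zeta> \<in> sphere 0 1. norm (g \<zeta>) > s}"

definition decreasing_rearrangement :: "(complex \<Rightarrow> complex) \<Rightarrow> real \<Rightarrow> real" where
  "decreasing_rearrangement g s = Inf {t. 0 \<le> t \<and> distribution_fun g t \<le> s}"

definition lorentz_norm :: "real \<Rightarrow> ennreal \<Rightarrow> (complex \<Rightarrow> complex) \<Rightarrow> ennreal" where
  "lorentz_norm p q g =
     (if q = \<infinity> then (SUP s\<in>{0<..}. ennreal (decreasing_rearrangement g s * s powr (1 / p)))
      else ennpowr
        (\<integral>\<^sup>+s\<in>{0<..<1}.
           ennreal ((decreasing_rearrangement g s * s powr (1 / p)) powr enn2real q / s) \<partial>lborel)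
        (1 / enn2real q))"

definition hardy_lorentz :: "real \<Rightarrow> ennreal \<Rightarrow> (complex \<Rightarrow> complex) set" where
  "hardy_lorentz p q = {f \<in> smirnov. lorentz_norm p q (boundary_fun f) < \<infinity>}"

definition integral_mean :: "real \<Rightarrow> real \<Rightarrow> (complex \<Rightarrow> complex) \<Rightarrow> real" where
  "integral_mean p r f =
     (\<integral>\<zeta>. norm (f (of_real r * \<zeta>)) powr p \<partial>circle_measure) powr (1 / p)"

definition hardy_H2 :: "(complex \<Rightarrow> complex) set" where
  "hardy_H2 = {f \<in> disk_holomorphic. bdd_above ((\<lambda>r. integral_mean 2 r f) ` {0<..<1})}"


section \<open>Mixed norm spaces\<close>

definition mixed_norm :: "real \<Rightarrow> ennreal \<Rightarrow> real \<Rightarrow> (complex \<Rightarrow> complex) \<Rightarrow> ennreal" where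
  "mixed_norm p q \<alpha> f =
     (if q = \<infinity> then (SUP r\<in>{0<..<1}. ennreal (integral_mean p r f * (1 - r) powr \<alpha>))
      else ennpowr
        (\<integral>\<^sup>+r\<in>{0<..<1}.
           ennreal (integral_mean p r f powr enn2real q * (1 - r) powr (enn2real q * \<alpha> - 1)) \<partial>lborel)
        (1 / enn2real q))"

definition mixed_norm_space :: "real \<Rightarrow> ennreal \<Rightarrow> real \<Rightarrow> (complex \<Rightarrow> complex) set" where
  "mixed_norm_space p q \<alpha> = {f \<in> disk_holomorphic. mixed_norm p q \<alpha> f < \<infinity>}"

definition frac_deriv :: "real \<Rightarrow> (complex \<Rightarrow> complex) \<Rightarrow> complex \<Rightarrow> complex" where
  "frac_deriv \<beta> f z =
     (\<Sum>n. of_real (Gamma (real n + \<beta> + 1) / fact n) * taylor_coeff f n * z ^ n)"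

definition mixed_norm_deriv_space ::
    "real \<Rightarrow> ennreal \<Rightarrow> real \<Rightarrow> real \<Rightarrow> (complex \<Rightarrow> complex) set" where
  "mixed_norm_deriv_space p q \<alpha> \<beta> =
     {f \<in> disk_holomorphic. frac_deriv \<beta> f \<in> mixed_norm_space p q \<alpha>}"

end

theory Submission
  imports Defs
begin

text \<open>
  Write \<open>I k\<close> for the block of indices from \<open>2 ^ k\<close> to \<open>2 ^ (k + 1) - 1\<close> and \<open>v k\<close> for
  \<open>2 ^ (2 * k * (1 / p - 1))\<close> times the sum of \<open>(norm (l n))\<^sup>2\<close> over \<open>I k\<close>. Both sides of the theorem are
  equivalent to the condition that \<open>v\<close> lies in the sequence space dual to the one with exponent \<open>q / 2\<close>.
  For the mixed norm space this is Parseval's identity and dyadic discretization of the radial integral.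

  If \<open>f\<close> lies in the Hardy-Lorentz space, then \<open>norm (f z)\<close> is at most the \<open>m\<close>-th power of the Poisson
  integral of \<open>F powr (1 / m)\<close>, where \<open>F = max 1 (norm (boundary_fun f))\<close>. Splitting at the
  height \<open>F\<^sup>*(2 ^ - k)\<close>, with \<open>1 / p < m\<close>, bounds the mean of \<open>norm f\<close> on the circle of radius \<open>1 - 2 ^ - k\<close>, hence
  the coefficients with index in \<open>I k\<close>, by \<open>2 ^ (k * (1 / p - 1)) * x k\<close> with \<open>x\<close> of exponent \<open>q\<close>, and Hoelder's
  inequality for sequences shows that the condition is sufficient. Conversely, for every sequence \<open>c\<close> of exponent \<open>q\<close> a superposition of
  kernels \<open>1 / (1 - r * z) ^ B\<close>, one for each dyadic scale, is a Hardy-Lorentz function whose coefficients in \<open>I k\<close> are at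
  least a constant times \<open>2 ^ (k * (1 / p - 1)) * c k\<close>, and the converse of Hoelder's inequality applies.
\<close>

section \<open>The circle measure\<close>

text \<open>For \<open>p < 1\<close> the boundary function need not be integrable, so
  \<open>f\<close> cannot be recovered from it by a Poisson integral; what the Smirnov condition
  controls by boundary values is \<open>log_plus (norm f)\<close>. The \<open>m\<close>-th root with
  \<open>m > 1 / p\<close> moves \<open>F\<close> to a Lorentz scale of first index
  \<open>p * m > 1\<close>, where Poisson integrals make sense. After raising back to the
  \<open>m\<close>-th power, each half of the splitting carries a geometric factor: its ratio is
  below 1 because \<open>p < 1\<close> in the lower half and because \<open>m > 1 / p\<close> in the
  upper half. Replacing \<open>norm f\<close> by its maximum with 1 costs a constant, harmless since
  the blocks may grow like \<open>2 ^ (k * (1 / p - 1))\<close>.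

  Membership in H2 depends only on the moduli of the coefficients, so one test function per sequence
  with coefficients bounded below suffices for necessity. Squaring turns the exponent
  \<open>q\<close> into \<open>q / 2\<close>, and \<open>star2 q\<close> is twice the exponent dual
  to \<open>q / 2\<close>. The converse of Hoelder's inequality is proved by explicit sequences,
  which treats normed and quasi-normed exponents alike.\<close>

lemma cis_measurable_circle:
  "cis \<in> measurable (uniform_measure lborel {0..2 * pi}) (restrict_space borel (sphere 0 1))"
proof (rule measurable_restrict_space2)
  have "cis \<in> borel_measurable borel"
    by (intro borel_measurable_continuous_onI continuous_intros)
  then show "cis \<in> borel_measurable (uniform_measure lborel {0..2 * pi})"
    by (simp add: measurable_def)
qed auto

lemma borel_measurable_circle:
  assumes "f \<in> borel_measurable (restrict_space borel (sphere 0 1))"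
  shows "f \<in> borel_measurable circle_measure"
  unfolding circle_measure_def
  by (rule measurable_completion) (use assms in \<open>simp add: measurable_def\<close>)

lemma borel_measurable_circle_continuous:
  fixes f :: "complex \<Rightarrow> 'b::topological_space"
  assumes "continuous_on (sphere 0 1) f"
  shows "f \<in> borel_measurable circle_measure"
  by (intro borel_measurable_circle borel_measurable_continuous_on_restrict assms)

lemma id_measurable_circle [measurable]: "(\<lambda>x. x) \<in> borel_measurable circle_measure"
  by (intro borel_measurable_circle_continuous continuous_intros)

interpretation circle: finite_measure circle_measure
  by standard (simp add: space_circle_measure emeasure_circle_measure)

lemma measure_circle: "measure circle_measure (sphere 0 1) = 1"
  by (simp add: measure_def emeasure_circle_measure)

lemma measure_space_circle [simp]: "measure circle_measure (space circle_measure) = 1"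
  by (simp add: space_circle_measure measure_circle)

lemma emeasure_space_circle [simp]: "emeasure circle_measure (space circle_measure) = 1"
  by (simp add: space_circle_measure emeasure_circle_measure)

lemma integrable_circle_continuous:
  fixes f :: "complex \<Rightarrow> 'b::{banach, second_countable_topology}"
  assumes "continuous_on (sphere 0 1) f"
  shows "integrable circle_measure f"
proof -
  have "bounded (f ` sphere 0 1)"
    by (intro compact_imp_bounded compact_continuous_image assms) auto
  then obtain B where "\<And>x. x \<in> sphere 0 1 \<Longrightarrow> norm (f x) \<le> B"
    unfolding bounded_iff by blast
  then show ?thesis
    by (intro circle.integrable_const_bound[of _ B] borel_measurable_circle_continuous assms)
       (auto simp: space_circle_measure)
qed

text \<open>Borel measurability of \<open>f\<close> is asked because the completion is stripped off
  first; transport by \<open>cis\<close> then leaves an ordinary integral over one period.\<close>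

lemma integral_circle:
  fixes f :: "complex \<Rightarrow> 'b::{banach, second_countable_topology}"
  assumes "f \<in> borel_measurable (restrict_space borel (sphere 0 1))"
  shows "integral\<^sup>L circle_measure f = (LBINT t:{0..2*pi}. f (cis t)) /\<^sub>R (2 * pi)"
proof -
  let ?U = "uniform_measure lborel {0..2 * pi}"
  let ?C = "restrict_space borel (sphere 0 1) :: complex measure"
  have "integral\<^sup>L circle_measure f = integral\<^sup>L (distr ?U ?C cis) f"
    unfolding circle_measure_def by (rule integral_completion) (use assms in \<open>simp add: measurable_def\<close>)
  also have "\<dots> = (\<integral>t. f (cis t) \<partial>?U)"
    by (rule integral_distr[OF cis_measurable_circle assms])
  also have "?U = density lborel (\<lambda>t. ennreal (indicator {0..2*pi} t / (2 * pi)))"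
    unfolding uniform_measure_def
    by (intro density_cong) (auto simp: indicator_def divide_ennreal ennreal_1[symmetric] simp del: ennreal_1)
  also have "(\<integral>t. f (cis t) \<partial>\<dots>) = (\<integral>t. (indicator {0..2*pi} t / (2 * pi)) *\<^sub>R f (cis t) \<partial>lborel)"
  proof (rule integral_density)
    have "(\<lambda>t. f (cis t)) \<in> borel_measurable ?U"
      by (rule measurable_compose[OF cis_measurable_circle assms])
    then show "(\<lambda>t. f (cis t)) \<in> borel_measurable lborel" by (simp add: measurable_def)
  qed auto
  also have "\<dots> = (\<integral>t. (1/(2*pi)) *\<^sub>R (indicator {0..2*pi} t *\<^sub>R f (cis t)) \<partial>lborel)"
    by (intro Bochner_Integration.integral_cong) auto
  also have "\<dots> = (LBINT t:{0..2*pi}. f (cis t)) /\<^sub>R (2 * pi)"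
    by (simp only: integral_scaleR_right set_lebesgue_integral_def inverse_eq_divide)
  finally show ?thesis .
qed

lemma integral_circle_power:
  "(\<integral>\<zeta>. \<zeta> ^ n \<partial>circle_measure) = (if n = 0 then 1 else 0)"
proof (cases "n = 0")
  case False
  have "(\<integral>\<zeta>. \<zeta> ^ n \<partial>circle_measure) = (LBINT t:{0..2*pi}. cis t ^ n) /\<^sub>R (2 * pi)"
    by (intro integral_circle borel_measurable_continuous_on_restrict continuous_intros)
  also have "(LBINT t:{0..2*pi}. cis t ^ n) = cis (real n * (2*pi)) / (\<i> * n) - cis (real n * 0) / (\<i> * n)"
    unfolding set_lebesgue_integral_def
  proof (rule integral_FTC_Icc)
    fix t :: real
    show "((\<lambda>t. cis (real n * t) / (\<i> * n)) has_vector_derivative cis t ^ n) (at t within {0..2*pi})"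
    proof -
      have "((\<lambda>z. exp (\<i> * (of_nat n * z)) / (\<i> * n)) has_field_derivative exp (\<i> * (of_nat n * of_real t))) (at (of_real t))"
        using False by (auto intro!: derivative_eq_intros simp: field_simps)
      from has_vector_derivative_real_field[OF this] show ?thesis
        by (simp add: cis_conv_exp exp_of_nat_mult[symmetric] mult.left_commute)
    qed
  qed (auto intro!: continuous_intros)
  also have "cis (real n * (2*pi)) = 1"
    by (metis Complex.DeMoivre cis_2pi power_one)
  finally show ?thesis using False by simp
qed simp

lemma integral_circle_cnj_power:
  "(\<integral>\<zeta>. cnj \<zeta> ^ n \<partial>circle_measure) = (if n = 0 then 1 else 0)"
proof -
  have "(\<integral>\<zeta>. cnj (\<zeta> ^ n) \<partial>circle_measure) = cnj (\<integral>\<zeta>. \<zeta> ^ n \<partial>circle_measure)"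
    by (intro integral_bounded_linear bounded_linear_cnj integrable_circle_continuous continuous_intros)
  then show ?thesis by (simp add: integral_circle_power)
qed

section \<open>Arcs of the circle near the point 1\<close>

lemma sin_lower_bound:
  fixes x :: real
  assumes "0 \<le> x" "x \<le> pi / 2"
  shows "2 * x / pi \<le> sin x"
proof -
  \<comment> \<open>Jordan's inequality: concavity puts the sine above its chord from 0 to
    \<open>pi / 2\<close>.\<close>
  have "concave_on {0..pi} sin"
    unfolding concave_on_def
    by (rule f''_ge0_imp_convex[where f' = "\<lambda>x. - cos x" and f'' = sin])
       (auto intro!: derivative_eq_intros sin_ge_zero)
  then have "(1 - 2*x/pi) * sin 0 + (2*x/pi) * sin (pi/2) \<le> sin ((1 - 2*x/pi) *\<^sub>R 0 + (2*x/pi) *\<^sub>R (pi/2))"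
    using assms by (intro concave_onD) (auto simp: field_simps)
  then show ?thesis by simp
qed

lemma norm_1_minus_cis: "norm (1 - cis t) = 2 * \<bar>sin (t/2)\<bar>"
proof -
  have "(norm (1 - cis t))\<^sup>2 = (1 - cos t)\<^sup>2 + (sin t)\<^sup>2"
    by (simp add: cmod_power2)
  also have "\<dots> = 2 - 2 * cos t"
    using sin_cos_squared_add[of t] by (simp add: power2_eq_square algebra_simps)
  also have "cos t = 1 - 2 * (sin (t/2))\<^sup>2"
    using cos_double_sin[of "t/2"] by simp
  finally have "(norm (1 - cis t))\<^sup>2 = (2 * \<bar>sin (t/2)\<bar>)\<^sup>2" by (simp add: power_mult_distrib)
  then show ?thesis by (subst (asm) power2_eq_iff_nonneg) auto
qed

text \<open>By Jordan's inequality the set lies in two arcs of total length \<open>pi * x\<close>,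
  so even \<open>x / 2\<close> is a bound. The constant 1 lets a majorant in
  \<open>norm (1 - \<zeta>)\<close> bound the decreasing rearrangement at the same argument.\<close>

lemma measure_circle_near_1:
  assumes "0 < x"
  shows "measure circle_measure {\<zeta> \<in> sphere 0 1. norm (1 - \<zeta>) < x} \<le> x"
proof -
  let ?U = "uniform_measure lborel {0..2 * pi}"
  let ?C = "restrict_space borel (sphere 0 1) :: complex measure"
  let ?A = "{\<zeta> \<in> sphere 0 1. norm (1 - \<zeta>) < x}"
  let ?J = "{0..pi * x / 2} \<union> {2 * pi - pi * x / 2..2 * pi}"
  have A: "?A \<in> sets ?C"
  proof -
    have "?A = sphere 0 1 \<inter> ball 1 x" by (auto simp: dist_norm)
    then show ?thesis unfolding sets_restrict_space by (intro image_eqI[of _ _ "ball 1 x"]) auto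
  qed
  have sub: "{0..2*pi} \<inter> cis -` ?A \<subseteq> ?J"
  proof
    fix t assume "t \<in> {0..2*pi} \<inter> cis -` ?A"
    then have t: "0 \<le> t" "t \<le> 2 * pi" "2 * \<bar>sin (t/2)\<bar> < x" by (auto simp: norm_1_minus_cis)
    show "t \<in> ?J"
    proof (cases "t \<le> pi")
      case True
      then have "2 * (t/2) / pi \<le> sin (t/2)" by (intro sin_lower_bound) (use t in auto)
      then have "2 * t / pi < x" using t by simp
      then show ?thesis using t by (auto simp: field_simps)
    next
      case False
      \<comment> \<open>The far half of the period is folded onto the near one by
        \<open>sin (pi - x) = sin x\<close>.\<close>
      have "2 * (pi - t/2) / pi \<le> sin (pi - t/2)" by (intro sin_lower_bound) (use t False in auto)
      then have "2 * (pi - t/2) / pi \<le> sin (t/2)" by (simp add: sin_diff)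
      moreover have "2 * sin (t/2) < x" using t by linarith
      moreover have "4 * (pi - t/2) / pi = 2 * (2 * (pi - t/2) / pi)" by simp
      ultimately have "4 * (pi - t/2) / pi < x" by linarith
      then show ?thesis using t by (auto simp: field_simps)
    qed
  qed
  have "emeasure circle_measure ?A = emeasure (distr ?U ?C cis) ?A"
    using A by (simp add: circle_measure_def)
  also have "\<dots> = emeasure ?U (cis -` ?A \<inter> space ?U)"
    by (rule emeasure_distr[OF cis_measurable_circle A])
  also have "\<dots> = emeasure lborel ({0..2*pi} \<inter> (cis -` ?A)) / emeasure lborel {0..2*pi}"
  proof -
    have "cis -` ?A \<inter> space ?U \<in> sets ?U" by (rule measurable_sets[OF cis_measurable_circle A])
    then show ?thesis by (simp add: emeasure_uniform_measure)
  qed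
  also have "\<dots> \<le> emeasure lborel ?J / emeasure lborel {0..2*pi}"
    by (intro divide_right_mono_ennreal emeasure_mono sub) auto
  also have "\<dots> \<le> (emeasure lborel {0..pi * x / 2} + emeasure lborel {2 * pi - pi * x / 2..2 * pi}) / emeasure lborel {0..2*pi}"
    by (intro divide_right_mono_ennreal emeasure_subadditive) auto
  also have "\<dots> = ennreal (pi * x) / ennreal (2 * pi)"
    using assms by (simp add: ennreal_plus[symmetric] del: ennreal_plus)
  also have "\<dots> = ennreal (x / 2)"
    using assms by (simp add: divide_ennreal)
  also have "\<dots> \<le> ennreal x" using assms by (intro ennreal_leI) auto
  finally show ?thesis
    unfolding measure_def using assms by (metis enn2real_leI less_imp_le)
qed

section \<open>Power series on the disk\<close>

lemma power_series_on_disk: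
  assumes "\<And>z. norm z < 1 \<Longrightarrow> (\<lambda>n. a n * z ^ n) sums f z"
  shows "f holomorphic_on ball 0 1" and "taylor_coeff f = a"
proof -
  show "f holomorphic_on ball 0 1"
    by (rule power_series_holomorphic[of _ _ a]) (use assms in auto)
  have "f has_fps_expansion Abs_fps a"
  proof (rule has_fps_expansionI)
    have "eventually (\<lambda>z. z \<in> ball 0 1) (nhds (0::complex))"
      by (intro eventually_nhds_in_open) auto
    then show "eventually (\<lambda>z. (\<lambda>n. fps_nth (Abs_fps a) n * z ^ n) sums f z) (nhds 0)"
      by eventually_elim (use assms in auto)
  qed
  from fps_nth_fps_expansion[OF this] show "taylor_coeff f = a"
    by (auto simp: taylor_coeff_def fun_eq_iff)
qed

lemma disk_holomorphic_sums:
  assumes "f holomorphic_on ball 0 1" and "norm z < 1"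
  shows "(\<lambda>n. taylor_coeff f n * z ^ n) sums f z"
  using holomorphic_power_series[OF assms(1), of z] assms(2) by (simp add: taylor_coeff_def)

lemma disk_holomorphic_abs_summable:
  assumes "f holomorphic_on ball 0 1" and "0 \<le> r" "r < 1"
  shows "summable (\<lambda>n. norm (taylor_coeff f n * of_real r ^ n))"
proof (rule powser_insidea[where x = "of_real ((1 + r) / 2)"])
  show "summable (\<lambda>n. taylor_coeff f n * of_real ((1 + r) / 2) ^ n)"
    by (rule sums_summable[OF disk_holomorphic_sums[OF assms(1)]]) (use assms in \<open>auto simp del: of_real_add of_real_divide\<close>)
  show "norm (of_real r :: complex) < norm (of_real ((1 + r) / 2) :: complex)"
    unfolding norm_of_real using assms by auto
qed

section \<open>Orthogonality of the powers and Parseval's identity\<close>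

lemma circle_mult_cnj [simp]: "norm z = 1 \<Longrightarrow> z * cnj z = 1"
  by (simp add: complex_norm_square[symmetric])

lemma integral_circle_orthonormal:
  "(\<integral>\<zeta>. \<zeta> ^ k * cnj \<zeta> ^ n \<partial>circle_measure) = (if k = n then 1 else 0)"
proof (cases "n \<le> k")
  case True
  have "(\<integral>\<zeta>. \<zeta> ^ k * cnj \<zeta> ^ n \<partial>circle_measure) = (\<integral>\<zeta>. \<zeta> ^ (k - n) \<partial>circle_measure)"
  proof (rule Bochner_Integration.integral_cong[OF refl])
    fix \<zeta> assume "\<zeta> \<in> space circle_measure"
    then have "\<zeta> ^ k * cnj \<zeta> ^ n = \<zeta> ^ (k - n) * (\<zeta> * cnj \<zeta>) ^ n"
      using True by (simp add: power_mult_distrib power_add[symmetric] mult.assoc[symmetric])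
    then show "\<zeta> ^ k * cnj \<zeta> ^ n = \<zeta> ^ (k - n)"
      using \<open>\<zeta> \<in> space circle_measure\<close> by (simp add: space_circle_measure)
  qed
  then show ?thesis using True by (auto simp: integral_circle_power)
next
  case False
  have "(\<integral>\<zeta>. \<zeta> ^ k * cnj \<zeta> ^ n \<partial>circle_measure) = (\<integral>\<zeta>. cnj \<zeta> ^ (n - k) \<partial>circle_measure)"
  proof (rule Bochner_Integration.integral_cong[OF refl])
    fix \<zeta> assume "\<zeta> \<in> space circle_measure"
    have "\<zeta> ^ k * cnj \<zeta> ^ n = \<zeta> ^ k * (cnj \<zeta> ^ (n - k) * cnj \<zeta> ^ k)"
      using False by (simp add: power_add[symmetric])
    also have "\<dots> = cnj \<zeta> ^ (n - k) * (\<zeta> * cnj \<zeta>) ^ k"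
      by (simp add: power_mult_distrib)
    finally show "\<zeta> ^ k * cnj \<zeta> ^ n = cnj \<zeta> ^ (n - k)"
      using \<open>\<zeta> \<in> space circle_measure\<close> by (simp add: space_circle_measure)
  qed
  then show ?thesis using False by (auto simp: integral_circle_cnj_power)
qed

text \<open>Termwise integration by absolute convergence. The factor \<open>h\<close> is later a
  power of \<zeta> or of its conjugate, or the conjugate of the series itself, which gives
  Parseval's identity.\<close>

lemma integral_circle_sums:
  fixes a :: "nat \<Rightarrow> complex"
  assumes a: "summable (\<lambda>n. norm (a n))" and h: "continuous_on (sphere 0 1) h"
  shows "(\<lambda>k. a k * (\<integral>\<zeta>. \<zeta> ^ k * h \<zeta> \<partial>circle_measure)) sums (\<integral>\<zeta>. (\<Sum>k. a k * \<zeta> ^ k) * h \<zeta> \<partial>circle_measure)"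
proof -
  obtain H where H: "\<And>\<zeta>. \<zeta> \<in> sphere 0 1 \<Longrightarrow> norm (h \<zeta>) \<le> H"
  proof -
    have "bounded (h ` sphere 0 1)"
      by (intro compact_imp_bounded compact_continuous_image h) auto
    then show ?thesis using that unfolding bounded_iff by blast
  qed
  have cont: "continuous_on (sphere 0 1) (\<lambda>\<zeta>. a k * \<zeta> ^ k * h \<zeta>)" for k
    by (intro continuous_intros h)
  have H0: "0 \<le> H" using order_trans[OF norm_ge_zero H[of 1]] by simp
  have nb: "norm (a k * \<zeta> ^ k * h \<zeta>) \<le> norm (a k) * H" if "\<zeta> \<in> sphere 0 1" for k \<zeta>
    using that H[OF that] by (simp add: norm_mult norm_power mult_left_mono)
  have "(\<lambda>k. \<integral>\<zeta>. a k * \<zeta> ^ k * h \<zeta> \<partial>circle_measure) sums (\<integral>\<zeta>. (\<Sum>k. a k * \<zeta> ^ k * h \<zeta>) \<partial>circle_measure)"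
  proof (rule sums_integral)
    show "integrable circle_measure (\<lambda>\<zeta>. a k * \<zeta> ^ k * h \<zeta>)" for k
      by (intro integrable_circle_continuous cont)
    show "AE \<zeta> in circle_measure. summable (\<lambda>k. norm (a k * \<zeta> ^ k * h \<zeta>))"
    proof (rule AE_I2)
      fix \<zeta> assume "\<zeta> \<in> space circle_measure"
      then show "summable (\<lambda>k. norm (a k * \<zeta> ^ k * h \<zeta>))"
        by (intro summable_comparison_test'[OF summable_mult2[OF a, of H]])
           (use nb in \<open>auto simp: space_circle_measure\<close>)
    qed
    show "summable (\<lambda>k. \<integral>\<zeta>. norm (a k * \<zeta> ^ k * h \<zeta>) \<partial>circle_measure)"
    proof (rule summable_comparison_test'[OF summable_mult2[OF a, of H]])
      fix k :: nat
      have "(\<integral>\<zeta>. norm (a k * \<zeta> ^ k * h \<zeta>) \<partial>circle_measure) \<le> (\<integral>\<zeta>. norm (a k) * H \<partial>circle_measure)"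
        by (intro integral_mono integrable_circle_continuous continuous_intros h)
           (use nb in \<open>auto simp: space_circle_measure\<close>)
      then show "norm (\<integral>\<zeta>. norm (a k * \<zeta> ^ k * h \<zeta>) \<partial>circle_measure) \<le> norm (a k) * H"
        by simp
    qed
  qed
  moreover have "(\<integral>\<zeta>. a k * \<zeta> ^ k * h \<zeta> \<partial>circle_measure) = a k * (\<integral>\<zeta>. \<zeta> ^ k * h \<zeta> \<partial>circle_measure)" for k
    by (simp add: mult.assoc)
  moreover have "(\<integral>\<zeta>. (\<Sum>k. a k * \<zeta> ^ k * h \<zeta>) \<partial>circle_measure) = (\<integral>\<zeta>. (\<Sum>k. a k * \<zeta> ^ k) * h \<zeta> \<partial>circle_measure)"
  proof (rule Bochner_Integration.integral_cong[OF refl])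
    fix \<zeta> assume "\<zeta> \<in> space circle_measure"
    then have "summable (\<lambda>k. a k * \<zeta> ^ k)"
      by (intro summable_norm_cancel[OF summable_comparison_test'[OF a]])
         (auto simp: space_circle_measure norm_mult norm_power)
    from suminf_mult2[OF this, of "h \<zeta>"]
    show "(\<Sum>k. a k * \<zeta> ^ k * h \<zeta>) = (\<Sum>k. a k * \<zeta> ^ k) * h \<zeta>" by simp
  qed
  ultimately show ?thesis by simp
qed

lemma integral_circle_cnj_power_series:
  fixes a :: "nat \<Rightarrow> complex"
  assumes "summable (\<lambda>n. norm (a n))"
  shows "(\<integral>\<zeta>. (\<Sum>k. a k * \<zeta> ^ k) * cnj \<zeta> ^ n \<partial>circle_measure) = a n"
proof -
  have "(\<lambda>k. a k * (\<integral>\<zeta>. \<zeta> ^ k * cnj \<zeta> ^ n \<partial>circle_measure)) sums (\<integral>\<zeta>. (\<Sum>k. a k * \<zeta> ^ k) * cnj \<zeta> ^ n \<partial>circle_measure)"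
    by (intro integral_circle_sums assms continuous_intros)
  also have "(\<lambda>k. a k * (\<integral>\<zeta>. \<zeta> ^ k * cnj \<zeta> ^ n \<partial>circle_measure)) = (\<lambda>k. if k = n then a k else 0)"
    by (auto simp: integral_circle_orthonormal)
  finally have "(\<lambda>k. if k = n then a k else 0) sums (\<integral>\<zeta>. (\<Sum>k. a k * \<zeta> ^ k) * cnj \<zeta> ^ n \<partial>circle_measure)" .
  moreover have "(\<lambda>k. if k = n then a k else 0) sums a n" by (rule sums_single)
  ultimately show ?thesis by (rule sums_unique2)
qed

lemma integral_circle_power_power_series:
  fixes a :: "nat \<Rightarrow> complex"
  assumes "summable (\<lambda>n. norm (a n))"
  shows "(\<integral>\<zeta>. (\<Sum>k. a k * \<zeta> ^ k) * \<zeta> ^ n \<partial>circle_measure) = (if n = 0 then a 0 else 0)"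
proof (cases "n = 0")
  case True
  then show ?thesis using integral_circle_cnj_power_series[OF assms, of 0] by simp
next
  case False
  have "(\<lambda>k. a k * (\<integral>\<zeta>. \<zeta> ^ k * \<zeta> ^ n \<partial>circle_measure)) sums (\<integral>\<zeta>. (\<Sum>k. a k * \<zeta> ^ k) * \<zeta> ^ n \<partial>circle_measure)"
    by (intro integral_circle_sums assms continuous_intros)
  then show ?thesis using False by (simp add: power_add[symmetric] integral_circle_power sums_iff)
qed

lemma parseval_circle:
  fixes a :: "nat \<Rightarrow> complex"
  assumes a: "summable (\<lambda>n. norm (a n))"
  shows "(\<lambda>n. (norm (a n))\<^sup>2) sums (\<integral>\<zeta>. (norm (\<Sum>k. a k * \<zeta> ^ k))\<^sup>2 \<partial>circle_measure)"
proof -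
  let ?f = "\<lambda>\<zeta>. \<Sum>k. a k * \<zeta> ^ k"
  have cont: "continuous_on (sphere 0 1) ?f"
  proof (rule uniform_limit_theorem)
    show "uniform_limit (sphere 0 1) (\<lambda>n \<zeta>. \<Sum>k<n. a k * \<zeta> ^ k) ?f sequentially"
      by (rule Weierstrass_m_test[OF _ a]) (auto simp: norm_mult norm_power)
  qed (auto intro!: always_eventually continuous_intros)
  have "(\<lambda>k. a k * (\<integral>\<zeta>. \<zeta> ^ k * cnj (?f \<zeta>) \<partial>circle_measure)) sums (\<integral>\<zeta>. ?f \<zeta> * cnj (?f \<zeta>) \<partial>circle_measure)"
    by (intro integral_circle_sums a continuous_intros cont)
  also have "(\<lambda>k. a k * (\<integral>\<zeta>. \<zeta> ^ k * cnj (?f \<zeta>) \<partial>circle_measure)) = (\<lambda>k. a k * cnj (a k))"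
  proof
    fix k
    have "(\<integral>\<zeta>. cnj (?f \<zeta> * cnj \<zeta> ^ k) \<partial>circle_measure) = cnj (\<integral>\<zeta>. ?f \<zeta> * cnj \<zeta> ^ k \<partial>circle_measure)"
      by (intro integral_bounded_linear bounded_linear_cnj integrable_circle_continuous continuous_intros cont)
    then show "a k * (\<integral>\<zeta>. \<zeta> ^ k * cnj (?f \<zeta>) \<partial>circle_measure) = a k * cnj (a k)"
      by (simp add: integral_circle_cnj_power_series[OF a] mult.commute[of "_ ^ k"])
  qed
  also have "(\<integral>\<zeta>. ?f \<zeta> * cnj (?f \<zeta>) \<partial>circle_measure) = of_real (\<integral>\<zeta>. (norm (?f \<zeta>))\<^sup>2 \<partial>circle_measure)"
    by (simp only: complex_norm_square[symmetric] integral_complex_of_real)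
  finally have "(\<lambda>k. of_real ((norm (a k))\<^sup>2) :: complex) sums of_real (\<integral>\<zeta>. (norm (?f \<zeta>))\<^sup>2 \<partial>circle_measure)"
    by (simp only: complex_norm_square[symmetric])
  then show ?thesis by (simp only: sums_of_real_iff)
qed

lemma parseval_disk:
  assumes f: "f holomorphic_on ball 0 1" and r: "0 \<le> r" "r < 1"
  shows "(\<lambda>n. (norm (taylor_coeff f n))\<^sup>2 * r ^ (2 * n)) sums (\<integral>\<zeta>. (norm (f (of_real r * \<zeta>)))\<^sup>2 \<partial>circle_measure)"
proof -
  have "(\<lambda>n. (norm (taylor_coeff f n * of_real r ^ n))\<^sup>2) sums
        (\<integral>\<zeta>. (norm (\<Sum>k. taylor_coeff f k * of_real r ^ k * \<zeta> ^ k))\<^sup>2 \<partial>circle_measure)"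
    by (intro parseval_circle disk_holomorphic_abs_summable f r)
  also have "(\<integral>\<zeta>. (norm (\<Sum>k. taylor_coeff f k * of_real r ^ k * \<zeta> ^ k))\<^sup>2 \<partial>circle_measure)
    = (\<integral>\<zeta>. (norm (f (of_real r * \<zeta>)))\<^sup>2 \<partial>circle_measure)"
  proof (rule Bochner_Integration.integral_cong[OF refl])
    fix \<zeta> assume "\<zeta> \<in> space circle_measure"
    then have "norm (of_real r * \<zeta>) < 1" using r by (simp add: space_circle_measure norm_mult)
    from disk_holomorphic_sums[OF f this]
    show "(norm (\<Sum>k. taylor_coeff f k * of_real r ^ k * \<zeta> ^ k))\<^sup>2 = (norm (f (of_real r * \<zeta>)))\<^sup>2"
      by (simp add: sums_iff power_mult_distrib mult.assoc)
  qed
  finally show ?thesis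
    using r by (simp add: norm_mult norm_power power_mult_distrib power_mult[symmetric] mult.commute)
qed

lemma continuous_on_circle_dilate:
  assumes f: "f holomorphic_on ball 0 1" and r: "0 \<le> r" "r < 1"
  shows "continuous_on (sphere 0 1) (\<lambda>\<zeta>. f (of_real r * \<zeta>))"
proof -
  have "(\<lambda>\<zeta>. of_real r * \<zeta>) ` sphere 0 1 \<subseteq> ball (0::complex) 1"
    using r by (auto simp: norm_mult)
  then show ?thesis
    by (intro continuous_on_compose2[OF holomorphic_on_imp_continuous_on[OF f]] continuous_intros)
qed

text \<open>Cauchy's estimate in the mean: integrating against \<open>cnj \<zeta> ^ n\<close>
  isolates one coefficient. It converts a bound for the mean of \<open>norm f\<close> over one
  circle into bounds for all coefficients.\<close>

lemma norm_taylor_coeff_le: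
  assumes f: "f holomorphic_on ball 0 1" and r: "0 \<le> r" "r < 1"
  shows "norm (taylor_coeff f n) * r ^ n \<le> (\<integral>\<zeta>. norm (f (of_real r * \<zeta>)) \<partial>circle_measure)"
proof -
  have "(\<integral>\<zeta>. f (of_real r * \<zeta>) * cnj \<zeta> ^ n \<partial>circle_measure) =
    (\<integral>\<zeta>. (\<Sum>k. taylor_coeff f k * of_real r ^ k * \<zeta> ^ k) * cnj \<zeta> ^ n \<partial>circle_measure)"
  proof (rule Bochner_Integration.integral_cong[OF refl])
    fix \<zeta> assume "\<zeta> \<in> space circle_measure"
    then have "norm (of_real r * \<zeta>) < 1" using r by (simp add: space_circle_measure norm_mult)
    from disk_holomorphic_sums[OF f this]
    show "f (of_real r * \<zeta>) * cnj \<zeta> ^ n = (\<Sum>k. taylor_coeff f k * of_real r ^ k * \<zeta> ^ k) * cnj \<zeta> ^ n"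
      by (simp add: sums_iff power_mult_distrib mult.assoc)
  qed
  also have "\<dots> = taylor_coeff f n * of_real r ^ n"
    by (intro integral_circle_cnj_power_series disk_holomorphic_abs_summable f r)
  finally have "norm (taylor_coeff f n) * r ^ n = norm (\<integral>\<zeta>. f (of_real r * \<zeta>) * cnj \<zeta> ^ n \<partial>circle_measure)"
    using r by (simp add: norm_mult norm_power)
  also have "\<dots> \<le> (\<integral>\<zeta>. norm (f (of_real r * \<zeta>) * cnj \<zeta> ^ n) \<partial>circle_measure)"
    by (rule integral_norm_bound)
  also have "\<dots> = (\<integral>\<zeta>. norm (f (of_real r * \<zeta>)) \<partial>circle_measure)"
    by (intro Bochner_Integration.integral_cong) (auto simp: space_circle_measure norm_mult norm_power)
  finally show ?thesis .
qed

section \<open>The Poisson kernel\<close>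

definition poisson :: "complex \<Rightarrow> complex \<Rightarrow> real" where
  "poisson z \<zeta> = (1 - (norm z)\<^sup>2) / (norm (\<zeta> - z))\<^sup>2"

lemma poisson_nonneg: "norm z < 1 \<Longrightarrow> 0 \<le> poisson z \<zeta>"
  by (simp add: poisson_def power_le_one)

lemma poisson_le:
  assumes "norm z < 1" "norm \<zeta> = 1"
  shows "poisson z \<zeta> \<le> 2 / (1 - norm z)"
proof -
  have "1 - norm z \<le> norm (\<zeta> - z)"
    using norm_triangle_ineq2[of \<zeta> z] assms by simp
  then have "poisson z \<zeta> \<le> (1 - (norm z)\<^sup>2) / (1 - norm z)\<^sup>2"
    unfolding poisson_def using assms by (intro divide_left_mono power_mono mult_pos_pos) (auto simp: power_le_one)
  also have "\<dots> = (1 + norm z) / (1 - norm z)"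
    using assms by (simp add: power2_eq_square divide_simps) (simp add: algebra_simps)
  also have "\<dots> \<le> 2 / (1 - norm z)"
    using assms by (intro divide_right_mono) auto
  finally show ?thesis .
qed

text \<open>Conjugation and multiplication by unimodular numbers carry one denominator into the
  other without changing the modulus. In \<open>poisson_fubini\<close> the symmetry turns an average
  over the base point into an average over the integration variable.\<close>

lemma poisson_symmetric:
  assumes "norm \<zeta> = 1" "norm \<eta> = 1"
  shows "poisson (of_real r * \<eta>) \<zeta> = poisson (of_real r * \<zeta>) \<eta>"
proof -
  have "norm (\<zeta> - of_real r * \<eta>) = norm (\<eta> * cnj \<zeta>) * norm (\<zeta> - of_real r * \<eta>)"
    using assms by (simp add: norm_mult)
  also have "\<dots> = norm (cnj (\<eta> * cnj \<zeta>) * (\<zeta> - of_real r * \<eta>))"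
    by (simp add: norm_mult)
  also have "cnj (\<eta> * cnj \<zeta>) * (\<zeta> - of_real r * \<eta>) = \<zeta> * \<zeta> * cnj \<eta> - of_real r * \<zeta> * (\<eta> * cnj \<eta>)"
    by (simp add: algebra_simps)
  also have "\<dots> = \<zeta> * (\<zeta> * cnj \<eta> - of_real r * (\<zeta> * cnj \<zeta>))"
    using assms by (simp add: right_diff_distrib mult_ac)
  also have "\<dots> = \<zeta> * \<zeta> * cnj (\<eta> - of_real r * \<zeta>)"
    by (simp add: algebra_simps)
  also have "norm \<dots> = norm (\<eta> - of_real r * \<zeta>)"
    using assms by (simp only: norm_mult complex_mod_cnj)
  finally show ?thesis using assms by (simp add: poisson_def norm_mult)
qed

lemma continuous_on_poisson:
  assumes "norm z < 1"
  shows "continuous_on (sphere 0 1) (poisson z)"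
  unfolding poisson_def[abs_def] using assms by (intro continuous_intros) auto

lemma poisson_measurable [measurable]: "poisson z \<in> borel_measurable circle_measure"
  unfolding poisson_def[abs_def] by measurable

text \<open>The kernel is twice the real part of a geometric series in
  \<open>cnj z * \<zeta>\<close>, minus 1; in this form its integrals against powers follow from
  orthogonality.\<close>

lemma poisson_eq:
  assumes z: "norm z < 1" and \<zeta>: "norm \<zeta> = 1"
  shows "of_real (poisson z \<zeta>) = (\<Sum>k. cnj z ^ k * \<zeta> ^ k) + cnj (\<Sum>k. cnj z ^ k * \<zeta> ^ k) - 1"
proof -
  have n: "norm (cnj z * \<zeta>) < 1" using z \<zeta> by (simp add: norm_mult)
  have "(\<Sum>k. cnj z ^ k * \<zeta> ^ k) = 1 / (1 - cnj z * \<zeta>)"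
    using suminf_geometric[OF n] by (simp add: power_mult_distrib)
  moreover have "cnj (1 / (1 - cnj z * \<zeta>)) = 1 / (1 - z * cnj \<zeta>)" by simp
  moreover have "of_real (poisson z \<zeta>) = (1 - z * cnj z) / ((\<zeta> - z) * cnj (\<zeta> - z))"
    unfolding poisson_def complex_norm_square[symmetric] by simp
  moreover have "(\<zeta> - z) * cnj (\<zeta> - z) = (1 - z * cnj \<zeta>) * (1 - cnj z * \<zeta>)"
  proof -
    have "(1 - z * cnj \<zeta>) * (1 - cnj z * \<zeta>) = 1 - z * cnj \<zeta> - cnj z * \<zeta> + z * cnj z * (\<zeta> * cnj \<zeta>)"
      by (simp add: algebra_simps)
    also have "\<dots> = \<zeta> * cnj \<zeta> - z * cnj \<zeta> - cnj z * \<zeta> + z * cnj z"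
      using \<zeta> by simp
    also have "\<dots> = (\<zeta> - z) * cnj (\<zeta> - z)" by (simp add: algebra_simps)
    finally show ?thesis by simp
  qed
  moreover have "1 - z * cnj z = 1 - (z * cnj \<zeta>) * (cnj z * \<zeta>)"
  proof -
    have "(z * cnj \<zeta>) * (cnj z * \<zeta>) = z * cnj z * (\<zeta> * cnj \<zeta>)" by (simp add: algebra_simps)
    then show ?thesis using \<zeta> by simp
  qed
  moreover have "cnj z * \<zeta> \<noteq> 1" "z * cnj \<zeta> \<noteq> 1"
  proof -
    show "cnj z * \<zeta> \<noteq> 1" using n by auto
    have "norm (z * cnj \<zeta>) < 1" using z \<zeta> by (simp add: norm_mult)
    then show "z * cnj \<zeta> \<noteq> 1" by auto
  qed
  moreover have "(1 - u * w) / ((1 - u) * (1 - w)) = 1 / (1 - w) + 1 / (1 - u) - 1"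
    if "u \<noteq> 1" "w \<noteq> 1" for u w :: complex
    using that by (simp add: divide_simps) (simp add: algebra_simps)
  ultimately show ?thesis by simp
qed

lemma poisson_power:
  assumes z: "norm z < 1"
  shows "(\<integral>\<zeta>. of_real (poisson z \<zeta>) * \<zeta> ^ n \<partial>circle_measure) = z ^ n"
proof -
  let ?S = "\<lambda>\<zeta>. \<Sum>k. cnj z ^ k * \<zeta> ^ k"
  have sm: "summable (\<lambda>k. norm (cnj z ^ k))"
    using z by (simp add: norm_power)
  have cont: "continuous_on (sphere 0 1) ?S"
  proof (rule uniform_limit_theorem)
    show "uniform_limit (sphere 0 1) (\<lambda>n \<zeta>. \<Sum>k<n. cnj z ^ k * \<zeta> ^ k) ?S sequentially"
      by (rule Weierstrass_m_test[OF _ sm]) (auto simp: norm_mult norm_power)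
  qed (auto intro!: always_eventually continuous_intros)
  have "(\<integral>\<zeta>. of_real (poisson z \<zeta>) * \<zeta> ^ n \<partial>circle_measure) =
     (\<integral>\<zeta>. ?S \<zeta> * \<zeta> ^ n + cnj (?S \<zeta> * cnj \<zeta> ^ n) - \<zeta> ^ n \<partial>circle_measure)"
    by (intro Bochner_Integration.integral_cong refl)
       (simp add: space_circle_measure poisson_eq[OF z] algebra_simps)
  also have "\<dots> = (\<integral>\<zeta>. ?S \<zeta> * \<zeta> ^ n \<partial>circle_measure) + (\<integral>\<zeta>. cnj (?S \<zeta> * cnj \<zeta> ^ n) \<partial>circle_measure)
                   - (\<integral>\<zeta>. \<zeta> ^ n \<partial>circle_measure)"
    by (subst Bochner_Integration.integral_diff Bochner_Integration.integral_add;
        (intro integrable_circle_continuous continuous_intros cont)?)+ simp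
  also have "(\<integral>\<zeta>. cnj (?S \<zeta> * cnj \<zeta> ^ n) \<partial>circle_measure) = cnj (\<integral>\<zeta>. ?S \<zeta> * cnj \<zeta> ^ n \<partial>circle_measure)"
    by (intro integral_bounded_linear bounded_linear_cnj integrable_circle_continuous continuous_intros cont)
  finally show ?thesis
    unfolding integral_circle_cnj_power_series[OF sm] integral_circle_power_power_series[OF sm]
    by (simp add: integral_circle_power)
qed

lemma integral_poisson:
  assumes z: "norm z < 1"
  shows "(\<integral>\<zeta>. poisson z \<zeta> \<partial>circle_measure) = 1"
  using poisson_power[OF z, of 0] by (simp add: integral_complex_of_real)

lemma poisson_poly:
  fixes p :: "complex poly"
  assumes z: "norm z < 1"
  shows "(\<integral>\<zeta>. poisson z \<zeta> * Re (poly p \<zeta>) \<partial>circle_measure) = Re (poly p z)"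
proof -
  have cont: "continuous_on (sphere 0 1) (\<lambda>\<zeta>. of_real (poisson z \<zeta>) * poly p \<zeta>)"
    by (intro continuous_intros continuous_on_poisson z)
  have "(\<integral>\<zeta>. of_real (poisson z \<zeta>) * poly p \<zeta> \<partial>circle_measure) =
     (\<integral>\<zeta>. (\<Sum>i\<le>degree p. coeff p i * (of_real (poisson z \<zeta>) * \<zeta> ^ i)) \<partial>circle_measure)"
    by (simp add: poly_altdef sum_distrib_left mult_ac)
  also have "\<dots> = (\<Sum>i\<le>degree p. \<integral>\<zeta>. coeff p i * (of_real (poisson z \<zeta>) * \<zeta> ^ i) \<partial>circle_measure)"
    by (intro Bochner_Integration.integral_sum integrable_circle_continuous continuous_intros continuous_on_poisson z)
  also have "\<dots> = poly p z"
    by (simp add: poisson_power[OF z] poly_altdef)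
  finally have "poly p z = (\<integral>\<zeta>. of_real (poisson z \<zeta>) * poly p \<zeta> \<partial>circle_measure)" by simp
  then have "Re (poly p z) = (\<integral>\<zeta>. Re (of_real (poisson z \<zeta>) * poly p \<zeta>) \<partial>circle_measure)"
    using integral_bounded_linear[OF bounded_linear_Re integrable_circle_continuous[OF cont]] by simp
  then show ?thesis by simp
qed

text \<open>On the circle \<open>cnj \<zeta>\<close> is the inverse of \<zeta>, so the product is a
  trigonometric polynomial, and a term of negative frequency has the same real part as its
  conjugate, which has positive frequency. The factor \<open>\<zeta> ^ m\<close> absorbs the powers
  split off from \<open>p\<close> during the induction.\<close>

lemma Re_poly_cnj_circle:
  fixes p q :: "complex poly"
  shows "\<exists>r. \<forall>\<zeta>\<in>sphere 0 1. Re (\<zeta> ^ m * poly p \<zeta> * cnj (poly q \<zeta>)) = Re (poly r \<zeta>)"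
proof (induction p arbitrary: m)
  case 0
  then show ?case by (auto intro!: exI[of _ 0])
next
  case (pCons a p)
  have *: "\<exists>r. \<forall>\<zeta>\<in>sphere 0 1. Re (\<zeta> ^ m * cnj (poly q \<zeta>)) = Re (poly r \<zeta>)" for q :: "complex poly" and m
  proof (induction m arbitrary: q)
    case 0
    then show ?case by (auto intro!: exI[of _ q])
  next
    case (Suc m)
    obtain b q' where q: "q = pCons b q'" by (cases q)
    obtain r where r: "\<forall>\<zeta>\<in>sphere 0 1. Re (\<zeta> ^ m * cnj (poly q' \<zeta>)) = Re (poly r \<zeta>)"
      using Suc by blast
    have "Re (\<zeta> ^ Suc m * cnj (poly q \<zeta>)) = Re (poly (monom (cnj b) (Suc m) + r) \<zeta>)"
      if "\<zeta> \<in> sphere 0 1" for \<zeta>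
    proof -
      have "\<zeta> ^ Suc m * cnj (poly q \<zeta>) = cnj b * \<zeta> ^ Suc m + (\<zeta> * cnj \<zeta>) * (\<zeta> ^ m * cnj (poly q' \<zeta>))"
        by (simp add: q algebra_simps)
      also have "\<zeta> * cnj \<zeta> = 1" using that by simp
      finally show ?thesis using r that by (simp add: poly_monom)
    qed
    then show ?case by blast
  qed
  obtain r1 where r1: "\<forall>\<zeta>\<in>sphere 0 1. Re (\<zeta> ^ m * cnj (poly (smult (cnj a) q) \<zeta>)) = Re (poly r1 \<zeta>)"
    using * by blast
  obtain r2 where r2: "\<forall>\<zeta>\<in>sphere 0 1. Re (\<zeta> ^ Suc m * poly p \<zeta> * cnj (poly q \<zeta>)) = Re (poly r2 \<zeta>)"
    using pCons.IH by blast
  have "Re (\<zeta> ^ m * poly (pCons a p) \<zeta> * cnj (poly q \<zeta>)) = Re (poly (r1 + r2) \<zeta>)" if "\<zeta> \<in> sphere 0 1" for \<zeta>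
  proof -
    have "\<zeta> ^ m * poly (pCons a p) \<zeta> * cnj (poly q \<zeta>) =
      \<zeta> ^ m * cnj (poly (smult (cnj a) q) \<zeta>) + \<zeta> ^ Suc m * poly p \<zeta> * cnj (poly q \<zeta>)"
      by (simp add: algebra_simps)
    then show ?thesis using r1 r2 that by simp
  qed
  then show ?case by blast
qed

text \<open>This makes Stone-Weierstrass deliver harmonic approximants: the Poisson integral of the
  real part of a polynomial is known from \<open>poisson_poly\<close>.\<close>

lemma real_polynomial_function_circle:
  assumes "real_polynomial_function g"
  shows "\<exists>p. \<forall>\<zeta>\<in>sphere 0 1. g \<zeta> = Re (poly p \<zeta>)"
  using assms
proof induction
  case (linear f)
  then interpret bounded_linear f .
  have "f \<zeta> = Re (poly [:0, Complex (f 1) (- f \<i>):] \<zeta>)" for \<zeta>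
  proof -
    have "\<zeta> = Re \<zeta> *\<^sub>R 1 + Im \<zeta> *\<^sub>R \<i>" by (simp add: complex_eq_iff)
    then have "f \<zeta> = Re \<zeta> * f 1 + Im \<zeta> * f \<i>" by (metis add scale real_scaleR_def)
    then show ?thesis by simp
  qed
  then show ?case by blast
next
  case (const c)
  show ?case by (rule exI[of _ "[:of_real c:]"]) simp
next
  case (add f g)
  then obtain p q where "\<forall>\<zeta>\<in>sphere 0 1. f \<zeta> = Re (poly p \<zeta>)" "\<forall>\<zeta>\<in>sphere 0 1. g \<zeta> = Re (poly q \<zeta>)" by blast
  then show ?case by (intro exI[of _ "p + q"]) auto
next
  case (mult f g)
  then obtain p q where pq: "\<forall>\<zeta>\<in>sphere 0 1. f \<zeta> = Re (poly p \<zeta>)" "\<forall>\<zeta>\<in>sphere 0 1. g \<zeta> = Re (poly q \<zeta>)" by blast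
  obtain r where r: "\<forall>\<zeta>\<in>sphere 0 1. Re (\<zeta> ^ 0 * poly p \<zeta> * cnj (poly q \<zeta>)) = Re (poly r \<zeta>)"
    using Re_poly_cnj_circle by blast
  \<comment> \<open>\<open>Re u * Re v\<close> is half the real part of
    \<open>u * v + u * cnj v\<close>; \<open>r\<close> stands for the second product.\<close>
  have "f \<zeta> * g \<zeta> = Re (poly (smult (1/2) (p * q + r)) \<zeta>)" if "\<zeta> \<in> sphere 0 1" for \<zeta>
  proof -
    have "Re (poly r \<zeta>) = Re (poly p \<zeta>) * Re (poly q \<zeta>) + Im (poly p \<zeta>) * Im (poly q \<zeta>)"
      using r that by auto
    then show ?thesis using pq that by simp
  qed
  then show ?case by blast
qed

section \<open>The function \<open>log_plus\<close> and its Poisson majorants\<close>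

lemma log_plus_nonneg: "0 \<le> log_plus x"
  by (simp add: log_plus_def)

lemma exp_log_plus: "exp (log_plus x) = max 1 x"
  by (simp add: log_plus_def)

lemma continuous_on_log_plus [continuous_intros]:
  "continuous_on S g \<Longrightarrow> continuous_on S (\<lambda>x. log_plus (g x))"
  unfolding log_plus_def by (intro continuous_intros) auto

lemma log_plus_measurable [measurable]: "log_plus \<in> borel_measurable borel"
  by (intro borel_measurable_continuous_onI continuous_intros)

text \<open>
  By Stone-Weierstrass the boundary values of \<open>log_plus (norm g)\<close> lie just below those of the real part
  of a polynomial \<open>p\<close>, and the maximum principle applies to \<open>g * exp (- p)\<close>.
\<close>

lemma log_plus_poisson:
  assumes hol: "g holomorphic_on ball 0 1" and cont: "continuous_on (cball 0 1) g" and z: "norm z < 1"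
  shows "log_plus (norm (g z)) \<le> (\<integral>\<zeta>. poisson z \<zeta> * log_plus (norm (g \<zeta>)) \<partial>circle_measure)"
proof (rule field_le_epsilon)
  fix e :: real assume e: "0 < e"
  let ?v = "\<lambda>\<zeta>. log_plus (norm (g \<zeta>))"
  have contv: "continuous_on (sphere 0 1) ?v"
    by (intro continuous_intros continuous_on_subset[OF cont]) auto
  \<comment> \<open>Approximating \<open>?v + e/2\<close> to within \<open>e/2\<close> confines
    \<open>T\<close> to the band between \<open>?v\<close> and \<open>?v + e\<close>.\<close>
  have "continuous_on (sphere 0 1) (\<lambda>\<zeta>. ?v \<zeta> + e/2)"
    by (intro continuous_on_add contv continuous_on_const)
  then obtain T where T: "real_polynomial_function T" "\<And>\<zeta>. \<zeta> \<in> sphere 0 1 \<Longrightarrow> \<bar>?v \<zeta> + e/2 - T \<zeta>\<bar> < e/2"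
    using Stone_Weierstrass_real_polynomial_function[of "sphere 0 1" "\<lambda>\<zeta>. ?v \<zeta> + e/2" "e/2"] half_gt_zero[OF e] compact_sphere by blast
  obtain p where p: "\<forall>\<zeta>\<in>sphere 0 1. T \<zeta> = Re (poly p \<zeta>)"
    using real_polynomial_function_circle[OF T(1)] by blast
  have lo: "?v \<zeta> \<le> Re (poly p \<zeta>)" and hi: "Re (poly p \<zeta>) \<le> ?v \<zeta> + e" if "\<zeta> \<in> sphere 0 1" for \<zeta>
    using T(2)[OF that] p[rule_format, OF that] by linarith+
  have ne: "norm (g w * exp (- poly p w)) \<le> 1 \<longleftrightarrow> norm (g w) \<le> exp (Re (poly p w))" for w
  proof -
    have "norm (g w * exp (- poly p w)) = norm (g w) / exp (Re (poly p w))"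
      by (simp only: norm_mult norm_inverse norm_exp_eq_Re exp_minus divide_inverse)
    then show ?thesis by (simp only: divide_le_eq_1_pos exp_gt_zero)
  qed
  have "norm (g z * exp (- poly p z)) \<le> 1"
  proof (rule maximum_modulus_frontier[where S = "cball 0 1" and f = "\<lambda>z. g z * exp (- poly p z)"])
    show "(\<lambda>z. g z * exp (- poly p z)) holomorphic_on interior (cball 0 1)"
      unfolding interior_cball by (intro holomorphic_intros hol)
    show "continuous_on (closure (cball 0 1)) (\<lambda>z. g z * exp (- poly p z))"
      unfolding closure_closed[OF closed_cball] by (intro continuous_intros cont)
    fix \<zeta> assume "\<zeta> \<in> frontier (cball (0::complex) 1)"
    then have \<zeta>: "\<zeta> \<in> sphere 0 1" by simp
    have "norm (g \<zeta>) \<le> exp (?v \<zeta>)" by (simp add: exp_log_plus)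
    also have "\<dots> \<le> exp (Re (poly p \<zeta>))" using lo[OF \<zeta>] by simp
    finally show "norm (g \<zeta> * exp (- poly p \<zeta>)) \<le> 1"
      unfolding ne .
  qed (use z in auto)
  then have "norm (g z) \<le> exp (Re (poly p z))"
    unfolding ne .
  moreover have P: "Re (poly p z) = (\<integral>\<zeta>. poisson z \<zeta> * Re (poly p \<zeta>) \<partial>circle_measure)"
    by (simp add: poisson_poly[OF z])
  \<comment> \<open>\<open>log_plus\<close> is the logarithm of a maximum with 1, so the bound on
    \<open>norm (g z)\<close> transfers only if its right-hand side is at least 1.\<close>
  moreover have "0 \<le> Re (poly p z)"
    unfolding P
    by (intro Bochner_Integration.integral_nonneg mult_nonneg_nonneg poisson_nonneg z order_trans[OF log_plus_nonneg lo])
       (auto simp: space_circle_measure)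
  ultimately have "log_plus (norm (g z)) \<le> Re (poly p z)"
    using ln_le_cancel_iff[of "max 1 (norm (g z))" "exp (Re (poly p z))"] by (simp add: log_plus_def)
  also have "\<dots> \<le> (\<integral>\<zeta>. poisson z \<zeta> * ?v \<zeta> + poisson z \<zeta> * e \<partial>circle_measure)"
    unfolding P
  proof (rule integral_mono)
    fix \<zeta> assume "\<zeta> \<in> space circle_measure"
    then have "poisson z \<zeta> * Re (poly p \<zeta>) \<le> poisson z \<zeta> * (?v \<zeta> + e)"
      by (intro mult_left_mono hi poisson_nonneg z) (auto simp: space_circle_measure)
    then show "poisson z \<zeta> * Re (poly p \<zeta>) \<le> poisson z \<zeta> * ?v \<zeta> + poisson z \<zeta> * e"
      by (simp add: algebra_simps)
  qed (intro integrable_circle_continuous continuous_intros continuous_on_poisson z contv)+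
  also have "\<dots> = (\<integral>\<zeta>. poisson z \<zeta> * ?v \<zeta> \<partial>circle_measure) + e"
    by (subst Bochner_Integration.integral_add)
       (auto intro!: integrable_circle_continuous continuous_intros continuous_on_poisson z contv simp: integral_poisson[OF z])
  finally show "log_plus (norm (g z)) \<le> (\<integral>\<zeta>. poisson z \<zeta> * ?v \<zeta> \<partial>circle_measure) + e" .
qed

section \<open>Nontangential limits\<close>

lemma stolz_region_mono: "\<kappa> \<le> \<kappa>' \<Longrightarrow> stolz_region \<kappa> \<zeta> \<subseteq> stolz_region \<kappa>' \<zeta>"
proof
  fix z assume le: "\<kappa> \<le> \<kappa>'" and z: "z \<in> stolz_region \<kappa> \<zeta>"
  have "\<kappa> * (1 - norm z) \<le> \<kappa>' * (1 - norm z)"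
    using le z by (intro mult_right_mono) (auto simp: stolz_region_def)
  moreover have "norm (z - \<zeta>) < \<kappa> * (1 - norm z)" "z \<in> ball 0 1"
    using z by (simp_all add: stolz_region_def)
  ultimately show "z \<in> stolz_region \<kappa>' \<zeta>"
    unfolding stolz_region_def mem_Collect_eq by linarith
qed

lemma norm_dilate_diff:
  fixes \<zeta> :: complex
  assumes "norm \<zeta> = 1" "r \<le> 1"
  shows "norm (of_real r * \<zeta> - \<zeta>) = 1 - r"
proof -
  have "of_real r * \<zeta> - \<zeta> = of_real (r - 1) * \<zeta>" by (simp add: algebra_simps)
  then have "norm (of_real r * \<zeta> - \<zeta>) = \<bar>r - 1\<bar> * norm \<zeta>" by (simp only: norm_mult norm_of_real)
  then show ?thesis using assms by simp
qed

lemma radial_in_stolz_region: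
  assumes "norm \<zeta> = 1" "0 \<le> r" "r < 1" "1 < \<kappa>"
  shows "of_real r * \<zeta> \<in> stolz_region \<kappa> \<zeta>"
  using assms norm_dilate_diff[of \<zeta> r] by (simp add: stolz_region_def norm_mult)

lemma filterlim_radial:
  assumes "norm \<zeta> = 1" "1 < \<kappa>"
  shows "filterlim (\<lambda>r. of_real r * \<zeta>) (at \<zeta> within stolz_region \<kappa> \<zeta>) (at_left 1)"
  unfolding filterlim_at
proof
  have "((\<lambda>r. complex_of_real r * \<zeta>) \<longlongrightarrow> of_real 1 * \<zeta>) (at_left 1)"
    by (intro tendsto_intros)
  then show "((\<lambda>r. of_real r * \<zeta>) \<longlongrightarrow> \<zeta>) (at_left 1)" by simp
  have "eventually (\<lambda>r::real. r \<in> {0<..<1}) (at_left 1)"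
    by (intro eventually_at_left_real) simp
  then show "eventually (\<lambda>r. of_real r * \<zeta> \<in> stolz_region \<kappa> \<zeta> \<and> of_real r * \<zeta> \<noteq> \<zeta>) (at_left 1)"
  proof eventually_elim
    case (elim r)
    then have "of_real r * \<zeta> \<in> stolz_region \<kappa> \<zeta>"
      by (intro radial_in_stolz_region assms) auto
    moreover have "norm (of_real r * \<zeta>) \<noteq> norm \<zeta>" using elim assms by (simp add: norm_mult)
    ultimately show ?case by auto
  qed
qed

lemma nontangential_radial:
  assumes "has_nontangential_limit f \<zeta> L" "norm \<zeta> = 1"
  shows "((\<lambda>r. f (of_real r * \<zeta>)) \<longlongrightarrow> L) (at_left 1)"
proof -
  have "(f \<longlongrightarrow> L) (at \<zeta> within stolz_region 2 \<zeta>)"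
    using assms by (simp add: has_nontangential_limit_def)
  from filterlim_compose[OF this filterlim_radial[of \<zeta> 2]] show ?thesis using assms by simp
qed

lemma boundary_fun_eq:
  assumes "has_nontangential_limit f \<zeta> L" "norm \<zeta> = 1"
  shows "boundary_fun f \<zeta> = L"
proof -
  have uniq: "L' = L" if "has_nontangential_limit f \<zeta> L'" for L'
    using tendsto_unique[OF _ nontangential_radial[OF that assms(2)] nontangential_radial[OF assms]]
    by (simp add: trivial_limit_at_left_real)
  have "(THE L. has_nontangential_limit f \<zeta> L) = L"
    by (rule the_equality) (rule assms(1), rule uniq)
  moreover have "\<exists>L. has_nontangential_limit f \<zeta> L" using assms(1) by (rule exI)
  ultimately show ?thesis by (simp only: boundary_fun_def if_True)
qed

text \<open>Radii increasing to 1, so that limits at the circle can be taken along a sequence, as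
  measurability and Fatou's lemma require.\<close>

definition radius :: "nat \<Rightarrow> real" where
  "radius n = 1 - 1 / real (n + 2)"

lemma radius_bounds: "0 < radius n" "0 \<le> radius n" "radius n < 1"
  by (simp_all add: radius_def divide_less_eq divide_le_eq)

lemma radius_tendsto: "radius \<longlonglongrightarrow> 1"
  using tendsto_diff[OF tendsto_const LIMSEQ_ignore_initial_segment[OF lim_1_over_n, of 2], of "1::real"]
  by (simp add: radius_def[abs_def])

lemma filterlim_radius: "filterlim radius (at_left 1) sequentially"
  unfolding filterlim_at
  by (intro conjI radius_tendsto always_eventually allI)
     (simp_all add: radius_bounds(3) radius_bounds(3)[THEN less_imp_neq])

text \<open>All parameters are made countable in order to prove measurability. The apertures
  \<open>real k + 2\<close> are cofinal among those above 1, and strict and weak inequalities are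
  placed so that each instance of the condition describes a closed set of points \<zeta>.\<close>

lemma has_nontangential_limit_iff_Cauchy:
  fixes f :: "complex \<Rightarrow> complex"
  assumes \<zeta>: "norm \<zeta> = 1"
  shows "(\<exists>L. has_nontangential_limit f \<zeta> L) \<longleftrightarrow>
    (\<forall>k n. \<exists>m. \<forall>z\<in>stolz_region (real k + 2) \<zeta>. \<forall>w\<in>stolz_region (real k + 2) \<zeta>.
        norm (z - \<zeta>) < inverse (real (Suc m)) \<longrightarrow> norm (w - \<zeta>) < inverse (real (Suc m)) \<longrightarrow>
        norm (f z - f w) \<le> inverse (real (Suc n)))" (is "?L \<longleftrightarrow> ?R")
proof
  assume ?L
  then obtain L where L: "has_nontangential_limit f \<zeta> L" by blast
  show ?R
  proof (intro allI)
    fix k n :: nat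
    let ?S = "stolz_region (real k + 2) \<zeta>"
    have "(f \<longlongrightarrow> L) (at \<zeta> within ?S)" using L by (simp add: has_nontangential_limit_def)
    then have "\<exists>d>0. \<forall>z\<in>?S. 0 < dist z \<zeta> \<and> dist z \<zeta> < d \<longrightarrow> dist (f z) L < inverse (real (Suc n)) / 2"
      unfolding tendsto_iff eventually_at zero_less_dist_iff
      by (elim allE[of _ "inverse (real (Suc n)) / 2"] impE) (simp only: half_gt_zero_iff inverse_positive_iff_positive of_nat_0_less_iff zero_less_Suc)
    then obtain d where d: "d > 0" "\<And>z. z \<in> ?S \<Longrightarrow> 0 < dist z \<zeta> \<Longrightarrow> dist z \<zeta> < d \<Longrightarrow> dist (f z) L < inverse (real (Suc n)) / 2"
      by blast
    obtain m where m: "inverse (real (Suc m)) < d" using d(1) reals_Archimedean by blast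
    have *: "dist (f z) L < inverse (real (Suc n)) / 2" if "z \<in> ?S" "norm (z - \<zeta>) < inverse (real (Suc m))" for z
      using that m \<zeta> by (intro d) (auto simp: dist_norm stolz_region_def)
    show "\<exists>m. \<forall>z\<in>?S. \<forall>w\<in>?S. norm (z - \<zeta>) < inverse (real (Suc m)) \<longrightarrow> norm (w - \<zeta>) < inverse (real (Suc m)) \<longrightarrow>
        norm (f z - f w) \<le> inverse (real (Suc n))"
    proof (intro exI[of _ m] ballI impI)
      fix z w assume "z \<in> ?S" "w \<in> ?S" "norm (z - \<zeta>) < inverse (real (Suc m))" "norm (w - \<zeta>) < inverse (real (Suc m))"
      then have "dist (f z) L < inverse (real (Suc n)) / 2" "dist (f w) L < inverse (real (Suc n)) / 2"
        using * by blast+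
      then have "dist (f z) (f w) < inverse (real (Suc n))" by (rule dist_triangle_half_l)
      then show "norm (f z - f w) \<le> inverse (real (Suc n))" by (simp add: dist_norm)
    qed
  qed
next
  assume R: ?R
  \<comment> \<open>The radial points lie in every Stolz region, so a single sequence yields the
    same limit for all apertures.\<close>
  define z where "z j = of_real (radius j) * \<zeta>" for j
  have zS: "z j \<in> stolz_region (real k + 2) \<zeta>" for j k
    unfolding z_def by (intro radial_in_stolz_region \<zeta>) (auto simp: radius_bounds)
  have zlim: "z \<longlonglongrightarrow> \<zeta>"
  proof -
    have "(\<lambda>j. of_real (radius j) * \<zeta>) \<longlonglongrightarrow> of_real 1 * \<zeta>"
      by (intro tendsto_intros radius_tendsto)
    then show ?thesis by (simp add: z_def[abs_def])
  qed
  have ev: "eventually (\<lambda>j. norm (z j - \<zeta>) < inverse (real (Suc m))) sequentially" for m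
    using tendstoD[OF zlim, of "inverse (real (Suc m))"] by (simp add: dist_norm)
  have "Cauchy (\<lambda>j. f (z j))"
  proof (rule metric_CauchyI)
    fix e :: real assume "0 < e"
    then obtain n where n: "inverse (real (Suc n)) < e" using reals_Archimedean by blast
    obtain m where m: "\<And>u w. u \<in> stolz_region (real 0 + 2) \<zeta> \<Longrightarrow> w \<in> stolz_region (real 0 + 2) \<zeta> \<Longrightarrow>
        norm (u - \<zeta>) < inverse (real (Suc m)) \<Longrightarrow> norm (w - \<zeta>) < inverse (real (Suc m)) \<Longrightarrow>
        norm (f u - f w) \<le> inverse (real (Suc n))" using R by meson
    obtain N where N: "\<And>j. j \<ge> N \<Longrightarrow> norm (z j - \<zeta>) < inverse (real (Suc m))"
      using ev unfolding eventually_sequentially by blast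
    show "\<exists>M. \<forall>i\<ge>M. \<forall>j\<ge>M. dist (f (z i)) (f (z j)) < e"
    proof (intro exI[of _ N] allI impI)
      fix i j assume "N \<le> i" "N \<le> j"
      then have "norm (f (z i) - f (z j)) \<le> inverse (real (Suc n))" by (intro m zS N)
      then show "dist (f (z i)) (f (z j)) < e" using n by (simp add: dist_norm)
    qed
  qed
  then obtain L where L: "(\<lambda>j. f (z j)) \<longlonglongrightarrow> L" using Cauchy_convergent_iff convergent_def by blast
  have "has_nontangential_limit f \<zeta> L"
    unfolding has_nontangential_limit_def
  proof (intro allI impI)
    fix \<kappa> :: real assume "1 < \<kappa>"
    obtain k :: nat where k: "\<kappa> \<le> real k" using real_arch_simple by blast
    have sub: "stolz_region \<kappa> \<zeta> \<subseteq> stolz_region (real k + 2) \<zeta>"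
      by (rule stolz_region_mono) (use k in auto)
    show "(f \<longlongrightarrow> L) (at \<zeta> within stolz_region \<kappa> \<zeta>)"
      unfolding tendsto_iff eventually_at
    proof (intro allI impI)
      fix e :: real assume "0 < e"
      then obtain n where n: "inverse (real (Suc n)) < e" using reals_Archimedean by blast
      obtain m where m: "\<And>u w. u \<in> stolz_region (real k + 2) \<zeta> \<Longrightarrow> w \<in> stolz_region (real k + 2) \<zeta> \<Longrightarrow>
        norm (u - \<zeta>) < inverse (real (Suc m)) \<Longrightarrow> norm (w - \<zeta>) < inverse (real (Suc m)) \<Longrightarrow>
        norm (f u - f w) \<le> inverse (real (Suc n))" using R by meson
      show "\<exists>d>0. \<forall>u\<in>stolz_region \<kappa> \<zeta>. u \<noteq> \<zeta> \<and> dist u \<zeta> < d \<longrightarrow> dist (f u) L < e"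
      proof (intro exI[of _ "inverse (real (Suc m))"] conjI ballI impI)
        fix u assume u: "u \<in> stolz_region \<kappa> \<zeta>" "u \<noteq> \<zeta> \<and> dist u \<zeta> < inverse (real (Suc m))"
        have "(\<lambda>j. norm (f u - f (z j))) \<longlonglongrightarrow> norm (f u - L)"
          by (intro tendsto_intros L)
        moreover have "eventually (\<lambda>j. norm (f u - f (z j)) \<le> inverse (real (Suc n))) sequentially"
          using ev[of m] by eventually_elim (use u sub zS m in \<open>auto simp: dist_norm\<close>)
        ultimately have "norm (f u - L) \<le> inverse (real (Suc n))"
          by (rule tendsto_upperbound) simp
        then show "dist (f u) L < e" using n by (simp add: dist_norm)
      qed simp
    qed
  qed
  then show ?L by blast
qed

text \<open>A pair of points \<open>z\<close>, \<open>w\<close> violates the Cauchy condition for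
  all \<zeta> of an open set, and uncountable unions of open sets are open; closedness of the sets
  \<open>B k n m\<close> thus comes from the geometry of the Stolz regions.\<close>

lemma nontangential_set_measurable:
  fixes f :: "complex \<Rightarrow> complex"
  shows "{\<zeta> \<in> space circle_measure. \<exists>L. has_nontangential_limit f \<zeta> L} \<in> sets circle_measure"
proof -
  define B where "B k n m = {\<zeta> \<in> sphere 0 1. \<forall>z\<in>stolz_region (real k + 2) \<zeta>. \<forall>w\<in>stolz_region (real k + 2) \<zeta>.
        norm (z - \<zeta>) < inverse (real (Suc m)) \<longrightarrow> norm (w - \<zeta>) < inverse (real (Suc m)) \<longrightarrow>
        norm (f z - f w) \<le> inverse (real (Suc n))}" for k n m :: nat
  have "B k n m \<in> sets circle_measure" for k n m
  proof -
    define U where "U z w = ball z (min ((real k + 2) * (1 - norm z)) (inverse (real (Suc m)))) \<inter>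
       ball w (min ((real k + 2) * (1 - norm w)) (inverse (real (Suc m))))" for z w :: complex
    let ?G = "\<Union>{U z w | z w. z \<in> ball 0 1 \<and> w \<in> ball 0 1 \<and> inverse (real (Suc n)) < norm (f z - f w)}"
    have U: "\<zeta> \<in> U z w \<longleftrightarrow> norm (z - \<zeta>) < (real k + 2) * (1 - norm z) \<and> norm (z - \<zeta>) < inverse (real (Suc m)) \<and>
        norm (w - \<zeta>) < (real k + 2) * (1 - norm w) \<and> norm (w - \<zeta>) < inverse (real (Suc m))" for z w \<zeta>
      by (auto simp: U_def dist_norm)
    have "B k n m = (\<lambda>x. x) -` (- ?G) \<inter> space circle_measure"
    proof (rule set_eqI)
      fix \<zeta>
      have "\<zeta> \<in> ?G \<longleftrightarrow> (\<exists>z w. \<zeta> \<in> U z w \<and> norm z < 1 \<and> norm w < 1 \<and> \<not> norm (f z - f w) \<le> inverse (real (Suc n)))"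
        by (simp add: not_le) blast
      then show "\<zeta> \<in> B k n m \<longleftrightarrow> \<zeta> \<in> (\<lambda>x. x) -` (- ?G) \<inter> space circle_measure"
        unfolding U B_def space_circle_measure stolz_region_def by (simp only: mem_Collect_eq Int_iff vimage_eq Compl_iff mem_ball_0) blast
    qed
    moreover have "open ?G" by (intro open_Union) (auto simp: U_def)
    ultimately show ?thesis using measurable_sets[OF id_measurable_circle borel_comp[OF borel_open]] by (simp only:)
  qed
  then have "(\<Inter>k. \<Inter>n. \<Union>m. B k n m) \<in> sets circle_measure" by auto
  also have "(\<Inter>k. \<Inter>n. \<Union>m. B k n m) = {\<zeta> \<in> space circle_measure. \<exists>L. has_nontangential_limit f \<zeta> L}"
  proof (rule set_eqI)
    fix \<zeta> :: complex
    show "\<zeta> \<in> (\<Inter>k. \<Inter>n. \<Union>m. B k n m) \<longleftrightarrow>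
      \<zeta> \<in> {\<zeta> \<in> space circle_measure. \<exists>L. has_nontangential_limit f \<zeta> L}"
    proof (cases "norm \<zeta> = 1")
      case True
      then show ?thesis
        using has_nontangential_limit_iff_Cauchy[OF True, of f] by (simp add: B_def space_circle_measure)
    qed (simp add: B_def space_circle_measure)
  qed
  finally show ?thesis .
qed

lemma dilate_measurable:
  assumes "f holomorphic_on ball 0 1" "0 \<le> r" "r < 1"
  shows "(\<lambda>\<zeta>. f (of_real r * \<zeta>)) \<in> borel_measurable circle_measure"
  by (intro borel_measurable_circle_continuous continuous_on_circle_dilate assms)

text \<open>On the measurable set where the nontangential limit exists it is the pointwise limit
  along \<open>radius\<close>; elsewhere the default value 0 is constant.\<close>

lemma boundary_fun_measurable:
  assumes f: "f holomorphic_on ball 0 1"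
  shows "boundary_fun f \<in> borel_measurable circle_measure"
proof -
  let ?E = "{\<zeta> \<in> space circle_measure. \<exists>L. has_nontangential_limit f \<zeta> L}"
  let ?g = "\<lambda>\<zeta>. if \<zeta> \<in> ?E then lim (\<lambda>n. f (of_real (radius n) * \<zeta>)) else 0"
  have [measurable]: "(\<lambda>\<zeta>. f (of_real (radius n) * \<zeta>)) \<in> borel_measurable circle_measure" for n
    by (intro dilate_measurable f radius_bounds)
  have [measurable]: "?E \<in> sets circle_measure" by (rule nontangential_set_measurable)
  have "?g \<in> borel_measurable circle_measure"
    by (intro measurable_If_set borel_measurable_lim_metric) (auto intro!: sets.Int)
  also have "?g \<in> borel_measurable circle_measure \<longleftrightarrow> ?thesis"
  proof (rule measurable_cong)
    fix \<zeta> assume \<zeta>: "\<zeta> \<in> space circle_measure"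
    show "?g \<zeta> = boundary_fun f \<zeta>"
    proof (cases "\<exists>L. has_nontangential_limit f \<zeta> L")
      case True
      then obtain L where L: "has_nontangential_limit f \<zeta> L" by blast
      have n: "norm \<zeta> = 1" using \<zeta> by (simp add: space_circle_measure)
      have "lim (\<lambda>n. f (of_real (radius n) * \<zeta>)) = L"
        by (rule limI[OF filterlim_compose[OF nontangential_radial[OF L n] filterlim_radius]])
      then show ?thesis using boundary_fun_eq[OF L n] \<zeta> True by simp
    next
      case False
      then have "\<zeta> \<notin> ?E" by blast
      then show ?thesis using False by (simp only: boundary_fun_def if_False)
    qed
  qed
  finally show ?thesis .
qed

section \<open>The Smirnov class\<close>

lemma smirnov_holomorphic: "f \<in> smirnov \<Longrightarrow> f holomorphic_on ball 0 1"
  by (simp add: smirnov_def nevanlinna_def disk_holomorphic_def)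

lemma smirnov_log_plus_finite:
  assumes "f \<in> smirnov"
  shows "(\<integral>\<^sup>+\<zeta>. ennreal (log_plus (norm (boundary_fun f \<zeta>))) \<partial>circle_measure) < \<infinity>"
proof -
  let ?I = "\<lambda>r. \<integral>\<^sup>+\<zeta>. ennreal (log_plus (norm (f (of_real r * \<zeta>)))) \<partial>circle_measure"
  have "eventually (\<lambda>r::real. r \<in> {0<..<1}) (at_left 1)"
    by (intro eventually_at_left_real) simp
  then have "eventually (\<lambda>r. ?I r \<le> (SUP r\<in>{0<..<1}. ?I r)) (at_left 1)"
    by eventually_elim (rule SUP_upper)
  with assms have "(\<integral>\<^sup>+\<zeta>. ennreal (log_plus (norm (boundary_fun f \<zeta>))) \<partial>circle_measure) \<le> (SUP r\<in>{0<..<1}. ?I r)"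
    by (intro tendsto_upperbound[where F = "at_left 1" and f = ?I]) (auto simp: smirnov_def)
  also have "\<dots> < \<infinity>" using assms by (simp add: smirnov_def nevanlinna_def)
  finally show ?thesis .
qed

lemma smirnov_log_plus_integrable:
  assumes "f \<in> smirnov"
  shows "integrable circle_measure (\<lambda>\<zeta>. log_plus (norm (boundary_fun f \<zeta>)))"
proof (rule integrableI_nonneg)
  have [measurable]: "boundary_fun f \<in> borel_measurable circle_measure"
    by (rule boundary_fun_measurable[OF smirnov_holomorphic[OF assms]])
  show "(\<lambda>\<zeta>. log_plus (norm (boundary_fun f \<zeta>))) \<in> borel_measurable circle_measure"
    by measurable
qed (use smirnov_log_plus_finite[OF assms] log_plus_nonneg in auto)

lemma integrable_poisson_mult:
  assumes z: "norm z < 1" and h: "integrable circle_measure h"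
  shows "integrable circle_measure (\<lambda>\<zeta>. poisson z \<zeta> * h \<zeta>)"
proof (rule Bochner_Integration.integrable_bound)
  show "integrable circle_measure (\<lambda>\<zeta>. 2 / (1 - norm z) * h \<zeta>)" using h by simp
  show "(\<lambda>\<zeta>. poisson z \<zeta> * h \<zeta>) \<in> borel_measurable circle_measure" using h by measurable
  show "AE \<zeta> in circle_measure. norm (poisson z \<zeta> * h \<zeta>) \<le> norm (2 / (1 - norm z) * h \<zeta>)"
  proof (rule AE_I2)
    fix \<zeta> assume "\<zeta> \<in> space circle_measure"
    then have "\<bar>poisson z \<zeta>\<bar> \<le> \<bar>2 / (1 - norm z)\<bar>"
      using poisson_le[OF z, of \<zeta>] poisson_nonneg[OF z, of \<zeta>] z by (simp add: space_circle_measure)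
    then show "norm (poisson z \<zeta> * h \<zeta>) \<le> norm (2 / (1 - norm z) * h \<zeta>)"
      unfolding real_norm_def abs_mult by (intro mult_right_mono) auto
  qed
qed

text \<open>
  Fatou's theorem on the existence of boundary values is not needed: where the nontangential limit fails
  to exist the boundary function is 0, so Fatou's lemma applies to the functions \<open>(M - P) * L n\<close> all the
  same, and convergence of the integrals of \<open>L n\<close> turns the lower bound into an upper bound for the Poisson
  integrals.
\<close>

lemma smirnov_poisson:
  assumes f: "f \<in> smirnov" and z: "norm z < 1"
  shows "log_plus (norm (f z)) \<le> (\<integral>\<zeta>. poisson z \<zeta> * log_plus (norm (boundary_fun f \<zeta>)) \<partial>circle_measure)"
proof -
  \<comment> \<open>\<open>M\<close> bounds the kernel, so \<open>M - poisson z\<close> is a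
    nonnegative weight, as Fatou's lemma demands.\<close>
  define M where "M = 2 / (1 - norm z)"
  define L where "L n \<zeta> = log_plus (norm (f (of_real (radius n) * \<zeta>)))" for n \<zeta>
  define Lb where "Lb \<zeta> = log_plus (norm (boundary_fun f \<zeta>))" for \<zeta>
  note hol = smirnov_holomorphic[OF f]
  have P: "0 \<le> poisson z \<zeta>" "poisson z \<zeta> \<le> M" if "norm \<zeta> = 1" for \<zeta>
    unfolding M_def using poisson_nonneg[OF z] poisson_le[OF z that] by auto
  have L0: "0 \<le> L n \<zeta>" "0 \<le> Lb \<zeta>" for n \<zeta> by (simp_all add: L_def Lb_def log_plus_nonneg)
  have cL: "continuous_on (sphere 0 1) (L n)" for n
    unfolding L_def[abs_def] by (intro continuous_intros continuous_on_circle_dilate hol radius_bounds)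
  have iLb: "integrable circle_measure Lb"
    unfolding Lb_def[abs_def] by (rule smirnov_log_plus_integrable[OF f])
  have [measurable]: "L n \<in> borel_measurable circle_measure" "Lb \<in> borel_measurable circle_measure" for n
    using iLb by (auto intro: borel_measurable_circle_continuous cL)
  have iMP: "integrable circle_measure (\<lambda>\<zeta>. (M - poisson z \<zeta>) * h \<zeta>)"
    and eMP: "(\<integral>\<zeta>. (M - poisson z \<zeta>) * h \<zeta> \<partial>circle_measure) =
        M * (\<integral>\<zeta>. h \<zeta> \<partial>circle_measure) - (\<integral>\<zeta>. poisson z \<zeta> * h \<zeta> \<partial>circle_measure)"
    if "integrable circle_measure h" for h
    using that integrable_poisson_mult[OF z that] by (simp_all add: left_diff_distrib)
  \<comment> \<open>Dilates of \<open>f\<close> are continuous up to the circle, where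
    \<open>log_plus_poisson\<close> applies.\<close>
  have step: "(\<integral>\<zeta>. (M - poisson z \<zeta>) * L n \<zeta> \<partial>circle_measure) \<le>
     M * (\<integral>\<zeta>. L n \<zeta> \<partial>circle_measure) - log_plus (norm (f (of_real (radius n) * z)))" for n
  proof -
    have sub: "norm (of_real (radius n) * w) < 1" if "norm w \<le> 1" for w :: complex
    proof -
      have "norm (of_real (radius n) * w) \<le> radius n * 1"
        unfolding norm_mult norm_of_real using that radius_bounds[of n] by (intro mult_mono) auto
      then show ?thesis using radius_bounds(3)[of n] by simp
    qed
    have "log_plus (norm (f (of_real (radius n) * z))) \<le> (\<integral>\<zeta>. poisson z \<zeta> * L n \<zeta> \<partial>circle_measure)"
      unfolding L_def
    proof (rule log_plus_poisson[where g = "\<lambda>w. f (of_real (radius n) * w)"])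
      show "(\<lambda>w. f (of_real (radius n) * w)) holomorphic_on ball 0 1"
        by (rule holomorphic_on_compose_gen[OF _ hol, unfolded o_def]) (use sub in \<open>auto intro!: holomorphic_intros\<close>)
      show "continuous_on (cball 0 1) (\<lambda>w. f (of_real (radius n) * w))"
        by (rule continuous_on_compose2[OF holomorphic_on_imp_continuous_on[OF hol]]) (use sub in \<open>auto intro!: continuous_intros\<close>)
    qed (rule z)
    then show ?thesis using eMP[OF integrable_circle_continuous[OF cL]] by simp
  qed
  have rad: "(\<lambda>n. log_plus (norm (f (of_real (radius n) * z)))) \<longlonglongrightarrow> log_plus (norm (f z))"
  proof -
    have "continuous_on (ball 0 1) (\<lambda>w. log_plus (norm (f w)))"
      by (intro continuous_intros holomorphic_on_imp_continuous_on hol)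
    then have cont: "isCont (\<lambda>w. log_plus (norm (f w))) z"
      using z by (simp add: continuous_on_eq_continuous_at)
    have "(\<lambda>n. of_real (radius n) * z) \<longlonglongrightarrow> of_real 1 * z"
      by (intro tendsto_intros radius_tendsto)
    then have "(\<lambda>n. of_real (radius n) * z) \<longlonglongrightarrow> z" by simp
    from isCont_tendsto_compose[OF cont this] show ?thesis .
  qed
  have "(\<lambda>n. \<integral>\<^sup>+\<zeta>. ennreal (L n \<zeta>) \<partial>circle_measure) \<longlonglongrightarrow> (\<integral>\<^sup>+\<zeta>. ennreal (Lb \<zeta>) \<partial>circle_measure)"
  proof -
    have "((\<lambda>r. \<integral>\<^sup>+\<zeta>. ennreal (log_plus (norm (f (of_real r * \<zeta>)))) \<partial>circle_measure) \<longlongrightarrow>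
      (\<integral>\<^sup>+\<zeta>. ennreal (Lb \<zeta>) \<partial>circle_measure)) (at_left 1)"
      using f by (simp add: smirnov_def Lb_def)
    from filterlim_compose[OF this filterlim_radius] show ?thesis by (simp add: L_def)
  qed
  then have "(\<lambda>n. ennreal (\<integral>\<zeta>. L n \<zeta> \<partial>circle_measure)) \<longlonglongrightarrow> ennreal (\<integral>\<zeta>. Lb \<zeta> \<partial>circle_measure)"
    using L0 by (simp add: nn_integral_eq_integral integrable_circle_continuous[OF cL] iLb)
  then have Lint: "(\<lambda>n. \<integral>\<zeta>. L n \<zeta> \<partial>circle_measure) \<longlonglongrightarrow> (\<integral>\<zeta>. Lb \<zeta> \<partial>circle_measure)"
    by (subst (asm) tendsto_ennreal_iff) (use L0 in auto)
  let ?R = "\<lambda>n. M * (\<integral>\<zeta>. L n \<zeta> \<partial>circle_measure) - log_plus (norm (f (of_real (radius n) * z)))"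
  let ?R' = "M * (\<integral>\<zeta>. Lb \<zeta> \<partial>circle_measure) - log_plus (norm (f z))"
  have R: "?R \<longlonglongrightarrow> ?R'" by (intro tendsto_intros Lint rad)
  have nn: "0 \<le> (M - poisson z \<zeta>) * L n \<zeta>" "0 \<le> (M - poisson z \<zeta>) * Lb \<zeta>" if "\<zeta> \<in> space circle_measure" for n \<zeta>
    using P[of \<zeta>] that L0 by (auto simp: space_circle_measure)
  have "0 \<le> ?R n" for n
    by (rule order_trans[OF _ step]) (use nn in \<open>auto intro!: Bochner_Integration.integral_nonneg\<close>)
  then have R0: "0 \<le> ?R'" by (intro LIMSEQ_le_const[OF R]) auto
  have "ennreal (\<integral>\<zeta>. (M - poisson z \<zeta>) * Lb \<zeta> \<partial>circle_measure) = (\<integral>\<^sup>+\<zeta>. ennreal ((M - poisson z \<zeta>) * Lb \<zeta>) \<partial>circle_measure)"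
    by (rule nn_integral_eq_integral[symmetric]) (use nn in \<open>auto intro!: iMP iLb\<close>)
  also have "\<dots> \<le> (\<integral>\<^sup>+\<zeta>. liminf (\<lambda>n. ennreal ((M - poisson z \<zeta>) * L n \<zeta>)) \<partial>circle_measure)"
  proof (rule nn_integral_mono)
    fix \<zeta> assume sp: "\<zeta> \<in> space circle_measure"
    then have n1: "norm \<zeta> = 1" by (simp add: space_circle_measure)
    show "ennreal ((M - poisson z \<zeta>) * Lb \<zeta>) \<le> liminf (\<lambda>n. ennreal ((M - poisson z \<zeta>) * L n \<zeta>))"
    proof (cases "\<exists>A. has_nontangential_limit f \<zeta> A")
      case True
      then obtain A where A: "has_nontangential_limit f \<zeta> A" by blast
      have "(\<lambda>n. f (of_real (radius n) * \<zeta>)) \<longlonglongrightarrow> A"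
        by (rule filterlim_compose[OF nontangential_radial[OF A n1] filterlim_radius])
      moreover have "isCont (\<lambda>w. log_plus (norm w)) A"
        using continuous_on_log_plus[OF continuous_on_norm_id, of "UNIV :: complex set"] by (simp add: continuous_on_eq_continuous_at)
      ultimately have "(\<lambda>n. L n \<zeta>) \<longlonglongrightarrow> Lb \<zeta>"
        unfolding L_def Lb_def boundary_fun_eq[OF A n1] by (rule isCont_tendsto_compose[rotated])
      then have "(\<lambda>n. ennreal ((M - poisson z \<zeta>) * L n \<zeta>)) \<longlonglongrightarrow> ennreal ((M - poisson z \<zeta>) * Lb \<zeta>)"
        by (intro tendsto_intros)
      then show ?thesis by (simp add: lim_imp_Liminf)
    next
      case False
      then have "boundary_fun f \<zeta> = 0" by (simp only: boundary_fun_def if_False)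
      then show ?thesis by (simp add: Lb_def log_plus_def)
    qed
  qed
  also have "\<dots> \<le> liminf (\<lambda>n. \<integral>\<^sup>+\<zeta>. ennreal ((M - poisson z \<zeta>) * L n \<zeta>) \<partial>circle_measure)"
    by (rule nn_integral_liminf) measurable
  also have "\<dots> \<le> liminf (\<lambda>n. ennreal (?R n))"
  proof (intro Liminf_mono always_eventually allI)
    fix n
    have "(\<integral>\<^sup>+\<zeta>. ennreal ((M - poisson z \<zeta>) * L n \<zeta>) \<partial>circle_measure) =
       ennreal (\<integral>\<zeta>. (M - poisson z \<zeta>) * L n \<zeta> \<partial>circle_measure)"
      by (rule nn_integral_eq_integral) (use nn in \<open>auto intro!: iMP integrable_circle_continuous[OF cL]\<close>)
    also have "\<dots> \<le> ennreal (?R n)" by (intro ennreal_leI step)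
    finally show "(\<integral>\<^sup>+\<zeta>. ennreal ((M - poisson z \<zeta>) * L n \<zeta>) \<partial>circle_measure) \<le> ennreal (?R n)" .
  qed
  also have "\<dots> = ennreal ?R'"
    by (intro lim_imp_Liminf tendsto_ennrealI R) simp
  finally have "(\<integral>\<zeta>. (M - poisson z \<zeta>) * Lb \<zeta> \<partial>circle_measure) \<le> ?R'"
    using R0 by (simp add: ennreal_le_iff)
  then show ?thesis unfolding eMP[OF iLb] unfolding Lb_def by linarith
qed

section \<open>Splitting Poisson integrals\<close>

text \<open>The kernel is a probability density and the exponential lies above its tangent at the
  mean \<open>t\<close>; integrating the tangent gives \<open>exp t\<close>.\<close>

lemma jensen_exp_poisson:
  assumes z: "norm z < 1" and u: "integrable circle_measure u" and e: "integrable circle_measure (\<lambda>\<zeta>. exp (u \<zeta>))"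
  shows "exp (\<integral>\<zeta>. poisson z \<zeta> * u \<zeta> \<partial>circle_measure) \<le> (\<integral>\<zeta>. poisson z \<zeta> * exp (u \<zeta>) \<partial>circle_measure)"
proof -
  define t where "t = (\<integral>\<zeta>. poisson z \<zeta> * u \<zeta> \<partial>circle_measure)"
  have iP: "integrable circle_measure (poisson z)"
    by (rule integrable_circle_continuous[OF continuous_on_poisson[OF z]])
  note iu = integrable_poisson_mult[OF z u]
  have "exp t = exp t * (1 - t) + exp t * t" by (simp add: algebra_simps)
  also have "\<dots> = (\<integral>\<zeta>. exp t * (1 - t) * poisson z \<zeta> + exp t * (poisson z \<zeta> * u \<zeta>) \<partial>circle_measure)"
    using iP iu by (simp add: integral_poisson[OF z] t_def[symmetric])
  also have "\<dots> \<le> (\<integral>\<zeta>. poisson z \<zeta> * exp (u \<zeta>) \<partial>circle_measure)"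
  proof (rule integral_mono)
    fix \<zeta>
    have "exp t * (1 + (u \<zeta> - t)) \<le> exp t * exp (u \<zeta> - t)"
      by (intro mult_left_mono exp_ge_add_one_self) auto
    then have "exp t * (1 + (u \<zeta> - t)) \<le> exp (u \<zeta>)" by (simp add: exp_diff)
    then have "poisson z \<zeta> * (exp t * (1 + (u \<zeta> - t))) \<le> poisson z \<zeta> * exp (u \<zeta>)"
      by (intro mult_left_mono poisson_nonneg z)
    then show "exp t * (1 - t) * poisson z \<zeta> + exp t * (poisson z \<zeta> * u \<zeta>) \<le> poisson z \<zeta> * exp (u \<zeta>)"
      by (simp add: algebra_simps)
  qed (intro Bochner_Integration.integrable_add integrable_mult_right iP iu integrable_poisson_mult[OF z e])+
  finally show ?thesis by (simp add: t_def)
qed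

text \<open>Tangent line inequality for a power: multiplying by \<open>x\<close> in the induction
  leaves the nonnegative surplus \<open>real (Suc m) * t ^ m * (x - t)\<^sup>2\<close>.\<close>

lemma power_tangent_le:
  fixes x t :: real
  assumes "0 \<le> x" "0 \<le> t"
  shows "t ^ Suc m + real (Suc m) * t ^ m * (x - t) \<le> x ^ Suc m"
proof (induction m)
  case (Suc m)
  have "0 \<le> real (Suc m) * t ^ m * (x - t)\<^sup>2" using assms by simp
  then have "t ^ Suc (Suc m) + real (Suc (Suc m)) * t ^ Suc m * (x - t) \<le>
    x * (t ^ Suc m + real (Suc m) * t ^ m * (x - t))"
    by (simp add: algebra_simps power2_eq_square)
  also have "\<dots> \<le> x * x ^ Suc m" by (intro mult_left_mono Suc assms)
  finally show ?case by simp
qed simp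

lemma jensen_power_poisson:
  assumes z: "norm z < 1" and h: "integrable circle_measure h" and hm: "integrable circle_measure (\<lambda>\<zeta>. h \<zeta> ^ Suc m)"
    and h0: "\<And>\<zeta>. 0 \<le> h \<zeta>"
  shows "(\<integral>\<zeta>. poisson z \<zeta> * h \<zeta> \<partial>circle_measure) ^ Suc m \<le> (\<integral>\<zeta>. poisson z \<zeta> * h \<zeta> ^ Suc m \<partial>circle_measure)"
proof -
  define t where "t = (\<integral>\<zeta>. poisson z \<zeta> * h \<zeta> \<partial>circle_measure)"
  have t0: "0 \<le> t" unfolding t_def
    by (intro Bochner_Integration.integral_nonneg mult_nonneg_nonneg poisson_nonneg z h0)
  have iP: "integrable circle_measure (poisson z)"
    by (rule integrable_circle_continuous[OF continuous_on_poisson[OF z]])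
  note ih = integrable_poisson_mult[OF z h]
  define a where "a = t ^ Suc m - real (Suc m) * t ^ m * t"
  define b where "b = real (Suc m) * t ^ m"
  have "t ^ Suc m = a + b * t" by (simp add: a_def b_def)
  also have "\<dots> = (\<integral>\<zeta>. a * poisson z \<zeta> + b * (poisson z \<zeta> * h \<zeta>) \<partial>circle_measure)"
    using iP ih by (simp add: integral_poisson[OF z] t_def[symmetric])
  also have "\<dots> \<le> (\<integral>\<zeta>. poisson z \<zeta> * h \<zeta> ^ Suc m \<partial>circle_measure)"
  proof (rule integral_mono)
    fix \<zeta>
    have "a + b * h \<zeta> \<le> h \<zeta> ^ Suc m"
      using power_tangent_le[OF h0 t0, of m \<zeta>] by (simp only: a_def b_def right_diff_distrib diff_add_eq add_diff_eq)
    then have "poisson z \<zeta> * (a + b * h \<zeta>) \<le> poisson z \<zeta> * h \<zeta> ^ Suc m"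
      by (intro mult_left_mono poisson_nonneg z)
    then show "a * poisson z \<zeta> + b * (poisson z \<zeta> * h \<zeta>) \<le> poisson z \<zeta> * h \<zeta> ^ Suc m"
      by (simp add: algebra_simps)
  qed (intro Bochner_Integration.integrable_add integrable_mult_right iP ih integrable_poisson_mult[OF z hm])+
  finally show ?thesis by (simp add: t_def)
qed

text \<open>By symmetry of the kernel the inner integral over \<eta> has total mass 1. The exchange
  is made for nonnegative integrals, which yields integrability along with the value.\<close>

lemma poisson_fubini:
  assumes r: "0 \<le> r" "r < 1" and h: "integrable circle_measure h" and h0: "\<And>\<zeta>. 0 \<le> h \<zeta>"
  shows "integrable circle_measure (\<lambda>\<eta>. \<integral>\<zeta>. poisson (of_real r * \<eta>) \<zeta> * h \<zeta> \<partial>circle_measure)" (is ?A)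
    and "(\<integral>\<eta>. (\<integral>\<zeta>. poisson (of_real r * \<eta>) \<zeta> * h \<zeta> \<partial>circle_measure) \<partial>circle_measure) = (\<integral>\<zeta>. h \<zeta> \<partial>circle_measure)" (is ?B)
proof -
  interpret P: pair_sigma_finite circle_measure circle_measure ..
  have [measurable]: "h \<in> borel_measurable circle_measure" using h by auto
  have m1 [measurable]: "(\<lambda>(\<eta>, \<zeta>). poisson (of_real r * \<eta>) \<zeta> * h \<zeta>) \<in> borel_measurable (circle_measure \<Otimes>\<^sub>M circle_measure)"
    unfolding poisson_def by measurable
  have nr: "norm (of_real r * \<eta>) < 1" if "norm \<eta> = 1" for \<eta> :: complex using that r by (simp add: norm_mult)
  let ?U = "\<lambda>\<eta>. \<integral>\<zeta>. poisson (of_real r * \<eta>) \<zeta> * h \<zeta> \<partial>circle_measure"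
  have U0: "0 \<le> ?U \<eta>" if "norm \<eta> = 1" for \<eta>
    by (intro Bochner_Integration.integral_nonneg mult_nonneg_nonneg poisson_nonneg nr h0 that)
  have Um: "?U \<in> borel_measurable circle_measure"
    by (rule circle.borel_measurable_lebesgue_integral[OF m1])
  have "(\<integral>\<^sup>+\<eta>. ennreal (?U \<eta>) \<partial>circle_measure) =
    (\<integral>\<^sup>+\<eta>. (\<integral>\<^sup>+\<zeta>. ennreal (poisson (of_real r * \<eta>) \<zeta> * h \<zeta>) \<partial>circle_measure) \<partial>circle_measure)"
  proof (rule nn_integral_cong)
    fix \<eta> assume "\<eta> \<in> space circle_measure"
    then have n: "norm \<eta> = 1" by (simp add: space_circle_measure)
    show "ennreal (?U \<eta>) = (\<integral>\<^sup>+\<zeta>. ennreal (poisson (of_real r * \<eta>) \<zeta> * h \<zeta>) \<partial>circle_measure)"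
      by (intro nn_integral_eq_integral[symmetric] integrable_poisson_mult nr n h AE_I2 mult_nonneg_nonneg poisson_nonneg h0)
  qed
  also have "\<dots> = (\<integral>\<^sup>+\<zeta>. (\<integral>\<^sup>+\<eta>. ennreal (poisson (of_real r * \<eta>) \<zeta> * h \<zeta>) \<partial>circle_measure) \<partial>circle_measure)"
    by (rule P.Fubini'[symmetric]) (use m1 in measurable)
  also have "\<dots> = (\<integral>\<^sup>+\<zeta>. ennreal (h \<zeta>) \<partial>circle_measure)"
  proof (rule nn_integral_cong)
    fix \<zeta> assume "\<zeta> \<in> space circle_measure"
    then have n: "norm \<zeta> = 1" by (simp add: space_circle_measure)
    have "(\<integral>\<^sup>+\<eta>. ennreal (poisson (of_real r * \<eta>) \<zeta> * h \<zeta>) \<partial>circle_measure) =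
       (\<integral>\<^sup>+\<eta>. ennreal (poisson (of_real r * \<zeta>) \<eta> * h \<zeta>) \<partial>circle_measure)"
      by (intro nn_integral_cong) (simp add: space_circle_measure poisson_symmetric[OF n])
    also have "\<dots> = ennreal (\<integral>\<eta>. poisson (of_real r * \<zeta>) \<eta> * h \<zeta> \<partial>circle_measure)"
      by (intro nn_integral_eq_integral integrable_poisson_mult[OF nr[OF n]] AE_I2 mult_nonneg_nonneg poisson_nonneg nr n h0) simp
    also have "\<dots> = ennreal (h \<zeta>)" by (simp add: integral_poisson[OF nr[OF n]])
    finally show "(\<integral>\<^sup>+\<eta>. ennreal (poisson (of_real r * \<eta>) \<zeta> * h \<zeta>) \<partial>circle_measure) = ennreal (h \<zeta>)" .
  qed
  also have "\<dots> = ennreal (\<integral>\<zeta>. h \<zeta> \<partial>circle_measure)"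
    by (intro nn_integral_eq_integral h AE_I2 h0)
  finally have eq: "(\<integral>\<^sup>+\<eta>. ennreal (?U \<eta>) \<partial>circle_measure) = ennreal (\<integral>\<zeta>. h \<zeta> \<partial>circle_measure)" .
  show A: ?A
    by (rule integrableI_nonneg[OF Um]) (use U0 eq in \<open>auto simp: space_circle_measure\<close>)
  have "(\<integral>\<^sup>+\<eta>. ennreal (?U \<eta>) \<partial>circle_measure) = ennreal (\<integral>\<eta>. ?U \<eta> \<partial>circle_measure)"
    by (intro nn_integral_eq_integral A AE_I2) (use U0 in \<open>auto simp: space_circle_measure\<close>)
  then have "ennreal (\<integral>\<eta>. ?U \<eta> \<partial>circle_measure) = ennreal (\<integral>\<zeta>. h \<zeta> \<partial>circle_measure)" using eq by simp
  then show ?B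
  proof (subst (asm) ennreal_inj)
    show "0 \<le> (\<integral>\<eta>. ?U \<eta> \<partial>circle_measure)"
      by (intro Bochner_Integration.integral_nonneg U0) (simp add: space_circle_measure)
    show "0 \<le> (\<integral>\<zeta>. h \<zeta> \<partial>circle_measure)"
      by (intro Bochner_Integration.integral_nonneg h0)
  qed simp
qed

text \<open>Of the \<open>Suc m\<close> factors, \<open>m\<close> are estimated by the supremum
  \<open>2 / (1 - r)\<close> of the kernel times the integral of \<open>h\<close>, and the last one
  is integrated.\<close>

lemma poisson_power_integral_le:
  assumes r: "0 \<le> r" "r < 1" and h: "integrable circle_measure h" and h0: "\<And>\<zeta>. 0 \<le> h \<zeta>"
  shows "integrable circle_measure (\<lambda>\<eta>. (\<integral>\<zeta>. poisson (of_real r * \<eta>) \<zeta> * h \<zeta> \<partial>circle_measure) ^ Suc m)" (is ?A)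
    and "(\<integral>\<eta>. (\<integral>\<zeta>. poisson (of_real r * \<eta>) \<zeta> * h \<zeta> \<partial>circle_measure) ^ Suc m \<partial>circle_measure)
       \<le> (2 / (1 - r)) ^ m * (\<integral>\<zeta>. h \<zeta> \<partial>circle_measure) ^ Suc m" (is ?B)
proof -
  let ?U = "\<lambda>\<eta>. \<integral>\<zeta>. poisson (of_real r * \<eta>) \<zeta> * h \<zeta> \<partial>circle_measure"
  let ?c = "2 / (1 - r) * (\<integral>\<zeta>. h \<zeta> \<partial>circle_measure)"
  have nr: "norm (of_real r * \<eta>) = r" if "norm \<eta> = 1" for \<eta> :: complex using that r by (simp add: norm_mult)
  have iU: "integrable circle_measure ?U" by (rule poisson_fubini[OF r h h0])
  have U0: "0 \<le> ?U \<eta>" if "norm \<eta> = 1" for \<eta>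
    by (intro Bochner_Integration.integral_nonneg mult_nonneg_nonneg poisson_nonneg h0) (use nr[OF that] r in simp)
  have Uc: "?U \<eta> \<le> ?c" if "norm \<eta> = 1" for \<eta>
  proof -
    have z: "norm (of_real r * \<eta>) < 1" using nr[OF that] r by simp
    have "?U \<eta> \<le> (\<integral>\<zeta>. 2 / (1 - r) * h \<zeta> \<partial>circle_measure)"
    proof (rule integral_mono)
      fix \<zeta> assume "\<zeta> \<in> space circle_measure"
      then show "poisson (of_real r * \<eta>) \<zeta> * h \<zeta> \<le> 2 / (1 - r) * h \<zeta>"
        using poisson_le[OF z, of \<zeta>] by (intro mult_right_mono h0) (simp add: nr[OF that] space_circle_measure)
    qed (use h integrable_poisson_mult[OF z h] in auto)
    then show ?thesis by simp
  qed
  have pw: "?U \<eta> ^ Suc m \<le> ?c ^ m * ?U \<eta>" if "norm \<eta> = 1" for \<eta>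
    using mult_right_mono[OF power_mono[OF Uc U0] U0, OF that that that, of m] by (simp only: power_Suc2)
  show ?A
  proof (rule Bochner_Integration.integrable_bound)
    show "integrable circle_measure (\<lambda>\<eta>. ?c ^ m * ?U \<eta>)" using iU by simp
    show "(\<lambda>\<eta>. ?U \<eta> ^ Suc m) \<in> borel_measurable circle_measure"
      using iU by (intro borel_measurable_power borel_measurable_integrable)
    show "AE \<eta> in circle_measure. norm (?U \<eta> ^ Suc m) \<le> norm (?c ^ m * ?U \<eta>)"
    proof (rule AE_I2)
      fix \<eta> assume "\<eta> \<in> space circle_measure"
      then have n: "norm \<eta> = 1" by (simp add: space_circle_measure)
      have "0 \<le> ?U \<eta> ^ Suc m" using U0[OF n] by (rule zero_le_power)
      with pw[OF n] show "norm (?U \<eta> ^ Suc m) \<le> norm (?c ^ m * ?U \<eta>)" unfolding real_norm_def by linarith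
    qed
  qed
  then have "(\<integral>\<eta>. ?U \<eta> ^ Suc m \<partial>circle_measure) \<le> (\<integral>\<eta>. ?c ^ m * ?U \<eta> \<partial>circle_measure)"
    using iU by (intro integral_mono pw) (auto simp: space_circle_measure)
  also have "\<dots> = ?c ^ m * (\<integral>\<zeta>. h \<zeta> \<partial>circle_measure)"
    by (simp add: poisson_fubini(2)[OF r h h0])
  also have "\<dots> = (2 / (1 - r)) ^ m * (\<integral>\<zeta>. h \<zeta> \<partial>circle_measure) ^ Suc m"
    by (simp only: power_mult_distrib power_Suc2 mult.assoc)
  finally show ?B .
qed

lemma power_add_le:
  fixes x y :: real
  assumes "0 \<le> x" "0 \<le> y"
  shows "(x + y) ^ n \<le> 2 ^ n * (x ^ n + y ^ n)"
proof -
  have "(x + y) ^ n \<le> (2 * max x y) ^ n" using assms by (intro power_mono) auto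
  also have "\<dots> = 2 ^ n * max x y ^ n" by (simp add: power_mult_distrib)
  also have "max x y ^ n \<le> x ^ n + y ^ n" using assms by (simp add: max_def)
  finally show ?thesis by simp
qed

text \<open>
  The part of \<open>G\<close> below the level \<open>a\<close> is controlled by Jensen's inequality, the part above it by the
  supremum of the kernel. The level is later tied to the radius.
\<close>

lemma poisson_split_integral_le:
  assumes r: "0 \<le> r" "r < 1" and G: "integrable circle_measure G" and G0: "\<And>\<zeta>. 0 \<le> G \<zeta>" and a: "0 \<le> a"
  shows "integrable circle_measure (\<lambda>\<eta>. (\<integral>\<zeta>. poisson (of_real r * \<eta>) \<zeta> * G \<zeta> \<partial>circle_measure) ^ Suc m)" (is ?A)
    and "(\<integral>\<eta>. (\<integral>\<zeta>. poisson (of_real r * \<eta>) \<zeta> * G \<zeta> \<partial>circle_measure) ^ Suc m \<partial>circle_measure)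
       \<le> 2 ^ Suc m * ((\<integral>\<zeta>. min (G \<zeta>) a ^ Suc m \<partial>circle_measure) +
            (2 / (1 - r)) ^ m * (\<integral>\<zeta>. max 0 (G \<zeta> - a) \<partial>circle_measure) ^ Suc m)" (is ?B)
proof -
  show ?A by (rule poisson_power_integral_le[OF r G G0])
  let ?U = "\<lambda>h \<eta>. \<integral>\<zeta>. poisson (of_real r * \<eta>) \<zeta> * h \<zeta> \<partial>circle_measure"
  define G1 where "G1 \<zeta> = max 0 (G \<zeta> - a)" for \<zeta>
  define G2 where "G2 \<zeta> = min (G \<zeta>) a" for \<zeta>
  have [measurable]: "G \<in> borel_measurable circle_measure" using G by auto
  have G10: "0 \<le> G1 \<zeta>" and G20: "0 \<le> G2 \<zeta>" and Gs: "G \<zeta> = G1 \<zeta> + G2 \<zeta>" for \<zeta>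
    using G0[of \<zeta>] a by (auto simp: G1_def G2_def)
  have i1: "integrable circle_measure G1"
    unfolding G1_def[abs_def] using G by auto
  have i2: "integrable circle_measure G2"
    unfolding G2_def[abs_def] using G by auto
  have i2m: "integrable circle_measure (\<lambda>\<zeta>. G2 \<zeta> ^ Suc m)"
  proof (rule circle.integrable_const_bound[of _ "a ^ Suc m"])
    show "AE \<zeta> in circle_measure. norm (G2 \<zeta> ^ Suc m) \<le> a ^ Suc m"
      using G20 by (intro AE_I2) (simp del: power_Suc add: G2_def power_mono abs_of_nonneg)
  qed (simp add: G2_def)
  have nr: "norm (of_real r * \<eta>) < 1" if "norm \<eta> = 1" for \<eta> :: complex using that r by (simp add: norm_mult)
  have U0: "0 \<le> ?U h \<eta>" if "norm \<eta> = 1" "\<And>\<zeta>. 0 \<le> h \<zeta>" for \<eta> h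
    by (intro Bochner_Integration.integral_nonneg mult_nonneg_nonneg poisson_nonneg nr that)
  note iU2 = poisson_fubini(1)[OF r i2m zero_le_power[OF G20]]
  note iU1 = poisson_power_integral_le(1)[OF r i1 G10, of m]
  have "(\<integral>\<eta>. ?U G \<eta> ^ Suc m \<partial>circle_measure) \<le>
     (\<integral>\<eta>. 2 ^ Suc m * (?U (\<lambda>\<zeta>. G2 \<zeta> ^ Suc m) \<eta> + ?U G1 \<eta> ^ Suc m) \<partial>circle_measure)"
  proof (rule integral_mono)
    fix \<eta> assume "\<eta> \<in> space circle_measure"
    then have n: "norm \<eta> = 1" by (simp add: space_circle_measure)
    have "?U G \<eta> = ?U G2 \<eta> + ?U G1 \<eta>"
      unfolding Gs using integrable_poisson_mult[OF nr[OF n] i1] integrable_poisson_mult[OF nr[OF n] i2]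
      by (simp add: distrib_left)
    then have "?U G \<eta> ^ Suc m \<le> 2 ^ Suc m * (?U G2 \<eta> ^ Suc m + ?U G1 \<eta> ^ Suc m)"
      by (simp only:) (intro power_add_le U0 n G10 G20)
    also have "\<dots> \<le> 2 ^ Suc m * (?U (\<lambda>\<zeta>. G2 \<zeta> ^ Suc m) \<eta> + ?U G1 \<eta> ^ Suc m)"
      by (intro mult_left_mono add_right_mono jensen_power_poisson[OF nr[OF n] i2 i2m G20]) auto
    finally show "?U G \<eta> ^ Suc m \<le> 2 ^ Suc m * (?U (\<lambda>\<zeta>. G2 \<zeta> ^ Suc m) \<eta> + ?U G1 \<eta> ^ Suc m)" .
  next
    show "integrable circle_measure (\<lambda>\<eta>. ?U G \<eta> ^ Suc m)" by (rule poisson_power_integral_le(1)[OF r G G0])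
    show "integrable circle_measure (\<lambda>\<eta>. 2 ^ Suc m * (?U (\<lambda>\<zeta>. G2 \<zeta> ^ Suc m) \<eta> + ?U G1 \<eta> ^ Suc m))"
      by (rule integrable_mult_right[OF Bochner_Integration.integrable_add[OF iU2 iU1]])
  qed
  also have "\<dots> = 2 ^ Suc m * ((\<integral>\<zeta>. G2 \<zeta> ^ Suc m \<partial>circle_measure) + (\<integral>\<eta>. ?U G1 \<eta> ^ Suc m \<partial>circle_measure))"
    using Bochner_Integration.integral_add[OF iU2 iU1] poisson_fubini(2)[OF r i2m zero_le_power[OF G20]]
    by (simp del: power_Suc)
  also have "\<dots> \<le> 2 ^ Suc m * ((\<integral>\<zeta>. G2 \<zeta> ^ Suc m \<partial>circle_measure) + (2 / (1 - r)) ^ m * (\<integral>\<zeta>. G1 \<zeta> \<partial>circle_measure) ^ Suc m)"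
    by (intro mult_left_mono add_left_mono poisson_power_integral_le r i1 G10) auto
  finally show ?B by (simp only: G1_def G2_def)
qed

section \<open>Taylor coefficients of Smirnov functions\<close>

lemma nn_integral_indicator_level_le:
  fixes G :: "complex \<Rightarrow> real"
  assumes m: "measure circle_measure {\<zeta> \<in> sphere 0 1. b < G \<zeta>} \<le> \<epsilon>"
    and [measurable]: "G \<in> borel_measurable circle_measure" and c: "0 \<le> c"
  shows "(\<integral>\<^sup>+\<zeta>. ennreal (c * indicator {x. b < G x} \<zeta>) \<partial>circle_measure) \<le> ennreal (c * \<epsilon>)"
proof -
  let ?A = "{\<zeta> \<in> space circle_measure. b < G \<zeta>}"
  have [measurable]: "?A \<in> sets circle_measure" by measurable
  have "(\<integral>\<^sup>+\<zeta>. ennreal (c * indicator {x. b < G x} \<zeta>) \<partial>circle_measure) =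
     (\<integral>\<^sup>+\<zeta>. ennreal c * indicator ?A \<zeta> \<partial>circle_measure)"
    by (intro nn_integral_cong) (auto simp: indicator_def)
  also have "\<dots> = ennreal c * emeasure circle_measure ?A"
    by (rule nn_integral_cmult_indicator) measurable
  also have "\<dots> = ennreal c * ennreal (measure circle_measure ?A)"
    by (simp add: circle.emeasure_eq_measure)
  also have "\<dots> = ennreal (c * measure circle_measure ?A)" using c by (simp add: ennreal_mult)
  also have "\<dots> \<le> ennreal (c * \<epsilon>)"
    using m c by (intro ennreal_leI mult_left_mono) (simp_all add: space_circle_measure)
  finally show ?thesis .
qed

text \<open>Raising the truncation from \<open>B k\<close> to \<open>B (Suc k)\<close> matters only
  where \<open>G\<close> exceeds \<open>B k\<close>, a set of measure at most
  \<open>(1/2) ^ k\<close>, and adds at most \<open>B (Suc k) ^ n\<close> there.\<close>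

lemma integral_truncated_power_le:
  fixes G :: "complex \<Rightarrow> real" and B :: "nat \<Rightarrow> real"
  assumes m: "\<And>j. measure circle_measure {\<zeta> \<in> sphere 0 1. B j < G \<zeta>} \<le> (1/2) ^ j"
    and [measurable]: "G \<in> borel_measurable circle_measure" and G0: "\<And>\<zeta>. 0 \<le> G \<zeta>" and B: "\<And>j. 1 \<le> B j"
  shows "(\<integral>\<zeta>. min (G \<zeta>) (B k) ^ n \<partial>circle_measure) \<le> B 0 ^ n + (\<Sum>j<k. B (Suc j) ^ n * (1/2) ^ j)"
proof -
  have B0: "0 \<le> B j" for j using B[of j] by simp
  have pw: "min (G \<zeta>) (B k) ^ n \<le> B 0 ^ n + (\<Sum>j<k. B (Suc j) ^ n * indicator {x. B j < G x} \<zeta>)" for \<zeta>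
  proof (induction k)
    case 0
    then show ?case using G0 B0 by (auto intro!: power_mono)
  next
    case (Suc k)
    have "min (G \<zeta>) (B (Suc k)) ^ n \<le> min (G \<zeta>) (B k) ^ n + B (Suc k) ^ n * indicator {x. B k < G x} \<zeta>"
    proof (cases "B k < G \<zeta>")
      case True
      have "min (G \<zeta>) (B (Suc k)) ^ n \<le> B (Suc k) ^ n" using G0 B0 by (intro power_mono) auto
      moreover have "0 \<le> min (G \<zeta>) (B k) ^ n" using G0 B0 by auto
      ultimately show ?thesis using True by simp
    next
      case False
      then have "min (G \<zeta>) (B (Suc k)) ^ n \<le> min (G \<zeta>) (B k) ^ n" using G0 B0 by (intro power_mono) auto
      then show ?thesis using False by simp
    qed
    with Suc show ?case by simp
  qed
  let ?R = "B 0 ^ n + (\<Sum>j<k. B (Suc j) ^ n * (1/2) ^ j)"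
  have R0: "0 \<le> ?R" using B0 by (auto intro!: add_nonneg_nonneg sum_nonneg)
  have int: "integrable circle_measure (\<lambda>\<zeta>. min (G \<zeta>) (B k) ^ n)"
  proof (rule circle.integrable_const_bound[of _ "B k ^ n"])
    show "AE \<zeta> in circle_measure. norm (min (G \<zeta>) (B k) ^ n) \<le> B k ^ n"
      using G0 B0 by (intro AE_I2) (auto simp: norm_power intro!: power_mono)
  qed measurable
  have "ennreal (\<integral>\<zeta>. min (G \<zeta>) (B k) ^ n \<partial>circle_measure) = (\<integral>\<^sup>+\<zeta>. ennreal (min (G \<zeta>) (B k) ^ n) \<partial>circle_measure)"
    using G0 B0 by (intro nn_integral_eq_integral[symmetric] int) auto
  also have "\<dots> \<le> (\<integral>\<^sup>+\<zeta>. ennreal (B 0 ^ n) + (\<Sum>j<k. ennreal (B (Suc j) ^ n * indicator {x. B j < G x} \<zeta>)) \<partial>circle_measure)"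
  proof (rule nn_integral_mono)
    fix \<zeta>
    have "ennreal (min (G \<zeta>) (B k) ^ n) \<le> ennreal (B 0 ^ n + (\<Sum>j<k. B (Suc j) ^ n * indicator {x. B j < G x} \<zeta>))"
      by (intro ennreal_leI pw)
    also have "\<dots> = ennreal (B 0 ^ n) + (\<Sum>j<k. ennreal (B (Suc j) ^ n * indicator {x. B j < G x} \<zeta>))"
      using B0 by (subst ennreal_plus) (auto intro!: sum_nonneg simp: sum_ennreal)
    finally show "ennreal (min (G \<zeta>) (B k) ^ n) \<le> ennreal (B 0 ^ n) + (\<Sum>j<k. ennreal (B (Suc j) ^ n * indicator {x. B j < G x} \<zeta>))" .
  qed
  also have "\<dots> = ennreal (B 0 ^ n) + (\<Sum>j<k. \<integral>\<^sup>+\<zeta>. ennreal (B (Suc j) ^ n * indicator {x. B j < G x} \<zeta>) \<partial>circle_measure)"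
    by (subst nn_integral_add) (auto simp: nn_integral_sum)
  also have "\<dots> \<le> ennreal (B 0 ^ n) + (\<Sum>j<k. ennreal (B (Suc j) ^ n * (1/2) ^ j))"
    using B0 by (intro add_left_mono sum_mono nn_integral_indicator_level_le m) auto
  also have "\<dots> = ennreal ?R"
    using B0 by (subst ennreal_plus) (auto intro!: sum_nonneg simp: sum_ennreal)
  finally show ?thesis using R0 by (simp add: ennreal_le_iff)
qed

text \<open>Above \<open>B k\<close>, the first level that reaches \<open>G \<zeta>\<close> bounds
  the excess by a single term of the series.\<close>

lemma nn_integral_excess_le:
  fixes G :: "complex \<Rightarrow> real" and B :: "nat \<Rightarrow> real"
  assumes m: "\<And>j. measure circle_measure {\<zeta> \<in> sphere 0 1. B j < G \<zeta>} \<le> (1/2) ^ j"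
    and [measurable]: "G \<in> borel_measurable circle_measure" and B: "\<And>j. 1 \<le> B j"
    and s: "summable (\<lambda>i. B (Suc (k + i)) * (1/2) ^ (k + i))"
  shows "(\<integral>\<^sup>+\<zeta>. ennreal (G \<zeta> - B k) \<partial>circle_measure) \<le> ennreal (\<Sum>i. B (Suc (k + i)) * (1/2) ^ (k + i))"
proof -
  have B0: "0 \<le> B j" for j using B[of j] by simp
  have pw: "ennreal (G \<zeta> - B k) \<le> (\<Sum>i. ennreal (B (Suc (k + i)) * indicator {x. B (k + i) < G x} \<zeta>))" (is "_ \<le> suminf ?t") for \<zeta>
  proof (cases "B k < G \<zeta>")
    case True
    show ?thesis
    proof (cases "\<exists>i. G \<zeta> \<le> B (Suc (k + i))")
      case ex: True
      define i where "i = (LEAST i. G \<zeta> \<le> B (Suc (k + i)))"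
      have i: "G \<zeta> \<le> B (Suc (k + i))" unfolding i_def using ex by (rule LeastI_ex)
      have "B (k + i) < G \<zeta>"
      proof (cases i)
        case (Suc i')
        then have "\<not> G \<zeta> \<le> B (Suc (k + i'))" using not_less_Least[of i' "\<lambda>i. G \<zeta> \<le> B (Suc (k + i))"] by (simp add: i_def)
        then show ?thesis using Suc by simp
      qed (use True in simp)
      then have "ennreal (G \<zeta> - B k) \<le> ?t i" using i B0[of k] by (simp add: ennreal_leI)
      also have "\<dots> \<le> suminf ?t" using sum_le_suminf[of ?t "{i}"] by simp
      finally show ?thesis .
    next
      case False
      then have "B (k + i) < G \<zeta>" for i using True by (cases i) (auto simp: not_le)
      \<comment> \<open>Where \<open>G\<close> exceeds every level, all terms are at least 1 and the
        series is infinite; this is what the lower bound on the levels provides.\<close>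
      then have t1: "1 \<le> ?t i" for i using B by (simp add: ennreal_1[symmetric] ennreal_leI del: ennreal_1)
      have "of_nat n \<le> suminf ?t" for n
      proof -
        have "(of_nat n :: ennreal) = (\<Sum>i<n. 1)" by simp
        also have "\<dots> \<le> (\<Sum>i<n. ?t i)" by (intro sum_mono t1)
        also have "\<dots> \<le> suminf ?t" by (intro sum_le_suminf) auto
        finally show ?thesis .
      qed
      moreover obtain n :: nat where "G \<zeta> - B k \<le> real n" using real_arch_simple by blast
      then have "ennreal (G \<zeta> - B k) \<le> of_nat n"
        unfolding ennreal_of_nat_eq_real_of_nat by (rule ennreal_leI)
      ultimately show ?thesis by (rule order_trans[rotated])
    qed
  qed (simp add: ennreal_neg)
  have "(\<integral>\<^sup>+\<zeta>. ennreal (G \<zeta> - B k) \<partial>circle_measure) \<le>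
    (\<integral>\<^sup>+\<zeta>. (\<Sum>i. ennreal (B (Suc (k + i)) * indicator {x. B (k + i) < G x} \<zeta>)) \<partial>circle_measure)"
    by (intro nn_integral_mono pw)
  also have "\<dots> = (\<Sum>i. \<integral>\<^sup>+\<zeta>. ennreal (B (Suc (k + i)) * indicator {x. B (k + i) < G x} \<zeta>) \<partial>circle_measure)"
    by (rule nn_integral_suminf) measurable
  also have "\<dots> \<le> (\<Sum>i. ennreal (B (Suc (k + i)) * (1/2) ^ (k + i)))"
    by (intro suminf_le nn_integral_indicator_level_le m B0) auto
  also have "\<dots> = ennreal (\<Sum>i. B (Suc (k + i)) * (1/2) ^ (k + i))"
    by (intro suminf_ennreal2 s) (simp add: B0)
  finally show ?thesis .
qed

text \<open>The sequence \<open>(1 - 1 / N) ^ N\<close> increases along powers of two from its value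
  1/4 at \<open>N = 2\<close>. On the circle of radius \<open>1 - 1 / N\<close> all indices below
  \<open>N\<close> therefore lose at most a factor 4.\<close>

lemma one_minus_half_power_ge:
  fixes n k :: nat
  assumes "n < 2 ^ Suc k"
  shows "1 / 4 \<le> (1 - (1/2::real) ^ Suc k) ^ n"
proof -
  have "1 / 4 \<le> (1 - (1/2::real) ^ Suc k) ^ (2 ^ Suc k)"
  proof (induction k)
    case (Suc k)
    have "(1 - (1/2::real) ^ Suc k) \<le> (1 - (1/2) ^ Suc (Suc k))\<^sup>2"
      by (simp add: power2_eq_square algebra_simps)
    then have "(1 - (1/2::real) ^ Suc k) ^ (2 ^ Suc k) \<le> ((1 - (1/2) ^ Suc (Suc k))\<^sup>2) ^ (2 ^ Suc k)"
      by (intro power_mono) (auto simp: power_le_one simp del: power_Suc)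
    also have "\<dots> = (1 - (1/2::real) ^ Suc (Suc k)) ^ (2 ^ Suc (Suc k))"
      by (simp only: power_mult[symmetric] power_Suc)
    finally show ?case using Suc by linarith
  qed (simp add: power2_eq_square)
  also have "\<dots> \<le> (1 - (1/2::real) ^ Suc k) ^ n"
    using assms by (intro power_decreasing) (auto simp: power_le_one simp del: power_Suc)
  finally show ?thesis .
qed

text \<open>The levels \<open>B j\<close> stand for the rearrangement of the root \<open>G\<close>
  at \<open>(1/2) ^ j\<close> and enter only through the distribution bounds. Level
  \<open>B k\<close> is paired with the radius \<open>1 - (1/2) ^ Suc k\<close>, where the kernel is
  at most \<open>4 * 2 ^ k\<close>.\<close>

lemma smirnov_coeff_le:
  fixes f :: "complex \<Rightarrow> complex" and m :: nat and B :: "nat \<Rightarrow> real"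
  defines "G \<equiv> \<lambda>\<zeta>. exp (log_plus (norm (boundary_fun f \<zeta>)) / real (Suc m))"
  assumes f: "f \<in> smirnov"
    and m: "\<And>j. measure circle_measure {\<zeta> \<in> sphere 0 1. B j < G \<zeta>} \<le> (1/2) ^ j"
    and B: "\<And>j. 1 \<le> B j" and s: "summable (\<lambda>j. B (Suc j) * (1/2) ^ j)"
    and n: "n < 2 ^ Suc k"
  shows "norm (taylor_coeff f n) \<le> 4 * 2 ^ Suc m * (B 0 ^ Suc m + (\<Sum>j<k. B (Suc j) ^ Suc m * (1/2) ^ j)
     + (4 * 2 ^ k) ^ m * (\<Sum>i. B (Suc (k + i)) * (1/2) ^ (k + i)) ^ Suc m)"
proof -
  define r :: real where "r = 1 - (1/2) ^ Suc k"
  have r: "0 \<le> r" "r < 1" by (simp_all add: r_def power_le_one del: power_Suc)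
  note hol = smirnov_holomorphic[OF f]
  have [measurable]: "boundary_fun f \<in> borel_measurable circle_measure" by (rule boundary_fun_measurable[OF hol])
  have Gm [measurable]: "G \<in> borel_measurable circle_measure" unfolding G_def by measurable
  have G0: "0 \<le> G \<zeta>" for \<zeta> by (simp add: G_def)
  have B0: "0 \<le> B j" for j using B[of j] by simp
  have sk: "summable (\<lambda>i. B (Suc (k + i)) * (1/2) ^ (k + i))" for k
    using summable_ignore_initial_segment[OF s, of k] by (simp add: add.commute)
  have S0: "0 \<le> (\<Sum>i. B (Suc (k + i)) * (1/2) ^ (k + i))" for k
    by (intro suminf_nonneg sk) (simp add: B0)
  have iG: "integrable circle_measure (\<lambda>\<zeta>. max 0 (G \<zeta> - B k))"
    and eG: "(\<integral>\<zeta>. max 0 (G \<zeta> - B k) \<partial>circle_measure) \<le> (\<Sum>i. B (Suc (k + i)) * (1/2) ^ (k + i))" for k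
  proof -
    have le: "(\<integral>\<^sup>+\<zeta>. ennreal (max 0 (G \<zeta> - B k)) \<partial>circle_measure) \<le> ennreal (\<Sum>i. B (Suc (k + i)) * (1/2) ^ (k + i))"
      using nn_integral_excess_le[of B G, OF m Gm B sk] by (simp add: ennreal_max_0)
    show i: "integrable circle_measure (\<lambda>\<zeta>. max 0 (G \<zeta> - B k))"
      by (rule integrableI_nonneg) (use le_less_trans[OF le ennreal_less_top] in auto)
    show "(\<integral>\<zeta>. max 0 (G \<zeta> - B k) \<partial>circle_measure) \<le> (\<Sum>i. B (Suc (k + i)) * (1/2) ^ (k + i))"
      using le S0 by (subst (asm) nn_integral_eq_integral[OF i]) (auto simp: ennreal_le_iff)
  qed
  \<comment> \<open>Integrability of the root comes from \<open>s\<close>, through the excess over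
    \<open>B 0\<close>.\<close>
  have intG: "integrable circle_measure G"
  proof (rule Bochner_Integration.integrable_bound)
    show "integrable circle_measure (\<lambda>\<zeta>. B 0 + max 0 (G \<zeta> - B 0))"
      by (intro Bochner_Integration.integrable_add iG) simp
    show "AE \<zeta> in circle_measure. norm (G \<zeta>) \<le> norm (B 0 + max 0 (G \<zeta> - B 0))"
      using G0 B0[of 0] by (intro AE_I2) auto
  qed measurable
  let ?U = "\<lambda>\<eta>. \<integral>\<zeta>. poisson (of_real r * \<eta>) \<zeta> * G \<zeta> \<partial>circle_measure"
  \<comment> \<open>The Poisson bound for \<open>log_plus\<close> is divided by \<open>Suc m\<close>
    before Jensen's inequality for the exponential, so that only the integrable root
    \<open>G\<close> is averaged; the power is restored afterwards.\<close>
  have fU: "norm (f (of_real r * \<eta>)) \<le> ?U \<eta> ^ Suc m" if "norm \<eta> = 1" for \<eta>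
  proof -
    have z: "norm (of_real r * \<eta>) < 1" using that r by (simp add: norm_mult)
    have iu: "integrable circle_measure (\<lambda>\<zeta>. log_plus (norm (boundary_fun f \<zeta>)) / real (Suc m))"
      using smirnov_log_plus_integrable[OF f] by simp
    have le: "log_plus (norm (f (of_real r * \<eta>))) / real (Suc m) \<le>
      (\<integral>\<zeta>. poisson (of_real r * \<eta>) \<zeta> * log_plus (norm (boundary_fun f \<zeta>)) \<partial>circle_measure) / real (Suc m)"
      by (intro divide_right_mono smirnov_poisson f z) simp
    have "exp (log_plus (norm (f (of_real r * \<eta>))) / real (Suc m)) \<le>
       exp (\<integral>\<zeta>. poisson (of_real r * \<eta>) \<zeta> * (log_plus (norm (boundary_fun f \<zeta>)) / real (Suc m)) \<partial>circle_measure)"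
      using le by simp
    also have "\<dots> \<le> ?U \<eta>"
      unfolding G_def by (rule jensen_exp_poisson[OF z iu]) (rule intG[unfolded G_def])
    finally have "exp (log_plus (norm (f (of_real r * \<eta>))) / real (Suc m)) \<le> ?U \<eta>" .
    then have "exp (log_plus (norm (f (of_real r * \<eta>))) / real (Suc m)) ^ Suc m \<le> ?U \<eta> ^ Suc m"
      by (intro power_mono) auto
    also have "exp (log_plus (norm (f (of_real r * \<eta>))) / real (Suc m)) ^ Suc m = max 1 (norm (f (of_real r * \<eta>)))"
      by (simp only: exp_divide_power_eq[OF zero_less_Suc] exp_log_plus)
    finally show ?thesis by linarith
  qed
  have "norm (taylor_coeff f n) * (1/4) \<le> norm (taylor_coeff f n) * r ^ n"
    using one_minus_half_power_ge[OF n] by (intro mult_left_mono) (auto simp: r_def)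
  also have "\<dots> \<le> (\<integral>\<eta>. norm (f (of_real r * \<eta>)) \<partial>circle_measure)"
    by (rule norm_taylor_coeff_le[OF hol r])
  also have "\<dots> \<le> (\<integral>\<eta>. ?U \<eta> ^ Suc m \<partial>circle_measure)"
  proof (rule integral_mono)
    show "integrable circle_measure (\<lambda>\<eta>. norm (f (of_real r * \<eta>)))"
      by (intro integrable_circle_continuous continuous_intros continuous_on_circle_dilate hol r)
    show "integrable circle_measure (\<lambda>\<eta>. ?U \<eta> ^ Suc m)"
      by (rule poisson_split_integral_le(1)[OF r intG G0 B0[of 0]])
  qed (rule fU, simp add: space_circle_measure)
  also have "\<dots> \<le> 2 ^ Suc m * ((\<integral>\<zeta>. min (G \<zeta>) (B k) ^ Suc m \<partial>circle_measure) +
            (2 / (1 - r)) ^ m * (\<integral>\<zeta>. max 0 (G \<zeta> - B k) \<partial>circle_measure) ^ Suc m)"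
    by (rule poisson_split_integral_le[OF r intG G0 B0])
  also have "2 / (1 - r) = 4 * 2 ^ k" by (simp add: r_def field_simps)
  also have "2 ^ Suc m * ((\<integral>\<zeta>. min (G \<zeta>) (B k) ^ Suc m \<partial>circle_measure) +
            (4 * 2 ^ k) ^ m * (\<integral>\<zeta>. max 0 (G \<zeta> - B k) \<partial>circle_measure) ^ Suc m) \<le>
    2 ^ Suc m * ((B 0 ^ Suc m + (\<Sum>j<k. B (Suc j) ^ Suc m * (1/2) ^ j)) +
      (4 * 2 ^ k) ^ m * (\<Sum>i. B (Suc (k + i)) * (1/2) ^ (k + i)) ^ Suc m)"
    by (intro mult_left_mono add_mono integral_truncated_power_le m Gm G0 B power_mono eG
          Bochner_Integration.integral_nonneg) auto
  finally show ?thesis by (simp add: algebra_simps)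
qed

section \<open>Weighted sequence inequalities\<close>

text \<open>
  Exponents are encoded by their reciprocals: \<open>\<theta> = 1 / q\<close>, so that \<open>\<theta> = 0\<close> stands for bounded
  sequences. Only meant for nonnegative sequences.
\<close>

definition lseq :: "real \<Rightarrow> (nat \<Rightarrow> real) \<Rightarrow> bool" where
  "lseq \<theta> x \<longleftrightarrow> (if \<theta> = 0 then \<exists>C. \<forall>k. x k \<le> C else summable (\<lambda>k. x k powr (1 / \<theta>)))"

lemma lseq_mono:
  assumes "lseq \<theta> y" "0 \<le> \<theta>" and "\<And>k. 0 \<le> x k" "\<And>k. x k \<le> y k"
  shows "lseq \<theta> x"
proof (cases "\<theta> = 0")
  case True
  then obtain C where "\<forall>k. y k \<le> C" using assms(1) by (auto simp: lseq_def)
  then have "\<forall>k. x k \<le> C" using assms(4) order_trans by blast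
  then show ?thesis using True by (auto simp: lseq_def)
next
  case False
  have "summable (\<lambda>k. x k powr (1 / \<theta>))"
    by (rule summable_comparison_test'[of "\<lambda>k. y k powr (1 / \<theta>)" 0])
       (use assms False in \<open>auto simp: lseq_def intro!: powr_mono2\<close>)
  then show ?thesis using False by (simp add: lseq_def)
qed

lemma lseq_cmult:
  assumes "lseq \<theta> x" "0 \<le> c" and "\<And>k. 0 \<le> x k"
  shows "lseq \<theta> (\<lambda>k. c * x k)"
proof (cases "\<theta> = 0")
  case True
  then obtain C where "\<forall>k. x k \<le> C" using assms by (auto simp: lseq_def)
  then have "\<forall>k. c * x k \<le> c * C" using assms(2) by (simp add: mult_left_mono)
  then show ?thesis using True by (auto simp: lseq_def)
next
  case False
  then show ?thesis using assms by (simp add: lseq_def powr_mult summable_mult)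
qed

lemma powr_add_le:
  fixes x y s :: real
  assumes "0 \<le> x" "0 \<le> y" "0 \<le> s"
  shows "(x + y) powr s \<le> 2 powr s * (x powr s + y powr s)"
proof -
  have "(x + y) powr s \<le> (2 * max x y) powr s" using assms by (intro powr_mono2) auto
  also have "\<dots> = 2 powr s * max x y powr s" using assms by (simp add: powr_mult)
  also have "max x y powr s \<le> x powr s + y powr s" by (simp add: max_def)
  finally show ?thesis by simp
qed

lemma lseq_add:
  assumes "lseq \<theta> x" "lseq \<theta> y" "0 \<le> \<theta>" and "\<And>k. 0 \<le> x k" "\<And>k. 0 \<le> y k"
  shows "lseq \<theta> (\<lambda>k. x k + y k)"
proof (cases "\<theta> = 0")
  case True
  then obtain C D where "\<forall>k. x k \<le> C" "\<forall>k. y k \<le> D" using assms by (auto simp: lseq_def)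
  then have "\<forall>k. x k + y k \<le> C + D" by (simp add: add_mono)
  then show ?thesis using True by (auto simp: lseq_def)
next
  case False
  have "summable (\<lambda>k. (x k + y k) powr (1 / \<theta>))"
  proof (rule summable_comparison_test')
    show "summable (\<lambda>k. 2 powr (1 / \<theta>) * (x k powr (1 / \<theta>) + y k powr (1 / \<theta>)))"
      using assms False by (intro summable_mult summable_add) (auto simp: lseq_def)
    show "norm ((x k + y k) powr (1 / \<theta>)) \<le> 2 powr (1 / \<theta>) * (x k powr (1 / \<theta>) + y k powr (1 / \<theta>))" for k
      using powr_add_le[of "x k" "y k" "1 / \<theta>"] assms by simp
  qed
  then show ?thesis using False by (simp add: lseq_def)
qed

lemma lseq_powr:
  assumes "lseq \<theta> x" "0 \<le> \<theta>" "0 < a" and x: "\<And>k. 0 \<le> x k"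
  shows "lseq (\<theta> * a) (\<lambda>k. x k powr a)"
proof (cases "\<theta> = 0")
  case True
  then obtain C where "\<forall>k. x k \<le> C" using assms by (auto simp: lseq_def)
  then have "\<forall>k. x k powr a \<le> C powr a" using assms by (auto intro!: powr_mono2)
  then show ?thesis using True by (auto simp: lseq_def)
next
  case False
  have "(x k powr a) powr (1 / (\<theta> * a)) = x k powr (1 / \<theta>)" for k
    using assms False by (simp add: powr_powr)
  then show ?thesis using assms False by (simp add: lseq_def)
qed

lemma lseq_power:
  assumes "lseq \<theta> x" "0 \<le> \<theta>" "0 < n" and x: "\<And>k. 0 \<le> x k"
  shows "lseq (\<theta> * real n) (\<lambda>k. x k ^ n)"
proof -
  have "x k powr real n = x k ^ n" for k using assms(3) x[of k] by (simp add: powr_realpow')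
  then show ?thesis using lseq_powr[OF assms(1,2) _ x, of "real n"] assms(3) by simp
qed

lemma lseq_imp_bounded:
  assumes "lseq \<theta> x" "0 \<le> \<theta>" and x: "\<And>k. 0 \<le> x k"
  shows "\<exists>C\<ge>0. \<forall>k. x k \<le> C"
proof (cases "\<theta> = 0")
  case True
  then obtain C where C: "\<forall>k. x k \<le> C" using assms by (auto simp: lseq_def)
  then have "0 \<le> C" using order_trans[OF x[of 0]] by blast
  then show ?thesis using C by blast
next
  case False
  then have "summable (\<lambda>k. x k powr (1 / \<theta>))" using assms by (simp add: lseq_def)
  then have "Bseq (\<lambda>k. x k powr (1 / \<theta>))"
    using summable_LIMSEQ_zero convergentI convergent_imp_Bseq by blast
  then obtain K where K: "0 < K" "\<And>k. norm (x k powr (1 / \<theta>)) \<le> K" by (auto simp: Bseq_def)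
  have "x k \<le> K powr \<theta>" for k
  proof -
    have "(x k powr (1 / \<theta>)) powr \<theta> \<le> K powr \<theta>" using K(2)[of k] assms(2) by (intro powr_mono2) auto
    then show ?thesis using False x[of k] by (simp add: powr_powr)
  qed
  then show ?thesis by (intro exI[of _ "K powr \<theta>"]) simp
qed

lemma lseq_geometric:
  assumes "0 < \<rho>" "\<rho> < 1" "0 \<le> \<theta>"
  shows "lseq \<theta> (\<lambda>k. \<rho> ^ k)"
proof (cases "\<theta> = 0")
  case True
  then show ?thesis using assms by (auto simp: lseq_def intro!: exI[of _ 1] power_le_one)
next
  case False
  have "(\<rho> ^ k) powr (1 / \<theta>) = (\<rho> powr (1 / \<theta>)) ^ k" for k
    using assms by (simp add: powr_realpow[symmetric] powr_powr mult.commute)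
  moreover have "\<rho> powr (1 / \<theta>) < 1" using powr_less_mono2[of "1 / \<theta>" \<rho> 1] assms False by simp
  ultimately show ?thesis using False by (simp add: lseq_def)
qed

lemma lseq_Suc:
  assumes "lseq \<theta> x"
  shows "lseq \<theta> (\<lambda>k. x (Suc k))"
  using assms summable_Suc_iff[of "\<lambda>k. x k powr (1 / \<theta>)"] by (auto simp: lseq_def split: if_splits)

text \<open>The distance of \<open>k\<close> and \<open>j\<close>, kept natural to serve as an
  exponent: of the two truncated differences at least one vanishes.\<close>

definition index_dist :: "nat \<Rightarrow> nat \<Rightarrow> nat" where
  "index_dist k j = (k - j) + (j - k)"

lemma index_dist_commute: "index_dist k j = index_dist j k"
  by (simp add: index_dist_def)

lemma index_dist_geometric:
  fixes \<tau> :: real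
  assumes "0 \<le> \<tau>" "\<tau> < 1"
  shows "summable (\<lambda>j. \<tau> ^ index_dist k j)" "(\<Sum>j. \<tau> ^ index_dist k j) \<le> 2 / (1 - \<tau>)"
proof -
  have gs: "(\<lambda>i. \<tau> ^ i) sums (1 / (1 - \<tau>))" using assms by (intro geometric_sums) simp
  then have tail: "(\<lambda>i. \<tau> ^ index_dist k (i + k)) sums (1 / (1 - \<tau>))" by (simp add: index_dist_def)
  then show sm: "summable (\<lambda>j. \<tau> ^ index_dist k j)"
    using summable_iff_shift[of "\<lambda>j. \<tau> ^ index_dist k j" k] sums_summable by blast
  have "(\<Sum>j<k. \<tau> ^ index_dist k j) = (\<Sum>j<k. \<tau> ^ Suc j)"
    by (subst sum.nat_diff_reindex[symmetric]) (auto simp: index_dist_def intro!: sum.cong)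
  also have "\<dots> \<le> (\<Sum>j<k. \<tau> ^ j)" using assms by (intro sum_mono power_decreasing) auto
  also have "\<dots> \<le> (\<Sum>j. \<tau> ^ j)" using assms sums_summable[OF gs] by (intro sum_le_suminf) auto
  also have "\<dots> = 1 / (1 - \<tau>)" using gs by (simp add: sums_iff)
  finally have "(\<Sum>j<k. \<tau> ^ index_dist k j) \<le> 1 / (1 - \<tau>)" .
  moreover have "(\<Sum>j. \<tau> ^ index_dist k j) = (\<Sum>i. \<tau> ^ index_dist k (i + k)) + (\<Sum>j<k. \<tau> ^ index_dist k j)"
    by (rule suminf_split_initial_segment[OF sm])
  ultimately show "(\<Sum>j. \<tau> ^ index_dist k j) \<le> 2 / (1 - \<tau>)" using tail by (simp add: sums_iff add_divide_distrib[symmetric])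
qed

text \<open>
  The sum is at most a constant times the supremum of the terms \<open>\<sigma> ^ index_dist k j * x j\<close> with \<open>\<sigma> = sqrt \<rho>\<close>,
  and the power of a supremum is at most the sum of the powers; this treats exponents below and above 1 alike.
\<close>

lemma lseq_convolution:
  assumes \<rho>: "0 < \<rho>" "\<rho> < 1" and x: "lseq \<theta> x" "0 \<le> \<theta>" "\<And>k. 0 \<le> x k"
  shows "summable (\<lambda>j. \<rho> ^ index_dist k j * x j)" and "lseq \<theta> (\<lambda>k. \<Sum>j. \<rho> ^ index_dist k j * x j)"
proof -
  obtain C where C: "0 \<le> C" "\<And>k. x k \<le> C" using lseq_imp_bounded[OF x] by blast
  show sm: "summable (\<lambda>j. \<rho> ^ index_dist k j * x j)" for k
    by (rule summable_comparison_test'[OF summable_mult2[OF index_dist_geometric(1)[of \<rho> k], of C]])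
       (use \<rho> C x in \<open>auto simp: abs_mult intro!: mult_left_mono\<close>)
  show "lseq \<theta> (\<lambda>k. \<Sum>j. \<rho> ^ index_dist k j * x j)"
  proof (cases "\<theta> = 0")
    case True
    have "(\<Sum>j. \<rho> ^ index_dist k j * x j) \<le> 2 / (1 - \<rho>) * C" for k
    proof -
      have "(\<Sum>j. \<rho> ^ index_dist k j * x j) \<le> (\<Sum>j. \<rho> ^ index_dist k j * C)"
        using \<rho> C by (intro suminf_le sm summable_mult2 index_dist_geometric mult_left_mono) auto
      also have "\<dots> = (\<Sum>j. \<rho> ^ index_dist k j) * C" using \<rho> by (intro suminf_mult2[symmetric] index_dist_geometric) auto
      also have "\<dots> \<le> 2 / (1 - \<rho>) * C" using \<rho> C by (intro mult_right_mono index_dist_geometric) auto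
      finally show ?thesis .
    qed
    then show ?thesis using True by (auto simp: lseq_def)
  next
    case False
    define s where "s = 1 / \<theta>"
    have s: "0 < s" using False x(2) by (simp add: s_def)
    define \<sigma> where "\<sigma> = sqrt \<rho>"
    have \<sigma>: "0 < \<sigma>" "\<sigma> < 1" "\<sigma> * \<sigma> = \<rho>" using \<rho> by (auto simp: \<sigma>_def)
    define \<tau> where "\<tau> = \<sigma> powr s"
    have \<tau>: "0 < \<tau>" "\<tau> < 1" using \<sigma> s powr_less_mono2[of s \<sigma> 1] by (simp_all add: \<tau>_def)
    define X where "X j = x j powr s" for j
    have X: "summable X" "\<And>j. 0 \<le> X j" using x False by (auto simp: lseq_def X_def[abs_def] s_def)
    have powX: "(\<sigma> ^ n * x j) powr s = \<tau> ^ n * X j" for n j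
    proof -
      have "(\<sigma> ^ n) powr s = \<tau> ^ n"
        using \<sigma> by (simp add: \<tau>_def powr_realpow[symmetric] powr_powr mult.commute)
      then show ?thesis using \<sigma> x(3)[of j] by (simp add: powr_mult X_def)
    qed
    have smW: "summable (\<lambda>j. \<tau> ^ index_dist k j * X j)" for k
      by (rule summable_comparison_test'[OF X(1)])
         (use \<tau> X in \<open>auto simp: abs_mult intro!: mult_left_le_one_le power_le_one\<close>)
    define W where "W k = (\<Sum>j. \<tau> ^ index_dist k j * X j)" for k
    have W0: "0 \<le> W k" for k unfolding W_def using \<tau> X by (intro suminf_nonneg smW) auto
    have bd: "(\<Sum>j. \<rho> ^ index_dist k j * x j) powr s \<le> (2 / (1 - \<sigma>)) powr s * W k" for k
    proof -
      have le: "\<sigma> ^ index_dist k j * x j \<le> W k powr \<theta>" for j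
      proof -
        have "\<tau> ^ index_dist k j * X j \<le> W k"
          unfolding W_def using sum_le_suminf[OF smW, of "{j}" k] \<tau> X by simp
        then have "((\<sigma> ^ index_dist k j * x j) powr s) powr \<theta> \<le> W k powr \<theta>"
          unfolding powX using x(2) \<tau> X by (intro powr_mono2) auto
        then show ?thesis using \<sigma> x(3)[of j] False by (simp add: powr_powr s_def)
      qed
      have "(\<Sum>j. \<rho> ^ index_dist k j * x j) \<le> (\<Sum>j. \<sigma> ^ index_dist k j * W k powr \<theta>)"
      proof (intro suminf_le sm summable_mult2 index_dist_geometric)
        fix j
        have "\<rho> ^ index_dist k j * x j = \<sigma> ^ index_dist k j * (\<sigma> ^ index_dist k j * x j)"
          by (simp add: \<sigma>(3)[symmetric] power_mult_distrib)
        also have "\<dots> \<le> \<sigma> ^ index_dist k j * W k powr \<theta>" using \<sigma> by (intro mult_left_mono le) auto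
        finally show "\<rho> ^ index_dist k j * x j \<le> \<sigma> ^ index_dist k j * W k powr \<theta>" .
      qed (use \<sigma> in auto)
      also have "\<dots> = (\<Sum>j. \<sigma> ^ index_dist k j) * W k powr \<theta>"
        using \<sigma> by (intro suminf_mult2[symmetric] index_dist_geometric) auto
      also have "\<dots> \<le> 2 / (1 - \<sigma>) * W k powr \<theta>"
        using \<sigma> by (intro mult_right_mono index_dist_geometric) auto
      finally have "(\<Sum>j. \<rho> ^ index_dist k j * x j) powr s \<le> (2 / (1 - \<sigma>) * W k powr \<theta>) powr s"
        using s \<rho> x(3) by (intro powr_mono2 suminf_nonneg sm) auto
      also have "\<dots> = (2 / (1 - \<sigma>)) powr s * W k"
        using \<sigma> False W0[of k] by (subst powr_mult) (auto simp: powr_powr s_def)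
      finally show ?thesis .
    qed
    have "summable W"
    proof (rule summableI_nonneg_bounded[OF W0])
      fix N
      \<comment> \<open>Exchanging the sums and using the symmetry of \<open>index_dist\<close>
        bounds the partial sums of \<open>W\<close> by a multiple of the sum of
        \<open>X\<close>.\<close>
      have "(\<Sum>k<N. W k) = (\<Sum>j. \<Sum>k<N. \<tau> ^ index_dist k j * X j)"
        unfolding W_def by (rule suminf_sum[symmetric]) (rule smW)
      also have "\<dots> \<le> (\<Sum>j. 2 / (1 - \<tau>) * X j)"
      proof (intro suminf_le summable_mult X summable_sum smW)
        fix j
        have "(\<Sum>k<N. \<tau> ^ index_dist k j) \<le> (\<Sum>k. \<tau> ^ index_dist j k)"
          unfolding index_dist_commute[of _ j] using \<tau> by (intro sum_le_suminf index_dist_geometric) auto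
        also have "\<dots> \<le> 2 / (1 - \<tau>)" using \<tau> by (intro index_dist_geometric) auto
        finally show "(\<Sum>k<N. \<tau> ^ index_dist k j * X j) \<le> 2 / (1 - \<tau>) * X j"
          unfolding sum_distrib_right[symmetric] by (intro mult_right_mono X)
      qed
      finally show "(\<Sum>k<N. W k) \<le> (\<Sum>j. 2 / (1 - \<tau>) * X j)" .
    qed
    from summable_mult[OF this, of "(2 / (1 - \<sigma>)) powr s"]
    have "summable (\<lambda>k. (\<Sum>j. \<rho> ^ index_dist k j * x j) powr s)"
      by (rule summable_comparison_test') (use bd in auto)
    then show ?thesis using False by (simp add: lseq_def s_def)
  qed
qed

text \<open>In terms of reciprocals the dual of \<theta> is \<open>1 - \<theta>\<close>; exponents
  at most 1, that is \<open>\<theta> \<ge> 1\<close>, have the bounded sequences as dual, whence the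
  truncation at 0. Only summability is claimed, so a crude form of Young's inequality
  suffices.\<close>

lemma lseq_holder:
  assumes b: "lseq \<theta> b" "\<And>k. 0 \<le> b k" and v: "lseq (max 0 (1 - \<theta>)) v" "\<And>k. 0 \<le> v k" and \<theta>: "0 \<le> \<theta>"
  shows "summable (\<lambda>k. b k * v k)"
proof -
  consider "\<theta> = 0" | "1 \<le> \<theta>" | "0 < \<theta>" "\<theta> < 1" using \<theta> by linarith
  then show ?thesis
  proof cases
    case 1
    obtain C where C: "0 \<le> C" "\<And>k. b k \<le> C" using lseq_imp_bounded[OF b(1) \<theta> b(2)] by blast
    have sv: "summable v" using v 1 by (simp add: lseq_def)
    show ?thesis
      by (rule summable_comparison_test'[OF summable_mult[OF sv, of C], of 0]) (use b C v in \<open>auto simp: abs_mult intro!: mult_right_mono\<close>)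
  next
    case 2
    obtain C where C: "0 \<le> C" "\<And>k. b k \<le> C" using lseq_imp_bounded[OF b(1) \<theta> b(2)] by blast
    obtain D where D: "0 \<le> D" "\<And>k. v k \<le> D"
      using lseq_imp_bounded[OF v(1) max.cobounded1 v(2)] by blast
    have sb: "summable (\<lambda>k. b k powr (1 / \<theta>))" using b 2 by (simp add: lseq_def)
    \<comment> \<open>Boundedness of \<open>b\<close> trades the first power for the smaller
      exponent \<open>1 / \<theta>\<close>.\<close>
    have le: "b k * v k \<le> C powr (1 - 1 / \<theta>) * D * b k powr (1 / \<theta>)" for k
    proof -
      have "b k = b k powr (1 - 1 / \<theta>) * b k powr (1 / \<theta>)"
        using b(2)[of k] by (cases "b k = 0") (simp_all add: powr_add[symmetric])
      also have "\<dots> \<le> C powr (1 - 1 / \<theta>) * b k powr (1 / \<theta>)"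
        using 2 b C by (intro mult_right_mono powr_mono2) auto
      finally have "b k * v k \<le> (C powr (1 - 1 / \<theta>) * b k powr (1 / \<theta>)) * D"
        using v D by (intro mult_mono) auto
      then show ?thesis by (simp add: mult_ac)
    qed
    show ?thesis
      by (rule summable_comparison_test'[OF summable_mult[OF sb, of "C powr (1 - 1 / \<theta>) * D"], of 0])
         (use b v le in \<open>auto simp: abs_mult\<close>)
  next
    case 3
    have s: "summable (\<lambda>k. b k powr (1 / \<theta>) + v k powr (1 / (1 - \<theta>)))"
      using b v 3 by (intro summable_add) (auto simp: lseq_def max_def split: if_splits)
    have le: "b k * v k \<le> b k powr (1 / \<theta>) + v k powr (1 / (1 - \<theta>))" for k
    proof -
      \<comment> \<open>Both factors are bounded by powers of the larger of the two quantities, with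
        exponents adding up to 1.\<close>
      define t where "t = max (b k powr (1 / \<theta>)) (v k powr (1 / (1 - \<theta>)))"
      have "b k = (b k powr (1 / \<theta>)) powr \<theta>" using 3 b(2)[of k] by (simp add: powr_powr)
      also have "\<dots> \<le> t powr \<theta>" unfolding t_def using 3 by (intro powr_mono2) auto
      finally have 1: "b k \<le> t powr \<theta>" .
      have "v k = (v k powr (1 / (1 - \<theta>))) powr (1 - \<theta>)" using 3 v(2)[of k] by (simp add: powr_powr)
      also have "\<dots> \<le> t powr (1 - \<theta>)" unfolding t_def using 3 by (intro powr_mono2) auto
      finally have "b k * v k \<le> t powr \<theta> * t powr (1 - \<theta>)" using 1 b v by (intro mult_mono) auto
      also have "\<dots> = t"
      proof -
        have "0 \<le> t" by (simp add: t_def max_def)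
        then show ?thesis by (cases "t = 0") (simp_all add: powr_add[symmetric])
      qed
      also have "t \<le> b k powr (1 / \<theta>) + v k powr (1 / (1 - \<theta>))" by (simp add: t_def max_def)
      finally show ?thesis .
    qed
    show ?thesis by (rule summable_comparison_test'[OF s, of 0]) (use b v le in \<open>auto simp: abs_mult\<close>)
  qed
qed

text \<open>The Abel-Dini theorem. Divergence: a block from \<open>N\<close> to a distant
  \<open>n\<close> has sum at least \<open>(S n - S N) / S n\<close>, hence at least 1/2.
  Convergence: beyond the leading zeros, a multiple of the terms is dominated by the telescoping
  differences of \<open>S k powr (1 - \<alpha>)\<close>.\<close>

lemma abel_dini:
  fixes d :: "nat \<Rightarrow> real"
  assumes d: "\<And>k. 0 \<le> d k" and ns: "\<not> summable d"
  defines "S \<equiv> \<lambda>k. \<Sum>i\<le>k. d i"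
  shows "\<not> summable (\<lambda>k. d k / S k)" and "1 < \<alpha> \<Longrightarrow> summable (\<lambda>k. d k / S k powr \<alpha>)"
proof -
  have S0: "0 \<le> S k" and dS: "d k \<le> S k" for k
    unfolding S_def using d by (auto intro!: sum_nonneg member_le_sum)
  have SS: "S (Suc k) = S k + d (Suc k)" for k by (simp add: S_def)
  have mono: "S i \<le> S j" if "i \<le> j" for i j
    using that d by (auto simp: S_def intro!: sum_mono2)
  have unb: "\<exists>k. C < S k" for C
  proof (rule ccontr)
    assume "\<not> ?thesis"
    then have le: "S k \<le> C" for k by (simp add: not_less)
    have "sum d {..<n} \<le> C" for n
      using le[of n] d[of n] by (simp add: S_def lessThan_Suc_atMost[symmetric])
    then have "summable d" by (rule summableI_nonneg_bounded[OF d])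
    then show False using ns by simp
  qed
  show "\<not> summable (\<lambda>k. d k / S k)"
  proof
    assume "summable (\<lambda>k. d k / S k)"
    then obtain N where N: "\<And>m n. m \<ge> N \<Longrightarrow> norm (sum (\<lambda>k. d k / S k) {m..<n}) < 1/2"
      unfolding summable_Cauchy by (metis half_gt_zero_iff zero_less_one)
    obtain n where n: "max 1 (2 * S N) < S n" using unb by blast
    have "N < n"
    proof (rule ccontr)
      assume "\<not> N < n"
      then have "S n \<le> S N" by (intro mono) auto
      then show False using n S0[of N] by simp
    qed
    have "1/2 \<le> (S n - S N) / S n" using n by (simp add: field_simps)
    also have "S n - S N = sum d {Suc N..<Suc n}"
      using sum.atLeastLessThan_concat[of 0 "Suc N" "Suc n" d] \<open>N < n\<close>
      by (simp add: S_def atMost_atLeast0 atLeastLessThanSuc_atLeastAtMost)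
    also have "sum d {Suc N..<Suc n} / S n = (\<Sum>k\<in>{Suc N..<Suc n}. d k / S n)"
      by (rule sum_divide_distrib)
    also have "\<dots> \<le> (\<Sum>k\<in>{Suc N..<Suc n}. d k / S k)"
    proof (rule sum_mono)
      fix k assume "k \<in> {Suc N..<Suc n}"
      then have "S k \<le> S n" by (intro mono) auto
      \<comment> \<open>Leading zeros of \<open>d\<close> give quotients 0 / 0, which count as
        0.\<close>
      moreover have "d k = 0" if "S k = 0" using dS[of k] d[of k] that by simp
      ultimately show "d k / S n \<le> d k / S k"
        using S0[of k] d[of k] by (cases "S k = 0") (auto intro!: divide_left_mono mult_pos_pos)
    qed
    also have "\<dots> < 1/2" using N[of "Suc N" "Suc n"] by simp
    finally show False by simp
  qed
  show "summable (\<lambda>k. d k / S k powr \<alpha>)" if \<alpha>: "1 < \<alpha>"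
  proof -
    obtain N where N: "0 < S N" using unb by blast
    have pos: "0 < S k" if "N \<le> k" for k using mono[OF that] N by simp
    have step: "(\<alpha> - 1) * (d (Suc k) / S (Suc k) powr \<alpha>) \<le> S k powr (1 - \<alpha>) - S (Suc k) powr (1 - \<alpha>)" if "N \<le> k" for k
    proof -
      define x where "x = S k / S (Suc k)"
      have b: "0 < S k" "0 < S (Suc k)" using pos that by auto
      then have x: "0 < x" by (simp add: x_def)
      \<comment> \<open>Bernoulli's inequality for the negative exponent
        \<open>1 - \<alpha>\<close>, obtained from \<open>ln x \<le> x - 1\<close>.\<close>
      have "1 + (1 - \<alpha>) * ln x \<le> exp ((1 - \<alpha>) * ln x)" by (rule exp_ge_add_one_self)
      moreover have "(1 - \<alpha>) * (x - 1) \<le> (1 - \<alpha>) * ln x"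
        using \<alpha> ln_le_minus_one[OF x] by (intro mult_left_mono_neg) auto
      ultimately have "1 + (1 - \<alpha>) * (x - 1) \<le> exp ((1 - \<alpha>) * ln x)" by linarith
      then have "1 + (1 - \<alpha>) * (x - 1) \<le> x powr (1 - \<alpha>)" using x by (simp add: powr_def)
      then have "(1 + (1 - \<alpha>) * (x - 1)) * S (Suc k) powr (1 - \<alpha>) \<le> x powr (1 - \<alpha>) * S (Suc k) powr (1 - \<alpha>)"
        by (intro mult_right_mono) auto
      also have "\<dots> = S k powr (1 - \<alpha>)" using b by (simp add: x_def powr_divide)
      finally have "(\<alpha> - 1) * ((1 - x) * S (Suc k) powr (1 - \<alpha>)) \<le> S k powr (1 - \<alpha>) - S (Suc k) powr (1 - \<alpha>)"
        by (simp add: algebra_simps)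
      also have "(1 - x) * S (Suc k) powr (1 - \<alpha>) = d (Suc k) / S (Suc k) powr \<alpha>"
      proof -
        have "1 - x = d (Suc k) / S (Suc k)" using b SS[of k] by (simp add: x_def divide_simps)
        then show ?thesis using b by (simp add: powr_diff)
      qed
      finally show ?thesis .
    qed
    have "summable (\<lambda>k. (\<alpha> - 1) * (d (Suc (k + N)) / S (Suc (k + N)) powr \<alpha>))"
    proof (rule summableI_nonneg_bounded)
      show "0 \<le> (\<alpha> - 1) * (d (Suc (k + N)) / S (Suc (k + N)) powr \<alpha>)" for k
        using \<alpha> d by (intro mult_nonneg_nonneg divide_nonneg_nonneg) auto
      fix n
      have "(\<Sum>k<n. (\<alpha> - 1) * (d (Suc (k + N)) / S (Suc (k + N)) powr \<alpha>)) \<le>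
        (\<Sum>k<n. S (k + N) powr (1 - \<alpha>) - S (Suc k + N) powr (1 - \<alpha>))"
        using step by (intro sum_mono) simp
      also have "\<dots> = S N powr (1 - \<alpha>) - S (n + N) powr (1 - \<alpha>)"
        by (subst sum_lessThan_telescope') simp
      also have "\<dots> \<le> S N powr (1 - \<alpha>)" by simp
      finally show "(\<Sum>k<n. (\<alpha> - 1) * (d (Suc (k + N)) / S (Suc (k + N)) powr \<alpha>)) \<le> S N powr (1 - \<alpha>)" .
    qed
    from summable_mult[OF this, of "1 / (\<alpha> - 1)"]
    have "summable (\<lambda>k. 1 / (\<alpha> - 1) * (\<alpha> - 1) * (d (k + Suc N) / S (k + Suc N) powr \<alpha>))"
      by (simp only: mult.assoc add_Suc_right)
    moreover have "1 / (\<alpha> - 1) * (\<alpha> - 1) = 1" using \<alpha> by simp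
    ultimately have "summable (\<lambda>k. d (k + Suc N) / S (k + Suc N) powr \<alpha>)" by simp
    then show ?thesis using summable_iff_shift[of "\<lambda>k. d k / S k powr \<alpha>" "Suc N"] by blast
  qed
qed

text \<open>The constant sequence 1 settles \<open>\<theta> = 0\<close>. Otherwise a failure of the
  conclusion yields an explicit \<open>c\<close> contradicting \<open>dual\<close>: a sparse
  geometric sequence placed along the large values of \<open>v\<close> when
  \<open>\<theta> \<ge> 1\<close>, and a sequence from the Abel-Dini theorem when \<theta> lies
  between 0 and 1.\<close>

lemma lseq_converse_holder:
  assumes v: "\<And>k. 0 \<le> v k" and \<theta>: "0 \<le> \<theta>"
    and dual: "\<And>c. (\<And>k. 0 \<le> c k) \<Longrightarrow> lseq \<theta> c \<Longrightarrow> summable (\<lambda>k. c k * v k)"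
  shows "lseq (max 0 (1 - \<theta>)) v"
proof -
  consider "\<theta> = 0" | "1 \<le> \<theta>" | "0 < \<theta>" "\<theta> < 1" using \<theta> by linarith
  then show ?thesis
  proof cases
    case 1
    then have "summable (\<lambda>k. 1 * v k)" by (intro dual) (auto simp: lseq_def intro: exI[of _ 1])
    then show ?thesis using 1 v by (simp add: lseq_def)
  next
    case 2
    have "\<exists>C. \<forall>k. v k \<le> C"
    proof (rule ccontr)
      assume unb: "\<not> ?thesis"
      have ex: "\<exists>k>m. (2::real) ^ n < v k" for n m
      proof (rule ccontr)
        assume "\<not> ?thesis"
        then have le: "v k \<le> 2 ^ n" if "m < k" for k using that by (simp add: not_less) (meson leD le_less_linear)
        have "v k \<le> max (2 ^ n) (Max (v ` {..m}))" for k
        proof (cases "m < k")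
          case True
          then show ?thesis using le by (simp add: le_max_iff_disj)
        next
          case False
          then have "v k \<le> Max (v ` {..m})" by (intro Max_ge) auto
          then show ?thesis by (simp add: le_max_iff_disj)
        qed
        then show False using unb by blast
      qed
      have "\<exists>\<kappa>. \<forall>n. (2::real) ^ n < v (\<kappa> n) \<and> \<kappa> n < \<kappa> (Suc n)"
      proof (rule dependent_nat_choice)
        show "\<exists>x. (2::real) ^ 0 < v x" using ex by blast
        show "\<exists>y. (2::real) ^ Suc n < v y \<and> x < y" for x n using ex by blast
      qed
      then obtain \<kappa> where \<kappa>: "\<And>n. (2::real) ^ n < v (\<kappa> n)" "strict_mono \<kappa>"
        by (auto simp: strict_mono_Suc_iff)
      \<comment> \<open>Weight \<open>(1/2) ^ n\<close> at the \<open>n\<close>-th chosen index,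
        where \<open>v\<close> exceeds \<open>2 ^ n\<close>: every positive power of
        \<open>c\<close> is summable, yet the products with \<open>v\<close> do not tend to
        0.\<close>
      define c where "c k = (if k \<in> range \<kappa> then (1/2::real) ^ (inv \<kappa> k) else 0)" for k
      have c: "c (\<kappa> n) = (1/2) ^ n" for n
        using strict_mono_imp_inj_on[OF \<kappa>(2)] by (simp add: c_def inv_f_f)
      have "summable (\<lambda>n. c (\<kappa> n) powr (1 / \<theta>))"
        using lseq_geometric[of "1/2" \<theta>] 2 by (simp add: c lseq_def)
      then have "summable (\<lambda>k. c k powr (1 / \<theta>))"
        by (subst (asm) summable_mono_reindex[OF \<kappa>(2)]) (auto simp: c_def)
      then have "summable (\<lambda>k. c k * v k)" using 2 by (intro dual) (auto simp: c_def lseq_def)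
      then have "(\<lambda>k. c k * v k) \<longlonglongrightarrow> 0" by (rule summable_LIMSEQ_zero)
      then have "(\<lambda>n. c (\<kappa> n) * v (\<kappa> n)) \<longlonglongrightarrow> 0"
        using LIMSEQ_subseq_LIMSEQ[OF _ \<kappa>(2)] by (simp add: o_def)
      moreover have "1 \<le> c (\<kappa> n) * v (\<kappa> n)" for n
        using \<kappa>(1)[of n] by (simp add: c power_one_over divide_simps)
      ultimately have "(1::real) \<le> 0" by (intro LIMSEQ_le_const) auto
      then show False by simp
    qed
    then show ?thesis using 2 by (simp add: lseq_def max_def)
  next
    case 3
    define d where "d k = v k powr (1 / (1 - \<theta>))" for k
    define S where "S k = (\<Sum>i\<le>k. d i)" for k
    have d: "0 \<le> d k" for k by (simp add: d_def)
    have S0: "0 \<le> S k" for k unfolding S_def by (intro sum_nonneg d)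
    have "summable d"
    proof (rule ccontr)
      assume ns: "\<not> summable d"
      \<comment> \<open>Chosen so that \<open>c k powr (1 / \<theta>)\<close> is
        \<open>d k / S k powr (1 / \<theta>)\<close>, with convergent sum since
        \<open>1 / \<theta> > 1\<close>, while \<open>c k * v k\<close> is \<open>d k / S k\<close>,
        with divergent sum.\<close>
      define c where "c k = d k powr \<theta> / S k" for k
      have "c k powr (1 / \<theta>) = d k / S k powr (1 / \<theta>)" for k
        using 3 d[of k] S0[of k] by (simp add: c_def powr_divide powr_powr)
      moreover have "summable (\<lambda>k. d k / S k powr (1 / \<theta>))"
        unfolding S_def using 3 by (intro abel_dini(2)[OF d ns]) simp
      ultimately have lc: "lseq \<theta> c" using 3 by (simp add: lseq_def)
      have "summable (\<lambda>k. c k * v k)"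
        by (rule dual[OF _ lc]) (simp add: c_def S0)
      moreover have "c k * v k = d k / S k" for k
      proof -
        have "v k = d k powr (1 - \<theta>)" using 3 v[of k] by (simp add: d_def powr_powr)
        then have "c k * v k = d k powr \<theta> * d k powr (1 - \<theta>) / S k" by (simp add: c_def)
        also have "d k powr \<theta> * d k powr (1 - \<theta>) = d k"
          using d[of k] by (cases "d k = 0") (simp_all add: powr_add[symmetric])
        finally show ?thesis .
      qed
      ultimately show False using abel_dini(1)[OF d ns] by (simp add: S_def)
    qed
    then show ?thesis using 3 by (simp add: lseq_def d_def[abs_def] max_def)
  qed
qed

section \<open>Dyadic discretization\<close>

lemma lseq_iff_ennreal:
  assumes "0 < s" and x: "\<And>k. 0 \<le> x k"
  shows "lseq (1 / s) x \<longleftrightarrow> (\<Sum>k. ennreal (x k powr s)) < \<infinity>"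
proof -
  have "(\<Sum>k. ennreal (x k powr s)) < \<infinity> \<longleftrightarrow> summable (\<lambda>k. x k powr s)"
  proof
    assume "(\<Sum>k. ennreal (x k powr s)) < \<infinity>"
    then show "summable (\<lambda>k. x k powr s)" by (intro summable_suminf_not_top) auto
  next
    assume "summable (\<lambda>k. x k powr s)"
    then have "(\<Sum>k. ennreal (x k powr s)) \<noteq> top" by (intro ennreal_suminf_neq_top) auto
    then show "(\<Sum>k. ennreal (x k powr s)) < \<infinity>" unfolding infinity_ennreal_def less_top .
  qed
  then show ?thesis using assms by (simp add: lseq_def)
qed

text \<open>Abstracts from two partitions: intervals shrinking to 0 for the Lorentz norm and their
  reflections shrinking to 1 for the radial integral.\<close>

definition dyadic_cover :: "(nat \<Rightarrow> real set) \<Rightarrow> bool" where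
  "dyadic_cover J \<longleftrightarrow> disjoint_family J \<and> (\<forall>j. J j \<in> sets lborel) \<and> (\<forall>j. emeasure lborel (J j) = ennreal ((1/2) ^ Suc j))
     \<and> (\<Union>j. J j) = {0<..<1}"

text \<open>The measure \<open>(1/2) ^ Suc j\<close> of a piece cancels \<open>2 ^ j\<close>, which
  stands for the singular density \<open>1 / s\<close> or \<open>1 / (1 - r)\<close>, and leaves the
  factor 1/2.\<close>

lemma dyadic_nn_integral:
  assumes J: "dyadic_cover J"
  shows "(\<And>j s. s \<in> J j \<Longrightarrow> ennreal (c j * 2 ^ j) \<le> h s) \<Longrightarrow>
      (\<Sum>j. ennreal (c j / 2)) \<le> (\<integral>\<^sup>+s\<in>{0<..<1}. h s \<partial>lborel)"
    and "(\<And>j s. s \<in> J j \<Longrightarrow> h s \<le> ennreal (c j * 2 ^ j)) \<Longrightarrow>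
      (\<integral>\<^sup>+s\<in>{0<..<1}. h s \<partial>lborel) \<le> (\<Sum>j. ennreal (c j / 2))"
proof -
  have [measurable]: "J j \<in> sets lborel" for j using J by (auto simp: dyadic_cover_def)
  let ?S = "\<lambda>s. \<Sum>j. ennreal (c j * 2 ^ j) * indicator (J j) s"
  have "(\<integral>\<^sup>+s. ?S s \<partial>lborel) = (\<Sum>j. \<integral>\<^sup>+s. ennreal (c j * 2 ^ j) * indicator (J j) s \<partial>lborel)"
    by (rule nn_integral_suminf) measurable
  also have "\<dots> = (\<Sum>j. ennreal (c j * 2 ^ j) * emeasure lborel (J j))"
    by (intro suminf_cong nn_integral_cmult_indicator) measurable
  also have "\<dots> = (\<Sum>j. ennreal (c j * 2 ^ j) * ennreal ((1/2) ^ Suc j))"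
    using J by (simp only: dyadic_cover_def)
  also have "\<dots> = (\<Sum>j. ennreal (c j / 2))"
    by (intro suminf_cong) (simp add: ennreal_mult''[symmetric] power_one_over)
  finally have eq: "(\<integral>\<^sup>+s. ?S s \<partial>lborel) = (\<Sum>j. ennreal (c j / 2))" .
  have S: "?S s = ennreal (c j * 2 ^ j)" "s \<in> {0<..<1}" if "s \<in> J j" for s j
  proof -
    show "s \<in> {0<..<1}" using that J by (auto simp: dyadic_cover_def)
    have "s \<notin> J i" if "i \<noteq> j" for i using \<open>s \<in> J j\<close> that J by (auto simp: dyadic_cover_def disjoint_family_on_def)
    then have "ennreal (c i * 2 ^ i) * indicator (J i) s = 0" if "i \<notin> {j}" for i using that by auto
    then have "?S s = (\<Sum>i\<in>{j}. ennreal (c i * 2 ^ i) * indicator (J i) s)" by (rule suminf_finite[rotated]) auto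
    then show "?S s = ennreal (c j * 2 ^ j)" using that by simp
  qed
  have S0: "?S s = 0" if "s \<notin> {0<..<1}" for s
  proof -
    have "s \<notin> J j" for j using that J unfolding dyadic_cover_def by blast
    then show ?thesis by simp
  qed
  have ex: "\<exists>j. s \<in> J j" if "s \<in> {0<..<1}" for s using that J unfolding dyadic_cover_def by blast
  {
    assume le: "\<And>j s. s \<in> J j \<Longrightarrow> ennreal (c j * 2 ^ j) \<le> h s"
    have "?S s \<le> h s * indicator {0<..<1} s" for s
    proof (cases "s \<in> {0<..<1}")
      case True
      then obtain j where j: "s \<in> J j" using ex by blast
      then show ?thesis unfolding S(1)[OF j] using le[OF j] True by simp
    qed (simp add: S0)
    then show "(\<Sum>j. ennreal (c j / 2)) \<le> (\<integral>\<^sup>+s\<in>{0<..<1}. h s \<partial>lborel)"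
      unfolding eq[symmetric] by (intro nn_integral_mono)
  }
  {
    assume le: "\<And>j s. s \<in> J j \<Longrightarrow> h s \<le> ennreal (c j * 2 ^ j)"
    have "h s * indicator {0<..<1} s \<le> ?S s" for s
    proof (cases "s \<in> {0<..<1}")
      case True
      then obtain j where j: "s \<in> J j" using ex by blast
      then show ?thesis unfolding S(1)[OF j] using le[OF j] True by simp
    qed simp
    then show "(\<integral>\<^sup>+s\<in>{0<..<1}. h s \<partial>lborel) \<le> (\<Sum>j. ennreal (c j / 2))"
      unfolding eq[symmetric] by (intro nn_integral_mono)
  }
qed

section \<open>The dyadic partitions at 0 and at 1\<close>

lemma half_power_antimono: "i \<le> j \<Longrightarrow> (1/2::real) ^ j \<le> (1/2) ^ i"
  by (rule power_decreasing) auto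

lemma dyadic_level:
  fixes s :: real
  assumes "0 < s" "s < 1"
  shows "\<exists>j. (1/2) ^ Suc j \<le> s \<and> s < (1/2) ^ j"
proof -
  have ex: "\<exists>j. (1/2::real) ^ Suc j \<le> s"
  proof -
    obtain n where "(1/2::real) ^ n < s" using real_arch_pow_inv[OF assms(1), of "1/2"] by auto
    moreover have "(1/2::real) ^ Suc n \<le> (1/2) ^ n" by (rule half_power_antimono) simp
    ultimately show ?thesis by (intro exI[of _ n]) linarith
  qed
  define j where "j = (LEAST j. (1/2::real) ^ Suc j \<le> s)"
  have "(1/2) ^ Suc j \<le> s" unfolding j_def using ex by (rule LeastI_ex)
  moreover have "s < (1/2) ^ j"
  proof (cases j)
    case (Suc i)
    then show ?thesis using not_less_Least[of i "\<lambda>j. (1/2::real) ^ Suc j \<le> s"] by (simp add: j_def not_le)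
  qed (use assms in simp)
  ultimately show ?thesis by blast
qed

lemma dyadic_intervals_disjoint:
  fixes s :: real
  assumes "(1/2) ^ Suc i \<le> s" "s < (1/2) ^ i" "(1/2) ^ Suc j \<le> s" "s < (1/2) ^ j"
  shows "i = j"
proof (rule ccontr)
  assume "i \<noteq> j"
  then consider "Suc i \<le> j" | "Suc j \<le> i" by linarith
  then show False
    using half_power_antimono[of "Suc i" j] half_power_antimono[of "Suc j" i] assms by cases linarith+
qed

lemma dyadic_cover_0: "dyadic_cover (\<lambda>j. {(1/2) ^ Suc j..<(1/2) ^ j})"
  unfolding dyadic_cover_def
proof (intro conjI allI)
  show "disjoint_family (\<lambda>j. {(1/2::real) ^ Suc j..<(1/2) ^ j})"
    unfolding disjoint_family_on_def
  proof (intro ballI impI)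
    fix i j :: nat assume "i \<noteq> j"
    show "{(1/2::real) ^ Suc i..<(1/2) ^ i} \<inter> {(1/2::real) ^ Suc j..<(1/2) ^ j} = {}"
    proof (rule equals0I)
      fix s assume "s \<in> {(1/2::real) ^ Suc i..<(1/2) ^ i} \<inter> {(1/2::real) ^ Suc j..<(1/2) ^ j}"
      then have "i = j"
        unfolding Int_iff atLeastLessThan_iff by (intro dyadic_intervals_disjoint[of i s j]) simp_all
      then show False using \<open>i \<noteq> j\<close> by simp
    qed
  qed
  show "emeasure lborel {(1/2::real) ^ Suc j..<(1/2) ^ j} = ennreal ((1/2) ^ Suc j)" for j
    by simp
  show "(\<Union>j. {(1/2::real) ^ Suc j..<(1/2) ^ j}) = {0<..<1}"
  proof safe
    fix s :: real and j assume s: "s \<in> {(1/2) ^ Suc j..<(1/2) ^ j}"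
    have "0 < (1/2::real) ^ Suc j" "(1/2::real) ^ j \<le> 1" by (auto intro: power_le_one)
    then show "s \<in> {0<..<1}"
      using s unfolding greaterThanLessThan_iff atLeastLessThan_iff greaterThanAtMost_iff by linarith
  next
    fix s :: real assume "s \<in> {0<..<1}"
    then show "s \<in> (\<Union>j. {(1/2::real) ^ Suc j..<(1/2) ^ j})"
      using dyadic_level[of s] by (simp del: power_Suc)
  qed
qed simp

lemma dyadic_cover_1: "dyadic_cover (\<lambda>j. {1 - (1/2) ^ j<..1 - (1/2) ^ Suc j})"
  unfolding dyadic_cover_def
proof (intro conjI allI)
  show "disjoint_family (\<lambda>j. {1 - (1/2::real) ^ j<..1 - (1/2) ^ Suc j})"
    unfolding disjoint_family_on_def
  proof (intro ballI impI)
    fix i j :: nat assume "i \<noteq> j"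
    show "{1 - (1/2::real) ^ i<..1 - (1/2) ^ Suc i} \<inter> {1 - (1/2::real) ^ j<..1 - (1/2) ^ Suc j} = {}"
    proof (rule equals0I)
      fix s assume "s \<in> {1 - (1/2::real) ^ i<..1 - (1/2) ^ Suc i} \<inter> {1 - (1/2::real) ^ j<..1 - (1/2) ^ Suc j}"
      then have "i = j"
        unfolding Int_iff greaterThanAtMost_iff by (intro dyadic_intervals_disjoint[of i "1 - s" j]) linarith+
      then show False using \<open>i \<noteq> j\<close> by simp
    qed
  qed
  show "emeasure lborel {1 - (1/2::real) ^ j<..1 - (1/2) ^ Suc j} = ennreal ((1/2) ^ Suc j)" for j
    by simp
  show "(\<Union>j. {1 - (1/2::real) ^ j<..1 - (1/2) ^ Suc j}) = {0<..<1}"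
  proof safe
    fix s :: real and j assume s: "s \<in> {1 - (1/2) ^ j<..1 - (1/2) ^ Suc j}"
    have "0 < (1/2::real) ^ Suc j" "(1/2::real) ^ j \<le> 1" by (auto intro: power_le_one)
    then show "s \<in> {0<..<1}"
      using s unfolding greaterThanLessThan_iff atLeastLessThan_iff greaterThanAtMost_iff by linarith
  next
    fix s :: real assume "s \<in> {0<..<1}"
    then show "s \<in> (\<Union>j. {1 - (1/2::real) ^ j<..1 - (1/2) ^ Suc j})"
      using dyadic_level[of "1 - s"] by (auto simp del: power_Suc simp: algebra_simps)
  qed
qed simp

text \<open>The parameter of \<open>lseq\<close> that belongs to an extended exponent.\<close>

definition recip :: "ennreal \<Rightarrow> real" where
  "recip q = (if q = \<infinity> then 0 else 1 / enn2real q)"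

lemma recip_nonneg: "0 \<le> recip q"
  by (simp add: recip_def)

lemma enn2real_pos: "0 < q \<Longrightarrow> q \<noteq> \<infinity> \<Longrightarrow> 0 < enn2real q"
  by (simp add: enn2real_positive_iff less_top)

lemma star2_ennreal:
  assumes "2 < t"
  shows "star2 (ennreal t) = ennreal (2 * t / (t - 2))"
proof -
  have "2 * ennreal t / (ennreal t - 2) = ennreal 2 * ennreal t / (ennreal t - ennreal 2)" by simp
  also have "\<dots> = ennreal (2 * t / (t - 2))"
    using assms by (simp add: divide_ennreal ennreal_mult'[symmetric] ennreal_minus del: ennreal_numeral)
  finally show ?thesis
    using assms ennreal_less_iff[of 2 t] by (simp add: star2_def)
qed

lemma star2_cases:
  assumes "0 < q"
  obtains "q = \<infinity>" "star2 q = 2" | t where "q = ennreal t" "0 < t" "t \<le> 2" "star2 q = \<infinity>"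
    | t where "q = ennreal t" "2 < t" "star2 q = ennreal (2 * t / (t - 2))"
proof (cases q)
  case (real t)
  then have t: "0 < t" using assms by simp
  show ?thesis
  proof (cases "2 < t")
    case True
    then show ?thesis using that(3) star2_ennreal real by blast
  next
    case False
    then have "\<not> 2 < ennreal t" using ennreal_less_iff[of 2 t] by simp
    then have "star2 q = \<infinity>" using real by (simp add: star2_def)
    then show ?thesis using that(2)[of t] real t False by simp
  qed
next
  case top
  then show ?thesis using that(1) by (simp add: star2_def)
qed

lemma star2_pos: "0 < q \<Longrightarrow> 0 < star2 q"
  by (erule star2_cases) auto

text \<open>The three cases in the definition of \<open>star2\<close> become one formula for
  reciprocals. Doubled, it is the dual parameter of \<open>lseq_holder\<close> for
  \<open>2 * recip q\<close>, that is for the exponent \<open>q / 2\<close>.\<close>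

lemma recip_star2:
  assumes "0 < q"
  shows "recip (star2 q) = max 0 (1/2 - recip q)"
  using assms by (rule star2_cases) (simp_all add: recip_def max_def field_simps)

section \<open>Lorentz norms and the rearrangement at dyadic points\<close>

lemma ennpowr_finite_iff: "ennpowr x a < top \<longleftrightarrow> x < top"
  by (auto simp: ennpowr_def less_top[symmetric])

text \<open>The set is nonempty because \<open>g\<close> is finite everywhere, so that its
  distribution function tends to 0. In the last claim \<open>t\<close> lies strictly above the
  infimum, so a member of the set lies below \<open>t\<close> and monotonicity applies.\<close>

lemma decreasing_rearrangement_props:
  assumes g [measurable]: "g \<in> borel_measurable circle_measure" and s: "0 < s"
  shows "{t. 0 \<le> t \<and> distribution_fun g t \<le> s} \<noteq> {}"
    and "0 \<le> decreasing_rearrangement g s"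
    and "s \<le> s' \<Longrightarrow> decreasing_rearrangement g s' \<le> decreasing_rearrangement g s"
    and "decreasing_rearrangement g s < t \<Longrightarrow> distribution_fun g t \<le> s"
proof -
  have meas: "{\<zeta> \<in> sphere 0 1. norm (g \<zeta>) > t} \<in> sets circle_measure" for t
    using borel_measurable_const[of t] unfolding space_circle_measure[symmetric] by measurable
  have anti: "distribution_fun g t' \<le> distribution_fun g t" if "t \<le> t'" for t t'
    unfolding distribution_fun_def using that by (intro circle.finite_measure_mono meas) auto
  show ne: "{t. 0 \<le> t \<and> distribution_fun g t \<le> s} \<noteq> {}"
  proof -
    have "(\<lambda>n. measure circle_measure {\<zeta> \<in> sphere 0 1. norm (g \<zeta>) > real n}) \<longlonglongrightarrow>
      measure circle_measure (\<Inter>n. {\<zeta> \<in> sphere 0 1. norm (g \<zeta>) > real n})"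
    proof (rule circle.finite_Lim_measure_decseq)
      show "range (\<lambda>n. {\<zeta> \<in> sphere 0 1. norm (g \<zeta>) > real n}) \<subseteq> sets circle_measure" using meas by blast
    qed (auto simp: decseq_def)
    also have "(\<Inter>n. {\<zeta> \<in> sphere 0 1. norm (g \<zeta>) > real n}) = {}"
      by auto (meson reals_Archimedean2 less_asym)
    finally have "(\<lambda>n. distribution_fun g (real n)) \<longlonglongrightarrow> 0" by (simp add: distribution_fun_def)
    then have "eventually (\<lambda>n. distribution_fun g (real n) < s) sequentially" using s by (rule order_tendstoD)
    then obtain n where "distribution_fun g (real n) < s" by (auto simp: eventually_sequentially)
    then show ?thesis by (auto intro!: exI[of _ "real n"])
  qed
  show "0 \<le> decreasing_rearrangement g s"
    unfolding decreasing_rearrangement_def by (rule cInf_greatest[OF ne]) simp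
  have bdd: "bdd_below {t. 0 \<le> t \<and> distribution_fun g t \<le> s}" for s
    by (rule bdd_belowI[of _ 0]) simp
  show "decreasing_rearrangement g s' \<le> decreasing_rearrangement g s" if "s \<le> s'"
    unfolding decreasing_rearrangement_def by (rule cInf_superset_mono[OF ne bdd]) (use that in auto)
  show "distribution_fun g t \<le> s" if "decreasing_rearrangement g s < t"
  proof -
    have "\<exists>u\<in>{t. 0 \<le> t \<and> distribution_fun g t \<le> s}. u < t"
      using that unfolding decreasing_rearrangement_def cInf_less_iff[OF ne bdd] .
    then obtain u where "distribution_fun g u \<le> s" "u < t" by blast
    then show ?thesis using anti[of u t] by linarith
  qed
qed

lemma dyadic_point_bounds:
  fixes s :: real
  assumes "s \<in> {(1/2) ^ Suc j..<(1/2) ^ j}"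
  shows "0 < s" "(1/2) ^ j / 2 \<le> s" "s \<le> (1/2) ^ j" "2 ^ j \<le> 1 / s" "1 / s \<le> 2 * 2 ^ j"
proof -
  have p: "0 < (1/2::real) ^ j" by simp
  show 1: "(1/2) ^ j / 2 \<le> s" and 2: "s \<le> (1/2) ^ j" using assms by simp_all
  then show 3: "0 < s" using p by linarith
  show "2 ^ j \<le> 1 / s" using 2 3 by (simp add: power_one_over field_simps)
  show "1 / s \<le> 2 * 2 ^ j" using 1 3 by (simp add: power_one_over field_simps)
qed

text \<open>Monotonicity bounds the rearrangement on a dyadic interval from below by its value at
  the right endpoint.\<close>

lemma lorentz_finite_imp_lseq:
  assumes p: "0 < p" and q: "0 < q" and g: "g \<in> borel_measurable circle_measure"
    and fin: "lorentz_norm p q g < \<infinity>"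
  shows "lseq (recip q) (\<lambda>j. decreasing_rearrangement g ((1/2) ^ j) * ((1/2) ^ j) powr (1/p))"
proof (cases "q = \<infinity>")
  case True
  let ?S = "SUP s\<in>{0<..}. ennreal (decreasing_rearrangement g s * s powr (1 / p))"
  have S: "?S < \<infinity>" using fin True by (simp add: lorentz_norm_def)
  have "decreasing_rearrangement g ((1/2) ^ j) * ((1/2) ^ j) powr (1/p) \<le> enn2real ?S" for j
  proof -
    have "ennreal (decreasing_rearrangement g ((1/2) ^ j) * ((1/2) ^ j) powr (1/p)) \<le> ?S"
      by (rule SUP_upper) simp
    then have "enn2real (ennreal (decreasing_rearrangement g ((1/2) ^ j) * ((1/2) ^ j) powr (1/p))) \<le> enn2real ?S"
      using S by (intro enn2real_mono) auto
    then show ?thesis using decreasing_rearrangement_props(2)[OF g, of "(1/2) ^ j"] by simp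
  qed
  then show ?thesis using True by (auto simp: lseq_def recip_def)
next
  case False
  define t where "t = enn2real q"
  have t: "0 < t" using enn2real_pos[OF q False] by (simp add: t_def)
  let ?h = "decreasing_rearrangement g"
  define x where "x j = ?h ((1/2) ^ j) * ((1/2) ^ j) powr (1/p)" for j
  \<comment> \<open>The loss in \<open>s powr (1/p)\<close> across one dyadic interval.\<close>
  define \<kappa> :: real where "\<kappa> = (1/2) powr (1/p)"
  have x0: "0 \<le> x j" for j unfolding x_def using decreasing_rearrangement_props(2)[OF g, of "(1/2) ^ j"] by simp
  have \<kappa>: "0 < \<kappa>" by (simp add: \<kappa>_def)
  have "(\<Sum>j. ennreal ((\<kappa> * x j) powr t / 2)) \<le> (\<integral>\<^sup>+s\<in>{0<..<1}. ennreal ((?h s * s powr (1 / p)) powr t / s) \<partial>lborel)"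
  proof (rule dyadic_nn_integral(1)[OF dyadic_cover_0])
    fix j and s :: real assume "s \<in> {(1/2) ^ Suc j..<(1/2) ^ j}"
    note s = dyadic_point_bounds[OF this]
    have "\<kappa> * x j = ?h ((1/2) ^ j) * ((1/2) ^ j / 2) powr (1/p)"
      by (simp add: x_def \<kappa>_def powr_mult[symmetric])
    also have "\<dots> \<le> ?h s * s powr (1/p)"
      using s p decreasing_rearrangement_props(2,3)[OF g] by (intro mult_mono powr_mono2) auto
    finally have "(\<kappa> * x j) powr t \<le> (?h s * s powr (1/p)) powr t"
      using t \<kappa> x0[of j] by (intro powr_mono2) auto
    then have "(\<kappa> * x j) powr t * 2 ^ j \<le> (?h s * s powr (1/p)) powr t * (1 / s)"
      using s by (intro mult_mono) auto
    then show "ennreal ((\<kappa> * x j) powr t * 2 ^ j) \<le> ennreal ((?h s * s powr (1 / p)) powr t / s)"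
      by (intro ennreal_leI) simp
  qed
  also have "\<dots> < \<infinity>" using fin False by (simp add: lorentz_norm_def ennpowr_finite_iff t_def)
  finally have "summable (\<lambda>j. (\<kappa> * x j) powr t / 2)"
    by (intro summable_suminf_not_top) auto
  from summable_mult[OF this, of "2 / \<kappa> powr t"] have "summable (\<lambda>j. x j powr t)"
    using \<kappa> x0 by (simp add: powr_mult)
  then show ?thesis using False t by (simp add: lseq_def recip_def t_def x_def)
qed

text \<open>The bound \<open>\<phi> j\<close> is posed on whole intervals, the form in which a
  majorant supplies it. Assumption \<open>h1\<close> serves the case \<open>q = \<infinity>\<close>,
  where the supremum runs over all positive \<open>s\<close>.\<close>

lemma lseq_imp_lorentz_finite:
  assumes p: "0 < p" and q: "0 < q"
    and h: "\<And>j s. s \<in> {(1/2) ^ Suc j..<(1/2) ^ j} \<Longrightarrow> 0 \<le> decreasing_rearrangement g s \<and> decreasing_rearrangement g s \<le> \<phi> j"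
    and h1: "\<And>s. 1 \<le> s \<Longrightarrow> decreasing_rearrangement g s = 0"
    and l: "lseq (recip q) (\<lambda>j. \<phi> j * ((1/2) ^ j) powr (1/p))"
  shows "lorentz_norm p q g < \<infinity>"
proof -
  let ?h = "decreasing_rearrangement g"
  define x where "x j = \<phi> j * ((1/2) ^ j) powr (1/p)" for j
  have le: "0 \<le> ?h s * s powr (1/p)" "?h s * s powr (1/p) \<le> x j" if "s \<in> {(1/2) ^ Suc j..<(1/2) ^ j}" for s j
  proof -
    note s = dyadic_point_bounds[OF that]
    show "0 \<le> ?h s * s powr (1/p)" using h[OF that] by simp
    show "?h s * s powr (1/p) \<le> x j"
      unfolding x_def using h[OF that] s p by (intro mult_mono powr_mono2) auto
  qed
  show ?thesis
  proof (cases "q = \<infinity>")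
    case True
    then obtain C where C: "\<And>j. x j \<le> C" using l by (auto simp: lseq_def recip_def x_def)
    have "(SUP s\<in>{0<..}. ennreal (?h s * s powr (1 / p))) \<le> ennreal C"
    proof (rule SUP_least)
      fix s :: real assume "s \<in> {0<..}"
      show "ennreal (?h s * s powr (1 / p)) \<le> ennreal C"
      proof (cases "s < 1")
        case True
        then obtain j where "s \<in> {(1/2) ^ Suc j..<(1/2) ^ j}" using dyadic_level[of s] \<open>s \<in> {0<..}\<close> by auto
        then show ?thesis using le(2) C by (intro ennreal_leI) (meson order_trans)
      qed (simp add: h1)
    qed
    also have "\<dots> < \<infinity>" by simp
    finally show ?thesis using True by (simp add: lorentz_norm_def)
  next
    case False
    define t where "t = enn2real q"
    have t: "0 < t" using enn2real_pos[OF q False] by (simp add: t_def)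
    have x0: "0 \<le> x j" for j
      using le[of "(1/2) ^ Suc j" j] by (simp add: order_trans)
    have "(\<integral>\<^sup>+s\<in>{0<..<1}. ennreal ((?h s * s powr (1 / p)) powr t / s) \<partial>lborel) \<le> (\<Sum>j. ennreal (2 * x j powr t / 2))"
    proof (rule dyadic_nn_integral(2)[OF dyadic_cover_0])
      fix j and s :: real assume sj: "s \<in> {(1/2) ^ Suc j..<(1/2) ^ j}"
      note s = dyadic_point_bounds[OF sj]
      have "(?h s * s powr (1/p)) powr t * (1 / s) \<le> x j powr t * (2 * 2 ^ j)"
        using t s le[OF sj] by (intro mult_mono powr_mono2) auto
      then show "ennreal ((?h s * s powr (1 / p)) powr t / s) \<le> ennreal (2 * x j powr t * 2 ^ j)"
        by (intro ennreal_leI) (simp add: mult_ac)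
    qed
    also have "\<dots> < \<infinity>"
    proof -
      have "lseq (1 / t) x" using l False by (simp add: recip_def t_def x_def[abs_def])
      then show ?thesis using lseq_iff_ennreal[of t x, OF t x0] by simp
    qed
    finally show ?thesis using False by (simp add: lorentz_norm_def ennpowr_finite_iff t_def)
  qed
qed

text \<open>The means increase with the radius, so on each dyadic interval they lie between their
  values at its endpoints. The resulting upper and lower sequences differ by a shift of the index
  and a constant, harmless for \<open>lseq\<close>.\<close>

lemma mixed_norm_finite_iff:
  assumes s: "0 < s" and mono: "\<And>r r'. 0 \<le> r \<Longrightarrow> r \<le> r' \<Longrightarrow> r' < 1 \<Longrightarrow> integral_mean 2 r F \<le> integral_mean 2 r' F"
  shows "mixed_norm 2 s 1 F < \<infinity> \<longleftrightarrow> lseq (recip s) (\<lambda>j. (1/2) ^ j * integral_mean 2 (1 - (1/2) ^ Suc j) F)"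
proof -
  let ?M = "\<lambda>r. integral_mean 2 r F"
  define x where "x j = (1/2) ^ j * ?M (1 - (1/2) ^ Suc j)" for j
  define z where "z j = (1/2) ^ j / 2 * ?M (1 - (1/2) ^ j)" for j
  have M0: "0 \<le> ?M r" for r by (simp add: integral_mean_def)
  have x0: "0 \<le> x j" and z0: "0 \<le> z j" for j by (simp_all add: x_def z_def M0)
  have pw: "0 < (1/2::real) ^ j" "(1/2::real) ^ j \<le> 1" "(1/2::real) ^ Suc j < 1" for j
    using power_le_one[of "1/2::real" j] by simp_all
  have up: "?M r * (1 - r) \<le> x j" and lo: "z j \<le> ?M r * (1 - r)"
    and inv: "2 ^ j \<le> 1 / (1 - r)" "1 / (1 - r) \<le> 2 * 2 ^ j" and r01: "0 < r" "r < 1"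
    if r: "r \<in> {1 - (1/2) ^ j<..1 - (1/2) ^ Suc j}" for r j
  proof -
    have "1 - r \<in> {(1/2) ^ Suc j..<(1/2) ^ j}" using r by auto
    note b = dyadic_point_bounds[OF this]
    show "2 ^ j \<le> 1 / (1 - r)" "1 / (1 - r) \<le> 2 * 2 ^ j" by (fact b)+
    have c: "0 \<le> 1 - (1/2::real) ^ j" "1 - (1/2::real) ^ j < r" "r \<le> 1 - (1/2::real) ^ Suc j" using pw[of j] r by simp_all
    have c': "1 - (1/2::real) ^ Suc j < 1" using pw(1)[of "Suc j"] by linarith
    have r: "0 < r" "r < 1" using c c' by linarith+
    have m: "?M r \<le> ?M (1 - (1/2) ^ Suc j)" "?M (1 - (1/2) ^ j) \<le> ?M r"
      using c c' r by (auto intro!: mono simp del: power_Suc)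
    show "0 < r" "r < 1" by (fact r)+
    show "?M r * (1 - r) \<le> x j"
      using mult_mono[OF m(1) b(3) M0] b(1) by (simp add: x_def mult.commute)
    show "z j \<le> ?M r * (1 - r)"
      using mult_mono[OF m(2) b(2) M0] by (simp add: z_def mult.commute M0)
  qed
  \<comment> \<open>The right endpoint of one interval is the left endpoint of the next; of the
    factor 4, one half sits in the definition of \<open>z\<close> and the other comes from the
    shift.\<close>
  have zx: "lseq (recip s) x" if "lseq (recip s) z"
  proof -
    have "lseq (recip s) (\<lambda>j. 4 * z (Suc j))"
      by (intro lseq_cmult lseq_Suc that z0) simp
    also have "(\<lambda>j. 4 * z (Suc j)) = x" by (simp add: fun_eq_iff z_def x_def)
    finally show ?thesis .
  qed
  have "mixed_norm 2 s 1 F < \<infinity> \<longleftrightarrow> lseq (recip s) x"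
  proof (cases "s = \<infinity>")
    case True
    let ?S = "SUP r\<in>{0<..<1}. ennreal (?M r * (1 - r) powr 1)"
    have eq: "mixed_norm 2 s 1 F = ?S" using True by (simp add: mixed_norm_def)
    show ?thesis
    proof
      assume "mixed_norm 2 s 1 F < \<infinity>"
      then have S: "?S < \<infinity>" using eq by simp
      have "x j \<le> 2 * enn2real ?S" for j
      proof -
        have r: "1 - (1/2::real) ^ Suc j \<in> {0<..<1}" using pw(1,3) by (simp del: power_Suc)
        have "ennreal (?M (1 - (1/2) ^ Suc j) * (1 - (1 - (1/2) ^ Suc j)) powr 1) \<le> ?S" by (rule SUP_upper[OF r])
        then have "enn2real (ennreal (?M (1 - (1/2) ^ Suc j) * (1 - (1 - (1/2) ^ Suc j)) powr 1)) \<le> enn2real ?S"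
          using S by (intro enn2real_mono) auto
        then show ?thesis using M0[of "1 - (1/2) ^ Suc j"] pw(1)[of "Suc j"] by (simp add: x_def mult.commute)
      qed
      then show "lseq (recip s) x" using True by (auto simp: lseq_def recip_def)
    next
      assume "lseq (recip s) x"
      then obtain C where C: "\<And>j. x j \<le> C" using True by (auto simp: lseq_def recip_def)
      have "?S \<le> ennreal C"
      proof (rule SUP_least)
        fix r :: real assume r: "r \<in> {0<..<1}"
        then obtain j where j: "r \<in> {1 - (1/2) ^ j<..1 - (1/2) ^ Suc j}" using dyadic_cover_1 unfolding dyadic_cover_def by blast
        have "?M r * (1 - r) \<le> C" using up[OF j] C[of j] by linarith
        then show "ennreal (?M r * (1 - r) powr 1) \<le> ennreal C" using r by (intro ennreal_leI) simp
      qed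
      then show "mixed_norm 2 s 1 F < \<infinity>" unfolding eq by (rule le_less_trans) simp
    qed
  next
    case False
    define t where "t = enn2real s"
    have t: "0 < t" using enn2real_pos[OF s False] by (simp add: t_def)
    have rs: "recip s = 1 / t" using False by (simp add: recip_def t_def)
    let ?I = "\<integral>\<^sup>+r\<in>{0<..<1}. ennreal (?M r powr t * (1 - r) powr (t * 1 - 1)) \<partial>lborel"
    have eq: "mixed_norm 2 s 1 F < \<infinity> \<longleftrightarrow> ?I < \<infinity>" using False by (simp add: mixed_norm_def ennpowr_finite_iff t_def)
    have int: "?M r powr t * (1 - r) powr (t * 1 - 1) = (?M r * (1 - r)) powr t * (1 / (1 - r))" if "r < 1" for r
      using that M0[of r] by (simp add: powr_mult powr_diff)
    show ?thesis unfolding eq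
    proof
      assume I: "?I < \<infinity>"
      have "(\<Sum>j. ennreal (z j powr t / 2)) \<le> ?I"
      proof (rule dyadic_nn_integral(1)[OF dyadic_cover_1])
        fix j and r :: real assume r: "r \<in> {1 - (1/2) ^ j<..1 - (1/2) ^ Suc j}"
        have "z j powr t \<le> (?M r * (1 - r)) powr t" using t z0 lo[OF r] by (intro powr_mono2) auto
        then have "z j powr t * 2 ^ j \<le> (?M r * (1 - r)) powr t * (1 / (1 - r))"
          using inv[OF r] by (intro mult_mono) auto
        then show "ennreal (z j powr t * 2 ^ j) \<le> ennreal (?M r powr t * (1 - r) powr (t * 1 - 1))"
          unfolding int[OF r01(2)[OF r]] by (rule ennreal_leI)
      qed
      also note I
      finally have "summable (\<lambda>j. z j powr t / 2)" by (intro summable_suminf_not_top) auto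
      from summable_mult[OF this, of 2] have "lseq (recip s) z" using t by (simp add: rs lseq_def)
      then show "lseq (recip s) x" by (rule zx)
    next
      assume l: "lseq (recip s) x"
      have "?I \<le> (\<Sum>j. ennreal (2 * x j powr t / 2))"
      proof (rule dyadic_nn_integral(2)[OF dyadic_cover_1])
        fix j and r :: real assume r: "r \<in> {1 - (1/2) ^ j<..1 - (1/2) ^ Suc j}"
        have "(?M r * (1 - r)) powr t \<le> x j powr t" using t M0[of r] r01[OF r] up[OF r] by (intro powr_mono2) auto
        then have "(?M r * (1 - r)) powr t * (1 / (1 - r)) \<le> x j powr t * (2 * 2 ^ j)"
          using inv[OF r] r01[OF r] by (intro mult_mono) auto
        then show "ennreal (?M r powr t * (1 - r) powr (t * 1 - 1)) \<le> ennreal (2 * x j powr t * 2 ^ j)"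
          unfolding int[OF r01(2)[OF r]] by (intro ennreal_leI) (simp add: mult_ac)
      qed
      also have "\<dots> < \<infinity>" using lseq_iff_ennreal[of t x, OF t x0] l by (simp add: rs)
      finally show "?I < \<infinity>" .
    qed
  qed
  then show ?thesis by (simp only: x_def[abs_def])
qed

section \<open>Dyadic blocks of series and the growth of Gamma quotients\<close>

lemma sum_dyadic_blocks:
  fixes a :: "nat \<Rightarrow> real"
  shows "(\<Sum>n<2 ^ K. a n) = a 0 + (\<Sum>k<K. \<Sum>n\<in>{2 ^ k..<2 ^ Suc k}. a n)"
proof (induction K)
  case (Suc K)
  have "(\<Sum>n<2 ^ Suc K. a n) = (\<Sum>n<2 ^ K. a n) + (\<Sum>n\<in>{2 ^ K..<2 ^ Suc K}. a n)"
    using sum.atLeastLessThan_concat[of 0 "2 ^ K" "2 ^ Suc K" a] by (simp add: lessThan_atLeast0)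
  then show ?case using Suc by simp
qed simp

lemma summable_dyadic_blocks:
  fixes a :: "nat \<Rightarrow> real"
  assumes a: "\<And>n. 0 \<le> a n"
  shows "summable a \<Longrightarrow> summable (\<lambda>k. \<Sum>n\<in>{2 ^ k..<2 ^ Suc k}. a n)"
    and "summable (\<lambda>k. \<Sum>n\<in>{2 ^ k..<2 ^ Suc k}. a n) \<Longrightarrow> summable a"
    and "summable (\<lambda>k. \<Sum>n\<in>{2 ^ k..<2 ^ Suc k}. a n) \<Longrightarrow> suminf a \<le> a 0 + (\<Sum>k. \<Sum>n\<in>{2 ^ k..<2 ^ Suc k}. a n)"
proof -
  let ?b = "\<lambda>k. \<Sum>n\<in>{2 ^ k..<2 ^ Suc k}. a n"
  have b: "0 \<le> ?b k" for k by (intro sum_nonneg a)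
  show "summable ?b" if "summable a"
  proof (rule summableI_nonneg_bounded[OF b])
    fix K
    have "(\<Sum>k<K. ?b k) \<le> (\<Sum>n<2 ^ K. a n)" using a[of 0] by (simp only: sum_dyadic_blocks)
    also have "\<dots> \<le> suminf a" by (intro sum_le_suminf that a) auto
    finally show "(\<Sum>k<K. ?b k) \<le> suminf a" .
  qed
  have bd: "(\<Sum>n<N. a n) \<le> a 0 + suminf ?b" if "summable ?b" for N
  proof -
    have "(\<Sum>n<N. a n) \<le> (\<Sum>n<2 ^ N. a n)"
      using less_exp[of N] a by (intro sum_mono2) auto
    also have "\<dots> \<le> a 0 + suminf ?b"
      unfolding sum_dyadic_blocks using that b by (intro add_left_mono sum_le_suminf) auto
    finally show ?thesis .
  qed
  show sa: "summable a" if "summable ?b" by (rule summableI_nonneg_bounded[OF a bd[OF that]])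
  show "suminf a \<le> a 0 + suminf ?b" if "summable ?b"
    by (rule suminf_le_const[OF sa[OF that] bd[OF that]])
qed

text \<open>For \<open>n \<ge> 1\<close> the product of \<open>Gamma_series \<beta> n\<close> and
  the quotient is exactly \<open>Gamma \<beta> * real n powr \<beta>\<close>. By the limit formula
  of Gauss the first factor tends to \<open>Gamma \<beta>\<close>, which is positive, so it and its
  inverse are bounded.\<close>

lemma Gamma_ratio_bounds:
  fixes \<beta> :: real
  assumes \<beta>: "0 < \<beta>"
  shows "\<exists>c C. 0 < c \<and> 0 < C \<and> (\<forall>n\<ge>1. c * real n powr \<beta> \<le> Gamma (real n + \<beta> + 1) / fact n \<and>
     Gamma (real n + \<beta> + 1) / fact n \<le> C * real n powr \<beta>)"
proof -
  define u where "u n = Gamma_series \<beta> n" for n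
  define g where "g n = Gamma (real n + \<beta> + 1) / fact n" for n
  have Gb: "0 < Gamma \<beta>" using \<beta> by (rule Gamma_real_pos)
  have g0: "0 < g n" for n unfolding g_def using \<beta> by (intro divide_pos_pos Gamma_real_pos) auto
  have ug: "u n * g n = Gamma \<beta> * real n powr \<beta>" if "1 \<le> n" for n
  proof -
    have "\<beta> \<notin> \<int>\<^sub>\<le>\<^sub>0" using \<beta> by (auto elim!: nonpos_Ints_cases)
    then have "pochhammer \<beta> (n + 1) = Gamma (real n + \<beta> + 1) / Gamma \<beta>"
      by (simp add: pochhammer_Gamma add_ac)
    moreover have "0 < Gamma (real n + \<beta> + 1)" using \<beta> by (intro Gamma_real_pos) auto
    ultimately show ?thesis using that by (simp add: u_def g_def Gamma_series_def powr_def)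
  qed
  have u0: "0 < u n" if "1 \<le> n" for n
  proof -
    have "0 < u n * g n" unfolding ug[OF that] using Gb that by simp
    then show ?thesis using g0[of n] by (simp add: zero_less_mult_iff)
  qed
  have lim: "u \<longlonglongrightarrow> Gamma \<beta>" unfolding u_def[abs_def] by (rule Gamma_series_LIMSEQ)
  then have "Bseq u" using convergentI convergent_imp_Bseq by blast
  then obtain K where K: "0 < K" "\<And>n. norm (u n) \<le> K" by (auto simp: Bseq_def)
  have "(\<lambda>n. inverse (u n)) \<longlonglongrightarrow> inverse (Gamma \<beta>)" using lim Gb by (intro tendsto_intros) auto
  then have "Bseq (\<lambda>n. inverse (u n))" using convergentI convergent_imp_Bseq by blast
  then obtain L where L: "0 < L" "\<And>n. norm (inverse (u n)) \<le> L" by (auto simp: Bseq_def)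
  have "Gamma \<beta> / K * real n powr \<beta> \<le> g n \<and> g n \<le> Gamma \<beta> * L * real n powr \<beta>" if "1 \<le> n" for n
  proof -
    have g: "g n = Gamma \<beta> * real n powr \<beta> * inverse (u n)" using ug[OF that] u0[OF that] by (simp add: field_simps)
    have "inverse K \<le> inverse (u n)" using K(2)[of n] u0[OF that] by (intro le_imp_inverse_le) auto
    moreover have "inverse (u n) \<le> L" using L(2)[of n] abs_ge_self[of "inverse (u n)"] unfolding real_norm_def by linarith
    ultimately have "Gamma \<beta> * real n powr \<beta> * inverse K \<le> g n" "g n \<le> Gamma \<beta> * real n powr \<beta> * L"
      unfolding g using Gb by (auto intro!: mult_left_mono)
    then show ?thesis by (simp add: divide_inverse mult_ac)
  qed
  then show ?thesis using Gb K L unfolding g_def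
    by (intro exI[of _ "Gamma \<beta> / K"] exI[of _ "Gamma \<beta> * L"]) auto
qed

section \<open>The mixed norm space in terms of coefficients\<close>

text \<open>The coefficient multiplier of \<open>frac_deriv\<close>. For
  \<open>\<beta> = real B - 1\<close> it is also \<open>Gamma (real B)\<close> times the
  \<open>n\<close>-th coefficient of \<open>1 / (1 - w) ^ B\<close>, so one set of bounds serves the
  mixed norm and the test functions.\<close>

definition gamma_ratio :: "real \<Rightarrow> nat \<Rightarrow> real" where
  "gamma_ratio \<beta> n = Gamma (real n + \<beta> + 1) / fact n"

lemma gamma_ratio_pos: "0 < \<beta> \<Longrightarrow> 0 < gamma_ratio \<beta> n"
  unfolding gamma_ratio_def by (intro divide_pos_pos Gamma_real_pos) auto

lemma gamma_ratio_Suc: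
  assumes "0 < \<beta>"
  shows "gamma_ratio \<beta> (Suc n) = (1 + \<beta> / real (Suc n)) * gamma_ratio \<beta> n"
proof -
  have "real n + \<beta> + 1 \<notin> \<int>\<^sub>\<le>\<^sub>0" using assms by (auto elim!: nonpos_Ints_cases)
  then have "Gamma (real n + \<beta> + 1 + 1) = (real n + \<beta> + 1) * Gamma (real n + \<beta> + 1)" by (rule Gamma_plus1)
  then show ?thesis by (simp add: gamma_ratio_def add_ac divide_simps)
qed

lemma summable_gamma_ratio:
  assumes \<beta>: "0 < \<beta>" and x: "0 \<le> x" "x < 1"
  shows "summable (\<lambda>n. gamma_ratio \<beta> n * x ^ n)"
proof -
  obtain N :: nat where N: "2 * \<beta> / (1 - x) \<le> real N" using real_arch_simple by blast
  show ?thesis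
  proof (rule summable_ratio_test[of "(1 + x) / 2" N])
    fix n assume n: "N \<le> n"
    have "2 * \<beta> / (1 - x) \<le> real (Suc n)" using N n by linarith
    then have "\<beta> / real (Suc n) \<le> (1 - x) / 2" using x by (simp add: field_simps)
    then have "x * (\<beta> / real (Suc n)) \<le> x * ((1 - x) / 2)" using x by (intro mult_left_mono)
    then have "x * (1 + \<beta> / real (Suc n)) \<le> x + x * ((1 - x) / 2)"
      unfolding distrib_left by linarith
    also have "\<dots> \<le> x + (1 - x) / 2" using x by (intro add_left_mono mult_left_le_one_le) auto
    finally have le: "x * (1 + \<beta> / real (Suc n)) \<le> (1 + x) / 2" by (simp add: field_simps)
    have "norm (gamma_ratio \<beta> (Suc n) * x ^ Suc n) = (x * (1 + \<beta> / real (Suc n))) * (gamma_ratio \<beta> n * x ^ n)"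
      using \<beta> x gamma_ratio_pos[OF \<beta>, of n] by (simp add: gamma_ratio_Suc abs_mult mult_ac del: of_nat_Suc)
    also have "\<dots> \<le> (1 + x) / 2 * (gamma_ratio \<beta> n * x ^ n)"
      using x gamma_ratio_pos[OF \<beta>, of n] by (intro mult_right_mono le) auto
    also have "\<dots> = (1 + x) / 2 * norm (gamma_ratio \<beta> n * x ^ n)"
      using x gamma_ratio_pos[OF \<beta>, of n] by (simp add: abs_mult)
    finally show "norm (gamma_ratio \<beta> (Suc n) * x ^ Suc n) \<le> (1 + x) / 2 * norm (gamma_ratio \<beta> n * x ^ n)" .
  qed (use x in auto)
qed

lemma frac_deriv_sums:
  assumes f: "f holomorphic_on ball 0 1" and \<beta>: "0 < \<beta>" and z: "norm z < 1"
  shows "(\<lambda>n. of_real (gamma_ratio \<beta> n) * taylor_coeff f n * z ^ n) sums frac_deriv \<beta> f z"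
proof -
  define r where "r = norm z"
  define \<rho> where "\<rho> = (1 + r) / 2"
  have r: "0 \<le> r" "r < \<rho>" "\<rho> < 1" "0 < \<rho>" using z norm_ge_zero[of z] by (auto simp: r_def \<rho>_def simp del: norm_ge_zero)
  have "summable (\<lambda>n. norm (taylor_coeff f n * of_real \<rho> ^ n))"
    by (rule disk_holomorphic_abs_summable[OF f]) (use r in auto)
  then have "Bseq (\<lambda>n. norm (taylor_coeff f n * of_real \<rho> ^ n))"
    using summable_LIMSEQ_zero convergentI convergent_imp_Bseq by blast
  then obtain K where K: "0 < K" "\<And>n. norm (norm (taylor_coeff f n * of_real \<rho> ^ n)) \<le> K" by (auto simp: Bseq_def)
  have sg: "summable (\<lambda>n. K * (gamma_ratio \<beta> n * (r / \<rho>) ^ n))"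
    using r by (intro summable_mult summable_gamma_ratio \<beta>) auto
  have "norm (of_real (gamma_ratio \<beta> n) * taylor_coeff f n * z ^ n) \<le> K * (gamma_ratio \<beta> n * (r / \<rho>) ^ n)" for n
  proof -
    have "norm (of_real (gamma_ratio \<beta> n) * taylor_coeff f n * z ^ n) = gamma_ratio \<beta> n * (r / \<rho>) ^ n * (norm (taylor_coeff f n) * \<rho> ^ n)"
      using gamma_ratio_pos[OF \<beta>, of n] r by (simp add: norm_mult norm_power r_def[symmetric] power_divide)
    also have "\<dots> \<le> gamma_ratio \<beta> n * (r / \<rho>) ^ n * K"
      using K(2)[of n] r gamma_ratio_pos[OF \<beta>, of n] by (intro mult_left_mono) (auto simp: norm_mult norm_power)
    finally show ?thesis by (simp add: mult_ac)
  qed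
  then have "summable (\<lambda>n. of_real (gamma_ratio \<beta> n) * taylor_coeff f n * z ^ n)"
    by (rule summable_comparison_test'[OF sg, of 0])
  then show ?thesis unfolding frac_deriv_def gamma_ratio_def[symmetric] by (rule summable_sums)
qed

lemma frac_deriv_holomorphic:
  assumes f: "f holomorphic_on ball 0 1" and \<beta>: "0 < \<beta>"
  shows "frac_deriv \<beta> f holomorphic_on ball 0 1"
    and "taylor_coeff (frac_deriv \<beta> f) = (\<lambda>n. of_real (gamma_ratio \<beta> n) * taylor_coeff f n)"
  using power_series_on_disk[OF frac_deriv_sums[OF f \<beta>]] by auto

lemma integral_mean_2:
  assumes f: "f holomorphic_on ball 0 1" and r: "0 \<le> r" "r < 1"
  shows "(\<lambda>n. (norm (taylor_coeff f n))\<^sup>2 * r ^ (2 * n)) sums (integral_mean 2 r f)\<^sup>2"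
proof -
  let ?I = "\<integral>\<zeta>. (norm (f (of_real r * \<zeta>)))\<^sup>2 \<partial>circle_measure"
  have "0 \<le> ?I" by (intro Bochner_Integration.integral_nonneg) auto
  then have "(integral_mean 2 r f)\<^sup>2 = ?I"
    by (simp add: integral_mean_def powr_half_sqrt)
  then show ?thesis using parseval_disk[OF f r] by simp
qed

lemma integral_mean_nonneg: "0 \<le> integral_mean p r f"
  by (simp add: integral_mean_def)

lemma integral_mean_2_mono:
  assumes f: "f holomorphic_on ball 0 1" and r: "0 \<le> r" "r \<le> r'" "r' < 1"
  shows "integral_mean 2 r f \<le> integral_mean 2 r' f"
proof (rule power2_le_imp_le[OF _ integral_mean_nonneg])
  show "(integral_mean 2 r f)\<^sup>2 \<le> (integral_mean 2 r' f)\<^sup>2"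
    by (rule sums_le[OF _ integral_mean_2[OF f] integral_mean_2[OF f]])
       (use r in \<open>auto intro!: mult_left_mono power_mono\<close>)
qed

text \<open>For \<open>\<beta> = 1 / p\<close> this is the sequence \<open>v\<close> of the
  overview. The weight combines the square of \<open>(2 ^ k) powr \<beta>\<close>, due to the
  fractional derivative, with \<open>(1/4) ^ k\<close>, due to the radial weight; see
  \<open>dyadic_weight\<close>.\<close>

definition block_weight :: "real \<Rightarrow> (nat \<Rightarrow> complex) \<Rightarrow> nat \<Rightarrow> real" where
  "block_weight \<beta> l k = ((2 ^ k) powr (\<beta> - 1))\<^sup>2 * (\<Sum>n\<in>{2 ^ k..<2 ^ Suc k}. (norm (l n))\<^sup>2)"

lemma block_weight_nonneg: "0 \<le> block_weight \<beta> l k"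
  unfolding block_weight_def by (intro mult_nonneg_nonneg sum_nonneg) auto

lemma lseq_square_iff:
  assumes \<sigma>: "0 \<le> \<sigma>" and y: "\<And>k. 0 \<le> y k"
  shows "lseq \<sigma> y \<longleftrightarrow> lseq (2 * \<sigma>) (\<lambda>k. (y k)\<^sup>2)"
proof
  assume "lseq \<sigma> y"
  from lseq_power[OF this \<sigma> _ y, of 2] show "lseq (2 * \<sigma>) (\<lambda>k. (y k)\<^sup>2)" by (simp add: mult.commute)
next
  assume "lseq (2 * \<sigma>) (\<lambda>k. (y k)\<^sup>2)"
  from lseq_powr[OF this, of "1/2"] show "lseq \<sigma> y" using \<sigma> y by (simp add: powr_half_sqrt)
qed

text \<open>The cube is chosen against the growth \<open>4 ^ i\<close> in
  \<open>dyadic_kernel_le\<close>, where it leaves \<open>(1/2) ^ i\<close>.\<close>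

lemma exp_minus_le_cube:
  fixes x :: real
  assumes "0 < x"
  shows "exp (- x) \<le> 27 / x ^ 3"
proof -
  have "x / 3 \<le> exp (x / 3)" using exp_ge_add_one_self[of "x / 3"] by linarith
  then have "(x / 3) ^ 3 \<le> exp (x / 3) ^ 3" using assms by (intro power_mono) auto
  also have "exp (x / 3) ^ 3 = exp x" by (simp add: exp_of_nat_mult[symmetric])
  finally have "x ^ 3 / 27 \<le> exp x" by (simp add: power_divide)
  then show ?thesis using assms by (simp add: exp_minus field_simps)
qed

text \<open>This is the weight of block \<open>k\<close> in the squared mean at radius index
  \<open>j\<close>. For \<open>k \<le> j\<close> the quotient of the powers of 4 decays; for
  \<open>k > j\<close> the power of the radius is at most \<open>exp (- (2 ^ (k - j)))\<close>,
  which beats \<open>4 ^ (k - j)\<close>.\<close>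

lemma dyadic_kernel_le:
  "(1/4) ^ j * 4 ^ k * (1 - (1/2) ^ Suc j) ^ (2 ^ Suc k) \<le> 27 * (1/2::real) ^ index_dist j k"
proof (cases "k \<le> j")
  case True
  define i where "i = j - k"
  have j: "j = i + k" using True by (simp add: i_def)
  have "(1/4) ^ j * 4 ^ k * (1 - (1/2) ^ Suc j) ^ (2 ^ Suc k) \<le> (1/4::real) ^ j * 4 ^ k * 1"
    by (intro mult_left_mono power_le_one) (auto simp: power_le_one simp del: power_Suc)
  also have "\<dots> = (1/4) ^ i" by (simp add: j power_add power_mult_distrib[symmetric])
  also have "\<dots> \<le> (1/2) ^ i" by (intro power_mono) auto
  also have "\<dots> \<le> 27 * (1/2) ^ index_dist j k" by (simp add: index_dist_def j)
  finally show ?thesis .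
next
  case False
  define i where "i = k - j"
  have k: "k = i + j" using False by (simp add: i_def)
  have "(1 - (1/2) ^ Suc j) ^ (2 ^ Suc k) \<le> exp (- ((1/2::real) ^ Suc j)) ^ (2 ^ Suc k)"
    using exp_ge_add_one_self[of "- ((1/2::real) ^ Suc j)"]
    by (intro power_mono) (auto simp: power_le_one simp del: power_Suc)
  also have "\<dots> = exp (- (2 ^ i))"
    by (simp add: exp_of_nat_mult[symmetric] k power_add power_one_over)
  also have "\<dots> \<le> 27 / (2 ^ i) ^ 3" by (rule exp_minus_le_cube) simp
  also have "\<dots> = 27 * (1/8) ^ i" by (simp add: power_mult[symmetric] power_one_over mult.commute[of i] power_mult)
  finally have "(1/4) ^ j * 4 ^ k * (1 - (1/2) ^ Suc j) ^ (2 ^ Suc k) \<le> (1/4::real) ^ j * 4 ^ k * (27 * (1/8) ^ i)"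
    by (intro mult_left_mono) auto
  also have "\<dots> = 27 * (4 ^ i * (1/8) ^ i)" by (simp add: k power_add power_one_over)
  also have "4 ^ i * (1/8) ^ i = (1/2::real) ^ i" by (simp add: power_mult_distrib[symmetric])
  finally show ?thesis by (simp add: index_dist_def k)
qed

lemma dyadic_weight:
  fixes \<beta> :: real
  shows "(1/4) ^ k * ((2 ^ k) powr \<beta>)\<^sup>2 = ((2 ^ k) powr (\<beta> - 1))\<^sup>2"
proof -
  have "((2 ^ k) powr (\<beta> - 1))\<^sup>2 = ((2 ^ k) powr \<beta>)\<^sup>2 / (2 ^ k * 2 ^ k)"
    by (simp add: powr_diff power_divide power2_eq_square)
  also have "(2::real) ^ k * 2 ^ k = 4 ^ k" by (simp add: power_mult_distrib[symmetric])
  finally show ?thesis by (simp add: power_one_over)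
qed

context
  fixes f :: "complex \<Rightarrow> complex" and \<beta> :: real
  assumes f: "f holomorphic_on ball 0 1" and \<beta>: "1 \<le> \<beta>"
begin

private definition y :: "nat \<Rightarrow> real" where
  "y j = (1/2) ^ j * integral_mean 2 (1 - (1/2) ^ Suc j) (frac_deriv \<beta> f)"

private definition a :: "nat \<Rightarrow> nat \<Rightarrow> real" where
  "a j n = (gamma_ratio \<beta> n * norm (taylor_coeff f n))\<^sup>2 * (1 - (1/2) ^ Suc j) ^ (2 * n)"

private lemma y_square: "(\<lambda>n. (1/4) ^ j * a j n) sums (y j)\<^sup>2"
proof -
  have r: "0 \<le> 1 - (1/2::real) ^ Suc j" "1 - (1/2::real) ^ Suc j < 1" by (auto simp: power_le_one simp del: power_Suc)
  have b: "0 < \<beta>" using \<beta> by simp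
  have "(\<lambda>n. (1/4) ^ j * ((norm (taylor_coeff (frac_deriv \<beta> f) n))\<^sup>2 * (1 - (1/2) ^ Suc j) ^ (2 * n))) sums
     ((1/4) ^ j * (integral_mean 2 (1 - (1/2) ^ Suc j) (frac_deriv \<beta> f))\<^sup>2)"
    by (intro sums_mult integral_mean_2 frac_deriv_holomorphic f b r)
  moreover have "(1/4::real) ^ j = ((1/2) ^ j)\<^sup>2" by (simp add: power2_eq_square power_mult_distrib[symmetric])
  moreover have "norm (taylor_coeff (frac_deriv \<beta> f) n) = gamma_ratio \<beta> n * norm (taylor_coeff f n)" for n
    using gamma_ratio_pos[OF b, of n] by (simp add: frac_deriv_holomorphic(2)[OF f b] norm_mult)
  ultimately show ?thesis by (simp add: a_def y_def power_mult_distrib del: power_Suc)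
qed

private lemma a_nonneg: "0 \<le> a j n"
proof -
  have "0 \<le> 1 - (1/2::real) ^ Suc j" by (simp add: power_le_one del: power_Suc)
  then show ?thesis unfolding a_def by (intro mult_nonneg_nonneg zero_le_power2 zero_le_power[of "1 - (1/2) ^ Suc j"])
qed

text \<open>Only block \<open>k\<close> is kept in the Parseval series at radius index
  \<open>k\<close>; there the powers of the radius stay above 1/16 and \<open>gamma_ratio\<close> is
  at least of order \<open>(2 ^ k) powr \<beta>\<close>.\<close>

private lemma lower: "\<exists>C\<ge>0. \<forall>k. block_weight \<beta> (taylor_coeff f) k \<le> C * (y k)\<^sup>2"
proof -
  obtain c where c: "0 < c" "\<And>n. 1 \<le> n \<Longrightarrow> c * real n powr \<beta> \<le> gamma_ratio \<beta> n"
    using Gamma_ratio_bounds[of \<beta>] \<beta> unfolding gamma_ratio_def[symmetric] by auto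
  have "block_weight \<beta> (taylor_coeff f) k \<le> 16 / c\<^sup>2 * (y k)\<^sup>2" for k
  proof -
    have "(\<Sum>n\<in>{2 ^ k..<2 ^ Suc k}. (c * (2 ^ k) powr \<beta> * norm (taylor_coeff f n))\<^sup>2 * (1/16)) \<le> (\<Sum>n\<in>{2 ^ k..<2 ^ Suc k}. a k n)"
    proof (rule sum_mono)
      fix n :: nat assume n: "n \<in> {2 ^ k..<2 ^ Suc k}"
      have n1: "1 \<le> n" using n one_le_power[of "2::nat" k] by (simp del: one_le_power)
      have "(2::real) ^ k \<le> real n" using n by (metis atLeastLessThan_iff of_nat_le_iff of_nat_numeral of_nat_power)
      then have "c * (2 ^ k) powr \<beta> \<le> c * real n powr \<beta>" using c \<beta> by (intro mult_left_mono powr_mono2) auto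
      also have "\<dots> \<le> gamma_ratio \<beta> n" by (rule c(2)[OF n1])
      finally have 1: "(c * (2 ^ k) powr \<beta> * norm (taylor_coeff f n))\<^sup>2 \<le> (gamma_ratio \<beta> n * norm (taylor_coeff f n))\<^sup>2"
        using c by (intro power_mono mult_right_mono) auto
      have "(1/4)\<^sup>2 \<le> ((1 - (1/2::real) ^ Suc k) ^ n)\<^sup>2"
        using n by (intro power_mono one_minus_half_power_ge) auto
      also have "((1 - (1/2::real) ^ Suc k) ^ n)\<^sup>2 = (1 - (1/2) ^ Suc k) ^ (2 * n)"
        by (simp only: power_mult[symmetric] mult.commute)
      finally have "1/16 \<le> (1 - (1/2::real) ^ Suc k) ^ (2 * n)"
        by (simp add: power2_eq_square del: power_Suc)
      with 1 show "(c * (2 ^ k) powr \<beta> * norm (taylor_coeff f n))\<^sup>2 * (1/16) \<le> a k n"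
        unfolding a_def by (intro mult_mono) auto
    qed
    also have "\<dots> \<le> suminf (a k)"
    proof (intro sum_le_suminf a_nonneg)
      show "summable (a k)" using sums_summable[OF y_square[of k]] by (simp add: summable_cmult_iff)
    qed auto
    also have "(1/4) ^ k * suminf (a k) = (y k)\<^sup>2"
    proof -
      have "summable (a k)" using sums_summable[OF y_square[of k]] by (simp add: summable_cmult_iff)
      from sums_unique2[OF sums_mult[OF summable_sums[OF this]] y_square[of k]] show ?thesis .
    qed
    then have "suminf (a k) = 4 ^ k * (y k)\<^sup>2" by (simp add: field_simps power_one_over)
    finally have "(c * (2 ^ k) powr \<beta>)\<^sup>2 * (1/16) * (\<Sum>n\<in>{2 ^ k..<2 ^ Suc k}. (norm (taylor_coeff f n))\<^sup>2) \<le> 4 ^ k * (y k)\<^sup>2"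
      by (simp add: sum_distrib_left sum_distrib_right power_mult_distrib mult_ac)
    then have "(1/4) ^ k * ((c * (2 ^ k) powr \<beta>)\<^sup>2 * (1/16) * (\<Sum>n\<in>{2 ^ k..<2 ^ Suc k}. (norm (taylor_coeff f n))\<^sup>2))
       \<le> (1/4) ^ k * (4 ^ k * (y k)\<^sup>2)" by (intro mult_left_mono) auto
    also have "(1/4) ^ k * (4 ^ k * (y k)\<^sup>2) = (y k)\<^sup>2" by (simp add: power_one_over)
    finally have "c\<^sup>2 / 16 * block_weight \<beta> (taylor_coeff f) k \<le> (y k)\<^sup>2"
      unfolding block_weight_def dyadic_weight[symmetric] by (simp add: power_mult_distrib mult_ac)
    then show ?thesis using c by (simp add: field_simps)
  qed
  then show ?thesis by (intro exI[of _ "16 / c\<^sup>2"]) auto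
qed

text \<open>By \<open>dyadic_kernel_le\<close> the squared means are dominated by a geometric
  convolution of the block weights. Index 0 lies in no block and yields the term with
  \<open>(1/4) ^ j\<close>.\<close>

private lemma upper:
  assumes conv: "\<And>j. summable (\<lambda>k. (1/2) ^ index_dist j k * block_weight \<beta> (taylor_coeff f) k)"
  shows "\<exists>C\<ge>0. \<exists>D\<ge>0. \<forall>j. (y j)\<^sup>2 \<le> C * (1/4) ^ j + D * (\<Sum>k. (1/2) ^ index_dist j k * block_weight \<beta> (taylor_coeff f) k)"
proof -
  obtain C where C: "0 < C" "\<And>n. 1 \<le> n \<Longrightarrow> gamma_ratio \<beta> n \<le> C * real n powr \<beta>"
    using Gamma_ratio_bounds[of \<beta>] \<beta> unfolding gamma_ratio_def[symmetric] by auto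
  define D where "D = 27 * (C * 2 powr \<beta>)\<^sup>2"
  have "(y j)\<^sup>2 \<le> a 0 0 * (1/4) ^ j + D * (\<Sum>k. (1/2) ^ index_dist j k * block_weight \<beta> (taylor_coeff f) k)" for j
  proof -
    let ?a = "\<lambda>n. (1/4) ^ j * a j n"
    have a0: "0 \<le> ?a n" for n by (simp add: a_nonneg)
    have sb: "summable (\<lambda>k. \<Sum>n\<in>{2 ^ k..<2 ^ Suc k}. ?a n)"
      by (rule summable_dyadic_blocks(1)[OF a0 sums_summable[OF y_square]])
    have blk: "(\<Sum>n\<in>{2 ^ k..<2 ^ Suc k}. ?a n) \<le> D * ((1/2) ^ index_dist j k * block_weight \<beta> (taylor_coeff f) k)" for k
    proof -
      define K where "K = (1/4) ^ j * (1 - (1/2::real) ^ Suc j) ^ (2 ^ Suc k)"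
      have "(\<Sum>n\<in>{2 ^ k..<2 ^ Suc k}. ?a n) \<le> (\<Sum>n\<in>{2 ^ k..<2 ^ Suc k}. (C * 2 powr \<beta> * (2 ^ k) powr \<beta>)\<^sup>2 * (norm (taylor_coeff f n))\<^sup>2 * K)"
      proof (rule sum_mono)
        fix n :: nat assume n: "n \<in> {2 ^ k..<2 ^ Suc k}"
        have n1: "1 \<le> n" using n one_le_power[of "2::nat" k] by (simp del: one_le_power)
        have "real n \<le> 2 * 2 ^ k" using n by (metis atLeastLessThan_iff less_imp_le of_nat_le_iff of_nat_numeral of_nat_power power_Suc)
        then have "real n powr \<beta> \<le> (2 * 2 ^ k) powr \<beta>" using \<beta> by (intro powr_mono2) auto
        also have "\<dots> = 2 powr \<beta> * (2 ^ k) powr \<beta>" by (rule powr_mult)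
        finally have "C * real n powr \<beta> \<le> C * (2 powr \<beta> * (2 ^ k) powr \<beta>)" using C by (intro mult_left_mono) auto
        then have "gamma_ratio \<beta> n \<le> C * 2 powr \<beta> * (2 ^ k) powr \<beta>" using C(2)[OF n1] by (simp add: mult.assoc)
        then have 1: "(gamma_ratio \<beta> n * norm (taylor_coeff f n))\<^sup>2 \<le> (C * 2 powr \<beta> * (2 ^ k) powr \<beta> * norm (taylor_coeff f n))\<^sup>2"
          using gamma_ratio_pos[of \<beta> n] \<beta> by (intro power_mono mult_right_mono) auto
        have 2: "(1 - (1/2::real) ^ Suc j) ^ (2 * n) \<le> (1 - (1/2) ^ Suc j) ^ (2 ^ Suc k)"
          using n power_le_one[of "1/2::real" j] by (intro power_decreasing) auto
        have "a j n \<le> (C * 2 powr \<beta> * (2 ^ k) powr \<beta> * norm (taylor_coeff f n))\<^sup>2 * (1 - (1/2) ^ Suc j) ^ (2 ^ Suc k)"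
        proof -
          have r: "0 \<le> 1 - (1/2::real) ^ Suc j" by (simp add: power_le_one del: power_Suc)
          show ?thesis unfolding a_def by (rule mult_mono[OF 1 2]) (simp_all only: zero_le_power2 zero_le_power[OF r])
        qed
        then have "?a n \<le> (1/4) ^ j * ((C * 2 powr \<beta> * (2 ^ k) powr \<beta> * norm (taylor_coeff f n))\<^sup>2 * (1 - (1/2) ^ Suc j) ^ (2 ^ Suc k))"
          by (intro mult_left_mono) auto
        then show "?a n \<le> (C * 2 powr \<beta> * (2 ^ k) powr \<beta>)\<^sup>2 * (norm (taylor_coeff f n))\<^sup>2 * K"
          by (simp add: K_def power_mult_distrib mult_ac del: power_Suc)
      qed
      also have "\<dots> = (C * 2 powr \<beta>)\<^sup>2 * (K * 4 ^ k) * ((1/4) ^ k * ((2 ^ k) powr \<beta>)\<^sup>2 * (\<Sum>n\<in>{2 ^ k..<2 ^ Suc k}. (norm (taylor_coeff f n))\<^sup>2))"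
        by (simp add: sum_distrib_left sum_distrib_right power_mult_distrib mult_ac power_one_over)
      also have "\<dots> = (C * 2 powr \<beta>)\<^sup>2 * (K * 4 ^ k) * block_weight \<beta> (taylor_coeff f) k"
        by (simp only: block_weight_def dyadic_weight)
      also have "\<dots> \<le> (C * 2 powr \<beta>)\<^sup>2 * (27 * (1/2) ^ index_dist j k) * block_weight \<beta> (taylor_coeff f) k"
        using dyadic_kernel_le[of j k] by (intro mult_right_mono mult_left_mono block_weight_nonneg) (auto simp: K_def mult_ac)
      finally show ?thesis by (simp add: D_def mult_ac)
    qed
    have "(y j)\<^sup>2 = suminf ?a" using y_square[of j] by (simp add: sums_iff)
    also have "\<dots> \<le> ?a 0 + (\<Sum>k. \<Sum>n\<in>{2 ^ k..<2 ^ Suc k}. ?a n)"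
      by (rule summable_dyadic_blocks(3)[OF a0 sb])
    also have "\<dots> \<le> ?a 0 + (\<Sum>k. D * ((1/2) ^ index_dist j k * block_weight \<beta> (taylor_coeff f) k))"
      by (intro add_left_mono suminf_le blk sb summable_mult conv)
    also have "\<dots> = a 0 0 * (1/4) ^ j + D * (\<Sum>k. (1/2) ^ index_dist j k * block_weight \<beta> (taylor_coeff f) k)"
      by (simp add: suminf_mult[OF conv] a_def)
    finally show ?thesis .
  qed
  moreover have "0 \<le> D" by (simp add: D_def)
  ultimately show ?thesis using a_nonneg by blast
qed

lemma frac_deriv_mixed_norm_iff:
  assumes s: "0 < s"
  shows "frac_deriv \<beta> f \<in> mixed_norm_space 2 s 1 \<longleftrightarrow> lseq (2 * recip s) (block_weight \<beta> (taylor_coeff f))"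
proof -
  have b: "0 < \<beta>" using \<beta> by simp
  note h = frac_deriv_holomorphic(1)[OF f b]
  have y0: "0 \<le> y j" for j by (simp add: y_def integral_mean_nonneg)
  have r0: "0 \<le> 2 * recip s" using recip_nonneg by simp
  have "frac_deriv \<beta> f \<in> mixed_norm_space 2 s 1 \<longleftrightarrow> mixed_norm 2 s 1 (frac_deriv \<beta> f) < \<infinity>"
    using h by (simp add: mixed_norm_space_def disk_holomorphic_def)
  also have "\<dots> \<longleftrightarrow> lseq (recip s) y"
    unfolding y_def[abs_def] by (rule mixed_norm_finite_iff[OF s integral_mean_2_mono[OF h]])
  also have "\<dots> \<longleftrightarrow> lseq (2 * recip s) (\<lambda>k. (y k)\<^sup>2)"
    by (rule lseq_square_iff[OF recip_nonneg y0])
  also have "\<dots> \<longleftrightarrow> lseq (2 * recip s) (block_weight \<beta> (taylor_coeff f))"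
  proof
    assume l: "lseq (2 * recip s) (\<lambda>k. (y k)\<^sup>2)"
    obtain C where C: "0 \<le> C" "\<forall>k. block_weight \<beta> (taylor_coeff f) k \<le> C * (y k)\<^sup>2" using lower by blast
    show "lseq (2 * recip s) (block_weight \<beta> (taylor_coeff f))"
      by (rule lseq_mono[OF lseq_cmult[OF l C(1)] r0 block_weight_nonneg]) (use C in auto)
  next
    assume l: "lseq (2 * recip s) (block_weight \<beta> (taylor_coeff f))"
    note conv = lseq_convolution[of "1/2", OF _ _ l r0 block_weight_nonneg]
    let ?w = "\<lambda>j. \<Sum>k. (1/2) ^ index_dist j k * block_weight \<beta> (taylor_coeff f) k"
    have w0: "0 \<le> ?w j" for j by (intro suminf_nonneg conv(1)) (auto simp: block_weight_nonneg)
    obtain C D where CD: "0 \<le> C" "0 \<le> D" "\<forall>j. (y j)\<^sup>2 \<le> C * (1/4) ^ j + D * ?w j"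
      using upper conv(1) by auto
    have "lseq (2 * recip s) (\<lambda>j. C * (1/4) ^ j + D * ?w j)"
      by (intro lseq_add lseq_cmult lseq_geometric conv(2) CD r0 mult_nonneg_nonneg w0) auto
    then show "lseq (2 * recip s) (\<lambda>k. (y k)\<^sup>2)"
      by (rule lseq_mono[OF _ r0]) (use CD in auto)
  qed
  finally show ?thesis .
qed

end

lemma bounded_power_series:
  fixes a :: "nat \<Rightarrow> complex"
  assumes a: "\<And>n. norm (a n) \<le> C"
  obtains f where "f holomorphic_on ball 0 1" "taylor_coeff f = a"
proof -
  have "(\<lambda>n. a n * z ^ n) sums (\<Sum>n. a n * z ^ n)" if "norm z < 1" for z
  proof (rule summable_sums)
    have "summable (\<lambda>n. C * norm z ^ n)" using that by (intro summable_mult summable_geometric) simp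
    then show "summable (\<lambda>n. a n * z ^ n)"
      by (rule summable_comparison_test'[of _ 0]) (auto simp: norm_mult norm_power intro!: mult_right_mono a)
  qed
  from power_series_on_disk[OF this] that show ?thesis by blast
qed

text \<open>A sequence that satisfies the condition has still to be realized by a function: bounded
  block weights with \<open>\<beta> \<ge> 1\<close> force bounded coefficients, so the power series
  converges in the disk.\<close>

lemma mixed_norm_deriv_space_iff:
  assumes s: "0 < s" and \<beta>: "1 \<le> \<beta>"
  shows "l \<in> seq_space (mixed_norm_deriv_space 2 s 1 \<beta>) \<longleftrightarrow> lseq (2 * recip s) (block_weight \<beta> l)"
proof
  assume "l \<in> seq_space (mixed_norm_deriv_space 2 s 1 \<beta>)"
  then obtain f where "f holomorphic_on ball 0 1" "l = taylor_coeff f" "frac_deriv \<beta> f \<in> mixed_norm_space 2 s 1"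
    by (auto simp: seq_space_def mixed_norm_deriv_space_def disk_holomorphic_def)
  then show "lseq (2 * recip s) (block_weight \<beta> l)" using frac_deriv_mixed_norm_iff[OF _ \<beta> s] by blast
next
  assume l: "lseq (2 * recip s) (block_weight \<beta> l)"
  obtain C where C: "0 \<le> C" "\<And>k. block_weight \<beta> l k \<le> C"
    using lseq_imp_bounded[OF l _ block_weight_nonneg] recip_nonneg[of s] by auto
  have bd: "norm (l n) \<le> max (sqrt C) (norm (l 0))" for n
  proof (cases "n = 0")
    case False
    then obtain k where k: "n \<in> {2 ^ k..<2 ^ Suc k}"
      using ex_power_ivl1[of 2 n] by (auto simp: Suc_le_eq)
    have "(norm (l n))\<^sup>2 \<le> (\<Sum>n\<in>{2 ^ k..<2 ^ Suc k}. (norm (l n))\<^sup>2)" using k by (intro member_le_sum) auto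
    also have "\<dots> = 1 * (\<Sum>n\<in>{2 ^ k..<2 ^ Suc k}. (norm (l n))\<^sup>2)" by simp
    also have "\<dots> \<le> block_weight \<beta> l k"
      unfolding block_weight_def using \<beta> by (intro mult_right_mono sum_nonneg one_le_power ge_one_powr_ge_zero) auto
    also have "\<dots> \<le> C" by (rule C)
    finally have "norm (l n) \<le> sqrt C" by (rule real_le_rsqrt)
    then show ?thesis by simp
  qed simp
  obtain f where f: "f holomorphic_on ball 0 1" "taylor_coeff f = l" using bounded_power_series[OF bd] .
  then have "frac_deriv \<beta> f \<in> mixed_norm_space 2 s 1" using frac_deriv_mixed_norm_iff[OF f(1) \<beta> s] l by simp
  then show "l \<in> seq_space (mixed_norm_deriv_space 2 s 1 \<beta>)"
    using f unfolding seq_space_def mixed_norm_deriv_space_def disk_holomorphic_def by auto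
qed

section \<open>Coefficients of Hardy-Lorentz functions\<close>

text \<open>Parseval's identity in both directions; for the partial sums the radius tends to 1 with
  the number of terms fixed.\<close>

lemma hardy_H2_iff: "s \<in> seq_space hardy_H2 \<longleftrightarrow> summable (\<lambda>n. (norm (s n))\<^sup>2)"
proof
  assume "s \<in> seq_space hardy_H2"
  then obtain f where f: "f holomorphic_on ball 0 1" "s = taylor_coeff f" and b: "bdd_above ((\<lambda>r. integral_mean 2 r f) ` {0<..<1})"
    by (auto simp: seq_space_def hardy_H2_def disk_holomorphic_def)
  obtain K where "\<forall>r\<in>{0<..<1}. integral_mean 2 r f \<le> K"
    using b by (auto simp: bdd_above_def)
  then have K: "0 < r \<Longrightarrow> r < 1 \<Longrightarrow> integral_mean 2 r f \<le> K" for r by simp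
  show "summable (\<lambda>n. (norm (s n))\<^sup>2)"
  proof (rule summableI_nonneg_bounded)
    fix N
    have "(\<Sum>n<N. (norm (s n))\<^sup>2 * radius i ^ (2 * n)) \<le> K\<^sup>2" for i
    proof -
      note sm = integral_mean_2[OF f(1) radius_bounds(2,3)[of i]]
      have "(\<Sum>n<N. (norm (s n))\<^sup>2 * radius i ^ (2 * n)) \<le> (\<Sum>n. (norm (s n))\<^sup>2 * radius i ^ (2 * n))"
        using sums_summable[OF sm] radius_bounds(2)[of i] by (intro sum_le_suminf) (auto simp: f(2))
      also have "\<dots> = (integral_mean 2 (radius i) f)\<^sup>2" using sm by (simp add: sums_iff f(2))
      also have "\<dots> \<le> K\<^sup>2" by (intro power_mono K radius_bounds integral_mean_nonneg)
      finally show ?thesis .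
    qed
    moreover have "(\<lambda>i. \<Sum>n<N. (norm (s n))\<^sup>2 * radius i ^ (2 * n)) \<longlonglongrightarrow> (\<Sum>n<N. (norm (s n))\<^sup>2 * 1 ^ (2 * n))"
      by (intro tendsto_intros radius_tendsto)
    ultimately show "(\<Sum>n<N. (norm (s n))\<^sup>2) \<le> K\<^sup>2"
      by (intro LIMSEQ_le_const2[of "\<lambda>i. \<Sum>n<N. (norm (s n))\<^sup>2 * radius i ^ (2 * n)"]) auto
  qed simp
next
  assume s: "summable (\<lambda>n. (norm (s n))\<^sup>2)"
  have bd: "norm (s n) \<le> sqrt (\<Sum>n. (norm (s n))\<^sup>2)" for n
    using sum_le_suminf[OF s, of "{n}"] by (intro real_le_rsqrt) simp
  obtain f where f: "f holomorphic_on ball 0 1" "taylor_coeff f = s" using bounded_power_series[OF bd] .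
  have "integral_mean 2 r f \<le> sqrt (\<Sum>n. (norm (s n))\<^sup>2)" if r: "0 < r" "r < 1" for r
  proof (rule real_le_rsqrt)
    show "(integral_mean 2 r f)\<^sup>2 \<le> (\<Sum>n. (norm (s n))\<^sup>2)"
      by (rule sums_le[OF _ integral_mean_2[OF f(1)] summable_sums[OF s]])
         (use r in \<open>auto simp: f(2) intro!: mult_right_le_one_le power_le_one\<close>)
  qed
  then have "bdd_above ((\<lambda>r. integral_mean 2 r f) ` {0<..<1})" by (intro bdd_aboveI2) auto
  then show "s \<in> seq_space hardy_H2"
    using f unfolding seq_space_def hardy_H2_def disk_holomorphic_def by auto
qed

text \<open>The factor 2 places \<open>A j\<close> strictly above the rearrangement, as the last
  claim of \<open>decreasing_rearrangement_props\<close> asks, and \<open>A j \<ge> 2\<close> lets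
  the maximum with 1 be dropped from the inequality.\<close>

lemma hardy_lorentz_level_sets:
  assumes f: "f \<in> smirnov"
  defines "A \<equiv> \<lambda>j. 2 * max 1 (decreasing_rearrangement (boundary_fun f) ((1/2) ^ j))"
  shows "measure circle_measure {\<zeta> \<in> sphere 0 1. A j powr (1 / real (Suc m)) <
     exp (log_plus (norm (boundary_fun f \<zeta>)) / real (Suc m))} \<le> (1/2) ^ j"
proof -
  let ?g = "boundary_fun f"
  have gm: "?g \<in> borel_measurable circle_measure" by (rule boundary_fun_measurable[OF smirnov_holomorphic[OF f]])
  have A: "2 \<le> A j" by (simp add: A_def)
  have "{\<zeta> \<in> sphere 0 1. A j powr (1 / real (Suc m)) < exp (log_plus (norm (?g \<zeta>)) / real (Suc m))}
     \<subseteq> {\<zeta> \<in> sphere 0 1. norm (?g \<zeta>) > A j}"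
  proof safe
    fix \<zeta> assume "A j powr (1 / real (Suc m)) < exp (log_plus (norm (?g \<zeta>)) / real (Suc m))"
    then have "(A j powr (1 / real (Suc m))) ^ Suc m < exp (log_plus (norm (?g \<zeta>)) / real (Suc m)) ^ Suc m"
      by (intro power_strict_mono) auto
    also have "exp (log_plus (norm (?g \<zeta>)) / real (Suc m)) ^ Suc m = max 1 (norm (?g \<zeta>))"
      by (simp only: exp_divide_power_eq[OF zero_less_Suc] exp_log_plus)
    also have "(A j powr (1 / real (Suc m))) ^ Suc m = A j"
      using A by (simp add: powr_powr powr_realpow[symmetric] del: power_Suc of_nat_Suc)
    finally show "norm (?g \<zeta>) > A j" using A by simp
  qed
  moreover have "{\<zeta> \<in> space circle_measure. norm (?g \<zeta>) > A j} \<in> sets circle_measure" using gm by measurable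
  ultimately have "measure circle_measure {\<zeta> \<in> sphere 0 1. A j powr (1 / real (Suc m)) < exp (log_plus (norm (?g \<zeta>)) / real (Suc m))}
     \<le> distribution_fun ?g (A j)"
    unfolding distribution_fun_def by (intro circle.finite_measure_mono) (simp_all only: space_circle_measure)
  also have "\<dots> \<le> (1/2) ^ j"
    by (rule decreasing_rearrangement_props(4)[OF gm]) (auto simp: A_def max_def)
  finally show ?thesis .
qed

lemma half_power_eq_powr: "(1/2::real) ^ j = 2 powr (- real j)"
  by (simp add: powr_minus powr_realpow power_one_over inverse_eq_divide)

text \<open>At the levels of the rearrangement \<open>smirnov_coeff_le\<close> gives two sums of
  Hardy type: one over the levels up to \<open>k\<close>, with ratio \<tau>, and one over the levels
  beyond, with ratio \<sigma>. Both are dominated by geometric convolutions, which preserve the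
  sequence spaces.\<close>

lemma hardy_lorentz_coeff:
  assumes p: "0 < p" "p < 1" and q: "0 < q" and f: "f \<in> hardy_lorentz p q"
  shows "\<exists>x. lseq (recip q) x \<and> (\<forall>k. 0 \<le> x k) \<and>
    (\<forall>k. \<forall>n\<in>{2 ^ k..<2 ^ Suc k}. norm (taylor_coeff f n) \<le> (2 ^ k) powr (1/p - 1) * x k)"
proof -
  let ?\<theta> = "recip q"
  note r0 = recip_nonneg[of q]
  have fs: "f \<in> smirnov" and fin: "lorentz_norm p q (boundary_fun f) < \<infinity>" using f by (auto simp: hardy_lorentz_def)
  have gm: "boundary_fun f \<in> borel_measurable circle_measure" by (rule boundary_fun_measurable[OF smirnov_holomorphic[OF fs]])
  let ?h = "\<lambda>j. decreasing_rearrangement (boundary_fun f) ((1/2) ^ j)"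
  have h0: "0 \<le> ?h j" for j by (rule decreasing_rearrangement_props(2)[OF gm]) simp
  \<comment> \<open>Large enough that \<open>a < 1\<close> below, which makes the series over the
    upper levels converge.\<close>
  obtain m where m: "1 / p < real (Suc m)" using reals_Archimedean2[of "1/p"] by (metis less_Suc_eq of_nat_less_iff order_less_trans lessI)
  define M where "M = real (Suc m)"
  define a where "a = 1 / (p * M)"
  define b where "b = 1 / p - 1"
  have M: "0 < M" by (simp add: M_def)
  have mM: "1 / p < M" using m unfolding M_def .
  have a: "0 < a" "a < 1" "a * M = 1 / p" using mM M p by (simp_all add: a_def field_simps)
  have b: "0 < b" using p by (simp add: b_def)
  \<comment> \<open>\<open>\<sigma> < 1\<close> expresses \<open>1 / p < M\<close>, and
    \<open>\<tau> < 1\<close> expresses \<open>p < 1\<close>.\<close>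
  define \<sigma> :: real where "\<sigma> = 2 powr (a - 1)"
  define \<tau> :: real where "\<tau> = 2 powr (- b)"
  have \<sigma>: "0 < \<sigma>" "\<sigma> < 1" using a powr_less_mono[of "a - 1" 0 "2::real"] by (simp_all add: \<sigma>_def)
  have \<tau>: "0 < \<tau>" "\<tau> < 1" using b powr_less_mono[of "- b" 0 "2::real"] by (simp_all add: \<tau>_def)
  have \<sigma>p: "\<sigma> ^ n = 2 powr (real n * (a - 1))" and \<tau>p: "\<tau> ^ n = 2 powr (- (real n * b))" for n
    by (simp_all add: \<sigma>_def \<tau>_def powr_realpow[symmetric] powr_powr mult.commute)
  define A where "A j = 2 * max 1 (?h j)" for j
  define Bq where "Bq j = A j powr (1 / M)" for j
  have A2: "2 \<le> A j" for j by (simp add: A_def)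
  have B1: "1 \<le> Bq j" for j using A2[of j] M by (simp add: Bq_def ge_one_powr_ge_zero)
  have BA: "Bq j ^ Suc m = A j" for j
    using A2[of j] by (simp add: Bq_def M_def powr_powr powr_realpow[symmetric] del: power_Suc of_nat_Suc)
  \<comment> \<open>Normalized levels: \<open>x0\<close> has exponent \<open>q\<close>, and
    \<open>z\<close>, its \<open>M\<close>-th root, has exponent \<open>q * M\<close>.\<close>
  define x0 where "x0 j = A j * 2 powr (- (real j / p))" for j
  define z where "z j = Bq j * 2 powr (- (real j * a))" for j
  have x00: "0 \<le> x0 j" and z0: "0 \<le> z j" for j using A2[of j] B1[of j] by (simp_all add: x0_def z_def)
  \<comment> \<open>Replacing the rearrangement by its maximum with 1 adds only a geometric
    sequence.\<close>
  have lx0: "lseq ?\<theta> x0"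
  proof (rule lseq_mono[OF _ r0 x00])
    have pw: "((1/2) ^ j) powr (1/p) = 2 powr (- (real j / p))" for j
      by (simp add: half_power_eq_powr powr_powr)
    have "lseq ?\<theta> (\<lambda>j. ((1/2) powr (1/p)) ^ j)"
      using p powr_less_mono2[of "1/p" "1/2" 1] by (intro lseq_geometric r0) auto
    also have "(\<lambda>j. ((1/2) powr (1/p)) ^ j) = (\<lambda>j. 2 powr (- (real j / p)))"
      by (simp add: fun_eq_iff pw[symmetric] powr_power mult.commute powr_realpow[symmetric] powr_powr)
    finally have g: "lseq ?\<theta> (\<lambda>j. 2 powr (- (real j / p)))" .
    have "lseq ?\<theta> (\<lambda>j. ?h j * 2 powr (- (real j / p)))"
      using lorentz_finite_imp_lseq[OF p(1) q gm fin] by (simp only: pw)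
    then show "lseq ?\<theta> (\<lambda>j. 2 * (2 powr (- (real j / p)) + ?h j * 2 powr (- (real j / p))))"
      using h0 by (intro lseq_cmult lseq_add g r0 add_nonneg_nonneg mult_nonneg_nonneg) auto
    show "x0 j \<le> 2 * (2 powr (- (real j / p)) + ?h j * 2 powr (- (real j / p)))" for j
    proof -
      have "A j \<le> 2 * (1 + ?h j)" using h0[of j] by (simp add: A_def)
      then have "x0 j \<le> 2 * (1 + ?h j) * 2 powr (- (real j / p))" unfolding x0_def by (intro mult_right_mono) auto
      then show ?thesis by (simp add: algebra_simps)
    qed
  qed
  have zx: "z j = x0 j powr (1 / M)" for j
  proof -
    have "x0 j powr (1 / M) = Bq j * (2 powr (- (real j / p))) powr (1 / M)"
      using A2[of j] by (simp add: x0_def Bq_def powr_mult)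
    also have "(2 powr (- (real j / p))) powr (1 / M) = 2 powr (- (real j * a))"
      using M p by (simp add: powr_powr a_def)
    finally show ?thesis by (simp add: z_def)
  qed
  have lz: "lseq (?\<theta> * (1 / M)) z"
    using lseq_powr[OF lx0 r0 _ x00, of "1 / M"] M by (simp add: zx[abs_def, symmetric])
  have rM: "0 \<le> ?\<theta> * (1 / M)" using r0 M by simp
  \<comment> \<open>\<open>V\<close> serves the levels up to \<open>k\<close> at the exponent
    \<open>q\<close>. \<open>Z\<close> serves the levels beyond \<open>k\<close> for the root, and
    its \<open>Suc m\<close>-th power returns to the exponent \<open>q\<close>. Both sums run over
    all indices, the additional terms being nonnegative.\<close>
  define V where "V k = (\<Sum>j. \<tau> ^ index_dist k j * x0 (Suc j))" for k
  define Z where "Z k = (\<Sum>j. \<sigma> ^ index_dist k j * z (Suc j))" for k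
  note convV = lseq_convolution[OF \<tau> lseq_Suc[OF lx0] r0 x00]
  note convZ = lseq_convolution[OF \<sigma> lseq_Suc[OF lz] rM z0]
  have V0: "0 \<le> V k" and Z0: "0 \<le> Z k" for k
    unfolding V_def Z_def using \<tau> \<sigma> x00 z0 by (auto intro!: suminf_nonneg convV convZ)
  have Bsum: "Bq (Suc j) * (1/2) ^ j = 2 powr a * (2 powr (real j * (a - 1)) * z (Suc j))" for j
  proof -
    have "2 powr a * (2 powr (real j * (a - 1)) * z (Suc j)) =
      Bq (Suc j) * (2 powr a * (2 powr (real j * (a - 1)) * 2 powr (- (real (Suc j) * a))))"
      by (simp add: z_def mult_ac)
    also have "2 powr a * (2 powr (real j * (a - 1)) * 2 powr (- (real (Suc j) * a))) = 2 powr (- real j)"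
      by (simp add: powr_add[symmetric] algebra_simps)
    finally show ?thesis by (simp add: half_power_eq_powr)
  qed
  have sB: "summable (\<lambda>j. Bq (Suc j) * (1/2) ^ j)"
    unfolding Bsum using convZ(1)[of 0] by (intro summable_mult) (simp add: index_dist_def \<sigma>p)
  have sBk: "summable (\<lambda>i. Bq (Suc (k + i)) * (1/2) ^ (k + i))" for k
    using summable_ignore_initial_segment[OF sB, of k] by (simp add: add.commute)
  have TZ: "(\<Sum>i. Bq (Suc (k + i)) * (1/2) ^ (k + i)) \<le> 2 powr a * 2 powr (real k * (a - 1)) * Z k" for k
  proof -
    have eq: "Bq (Suc (k + i)) * (1/2) ^ (k + i) = 2 powr a * 2 powr (real k * (a - 1)) * (\<sigma> ^ index_dist k (i + k) * z (Suc (i + k)))" for i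
    proof -
      have "2 powr (real (k + i) * (a - 1)) = 2 powr (real k * (a - 1)) * (2::real) powr (real i * (a - 1))"
        by (simp add: powr_add[symmetric] algebra_simps)
      then show ?thesis unfolding Bsum by (simp add: \<sigma>p index_dist_def mult_ac add.commute)
    qed
    have sh: "summable (\<lambda>i. \<sigma> ^ index_dist k (i + k) * z (Suc (i + k)))"
      using summable_ignore_initial_segment[OF convZ(1)[of k], of k] .
    have "(\<Sum>i. Bq (Suc (k + i)) * (1/2) ^ (k + i)) = 2 powr a * 2 powr (real k * (a - 1)) * (\<Sum>i. \<sigma> ^ index_dist k (i + k) * z (Suc (i + k)))"
      unfolding eq by (rule suminf_mult[OF sh])
    also have "(\<Sum>i. \<sigma> ^ index_dist k (i + k) * z (Suc (i + k))) \<le> Z k"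
    proof -
      have "0 \<le> (\<Sum>j<k. \<sigma> ^ index_dist k j * z (Suc j))" using \<sigma> z0 by (intro sum_nonneg) auto
      then show ?thesis unfolding Z_def using suminf_split_initial_segment[OF convZ(1)[of k], of k] by linarith
    qed
    finally show ?thesis by (simp add: mult_left_mono)
  qed
  define x where "x k = 4 * 2 ^ Suc m * (A 0 * \<tau> ^ k + 2 powr (1/p) * V k + 4 ^ m * 2 powr (1/p) * Z k ^ Suc m)" for k
  have "lseq ?\<theta> (\<lambda>k. Z k ^ Suc m)"
  proof -
    have "lseq (?\<theta> * (1 / M)) Z" unfolding Z_def[abs_def] by (rule convZ(2))
    from lseq_power[OF this rM _ Z0, of "Suc m"] show ?thesis using M by (simp add: M_def[symmetric] del: of_nat_Suc power_Suc)
  qed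
  moreover have "lseq ?\<theta> V" unfolding V_def[abs_def] by (rule convV(2))
  moreover have "lseq ?\<theta> (\<lambda>k. \<tau> ^ k)" by (rule lseq_geometric[OF \<tau> r0])
  ultimately have lx: "lseq ?\<theta> x"
    unfolding x_def[abs_def] using A2[of 0] \<tau> V0 Z0
    by (intro lseq_cmult lseq_add r0 add_nonneg_nonneg mult_nonneg_nonneg zero_le_power) auto
  have x0': "0 \<le> x k" for k
    unfolding x_def using A2[of 0] \<tau> V0 Z0 by (intro mult_nonneg_nonneg add_nonneg_nonneg zero_le_power) auto
  have "norm (taylor_coeff f n) \<le> (2 ^ k) powr b * x k" if n: "n \<in> {2 ^ k..<2 ^ Suc k}" for n k
  proof -
    have kb: "(2 ^ k) powr b = 2 powr (real k * b)" by (simp add: powr_realpow[symmetric] powr_powr)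
    have kb1: "2 powr (real k * b) * \<tau> ^ k = 1" by (simp add: \<tau>p powr_add[symmetric])
    have "norm (taylor_coeff f n) \<le> 4 * 2 ^ Suc m * (Bq 0 ^ Suc m + (\<Sum>j<k. Bq (Suc j) ^ Suc m * (1/2) ^ j)
     + (4 * 2 ^ k) ^ m * (\<Sum>i. Bq (Suc (k + i)) * (1/2) ^ (k + i)) ^ Suc m)"
      by (rule smirnov_coeff_le[OF fs _ B1 sB])
         (use hardy_lorentz_level_sets[OF fs, of _ m] n in \<open>simp_all add: Bq_def A_def M_def del: of_nat_Suc\<close>)
    also have "\<dots> \<le> 4 * 2 ^ Suc m * (2 powr (real k * b) * (A 0 * \<tau> ^ k) + 2 powr (real k * b) * (2 powr (1/p) * V k)
        + 2 powr (real k * b) * (4 ^ m * 2 powr (1/p) * Z k ^ Suc m))"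
    proof (intro mult_left_mono add_mono)
      show "Bq 0 ^ Suc m \<le> 2 powr (real k * b) * (A 0 * \<tau> ^ k)"
        using kb1 unfolding BA by (simp add: mult.left_commute)
      have "(\<Sum>j<k. Bq (Suc j) ^ Suc m * (1/2) ^ j) = (\<Sum>j<k. 2 powr (real k * b) * (2 powr (1/p) * (\<tau> ^ index_dist k j * x0 (Suc j))))"
      proof (rule sum.cong[OF refl])
        fix j assume "j \<in> {..<k}"
        then have d: "real (index_dist k j) = real k - real j" by (simp add: index_dist_def of_nat_diff)
        have "2 powr (real k * b) * (2 powr (1/p) * (\<tau> ^ index_dist k j * x0 (Suc j))) =
          A (Suc j) * (2 powr (real k * b) * (2 powr (1/p) * (2 powr (- ((real k - real j) * b)) * 2 powr (- (real (Suc j) / p)))))"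
          by (simp add: \<tau>p d x0_def mult_ac)
        also have "2 powr (real k * b) * (2 powr (1/p) * (2 powr (- ((real k - real j) * b)) * 2 powr (- (real (Suc j) / p)))) = 2 powr (- real j)"
          using p by (simp add: powr_add[symmetric] b_def add_divide_distrib algebra_simps)
        finally show "Bq (Suc j) ^ Suc m * (1/2) ^ j = 2 powr (real k * b) * (2 powr (1/p) * (\<tau> ^ index_dist k j * x0 (Suc j)))"
          by (simp only: BA half_power_eq_powr)
      qed
      also have "\<dots> = 2 powr (real k * b) * (2 powr (1/p) * (\<Sum>j<k. \<tau> ^ index_dist k j * x0 (Suc j)))"
        by (simp only: sum_distrib_left)
      also have "\<dots> \<le> 2 powr (real k * b) * (2 powr (1/p) * V k)"
        unfolding V_def using \<tau> x00 by (intro mult_left_mono sum_le_suminf convV) auto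
      finally show "(\<Sum>j<k. Bq (Suc j) ^ Suc m * (1/2) ^ j) \<le> 2 powr (real k * b) * (2 powr (1/p) * V k)" .
      have "0 \<le> (\<Sum>i. Bq (Suc (k + i)) * (1/2) ^ (k + i))"
        using order_trans[OF zero_le_one B1] by (intro suminf_nonneg sBk) auto
      then have "(4 * 2 ^ k) ^ m * (\<Sum>i. Bq (Suc (k + i)) * (1/2) ^ (k + i)) ^ Suc m \<le>
         (4 * 2 ^ k) ^ m * (2 powr a * 2 powr (real k * (a - 1)) * Z k) ^ Suc m"
        by (intro mult_left_mono power_mono TZ) auto
      also have "\<dots> = 4 ^ m * Z k ^ Suc m * ((2 ^ k) ^ m * ((2 powr a) ^ Suc m * (2 powr (real k * (a - 1))) ^ Suc m))"
        by (simp only: power_mult_distrib mult_ac)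
      also have "(2 ^ k) ^ m * ((2 powr a) ^ Suc m * (2 powr (real k * (a - 1))) ^ Suc m) = 2 powr (real k * real m + (a * M + real k * (a - 1) * M))"
      proof -
        have "(2 powr a) ^ Suc m = (2::real) powr (a * M)" "(2 powr (real k * (a - 1))) ^ Suc m = (2::real) powr (real k * (a - 1) * M)"
          unfolding M_def by (simp_all only: powr_powr[symmetric] powr_realpow powr_gt_zero zero_less_numeral simp_thms) (simp_all add: powr_realpow del: power_Suc of_nat_Suc)
        moreover have "((2::real) ^ k) ^ m = 2 powr (real k * real m)"
          by (simp add: powr_realpow[symmetric] powr_powr)
        ultimately show ?thesis by (simp only: powr_add)
      qed
      \<comment> \<open>The powers of 2 from the kernel and from the tail combine to the desired
        growth of the block, because \<open>a * M = 1 / p\<close> and \<open>M\<close> is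
        \<open>m + 1\<close>.\<close>
      also have "real k * real m + (a * M + real k * (a - 1) * M) = real k * b + 1 / p"
      proof -
        have "real k * (a - 1) * M = real k * (1/p) - real k * M" by (simp add: a(3)[symmetric] algebra_simps)
        then show ?thesis unfolding a(3) b_def by (simp add: M_def algebra_simps)
      qed
      also have "4 ^ m * Z k ^ Suc m * 2 powr (real k * b + 1 / p) = 2 powr (real k * b) * (4 ^ m * 2 powr (1/p) * Z k ^ Suc m)"
        by (simp only: powr_add mult_ac)
      finally show "(4 * 2 ^ k) ^ m * (\<Sum>i. Bq (Suc (k + i)) * (1/2) ^ (k + i)) ^ Suc m \<le>
         2 powr (real k * b) * (4 ^ m * 2 powr (1/p) * Z k ^ Suc m)" .
    qed auto
    also have "\<dots> = (2 ^ k) powr b * x k" unfolding kb x_def by (simp only: distrib_left mult_ac)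
    finally show ?thesis .
  qed
  then show ?thesis using lx x0' unfolding b_def by blast
qed

section \<open>Test functions\<close>

text \<open>The binomial series; the factor \<open>Gamma (real B)\<close> turns its coefficients
  into \<open>gamma_ratio\<close>.\<close>

lemma power_series_inverse_power:
  fixes w :: complex
  assumes w: "norm w < 1" and B: "1 < B"
  shows "(\<lambda>n. of_real (gamma_ratio (real B - 1) n) * w ^ n) sums (of_real (Gamma (real B)) / (1 - w) ^ B)"
proof -
  have w1: "1 - w \<noteq> 0" using w by auto
  have "(\<lambda>n. (- of_nat B gchoose n) * (- w) ^ n) sums (1 + (- w)) powr (- of_nat B)"
    by (rule gen_binomial_complex) (use w in simp)
  moreover have "(1 + (- w)) powr (- of_nat B) = 1 / (1 - w) ^ B"
    using w1 by (simp add: powr_minus powr_nat' inverse_eq_divide)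
  moreover have "(- of_nat B gchoose n) * (- w) ^ n = of_real (pochhammer (real B) n / fact n) * w ^ n" for n
  proof -
    have "(- of_nat B gchoose n) = (- 1) ^ n * (of_real (pochhammer (real B) n) / fact n :: complex)"
      by (simp add: gbinomial_pochhammer pochhammer_of_real[symmetric])
    moreover have "(- w) ^ n = (- 1) ^ n * w ^ n" by (rule power_minus)
    moreover have "(- 1) ^ n * (- 1) ^ n = (1::complex)" by (simp add: power_mult_distrib[symmetric])
    ultimately show ?thesis by (simp add: mult_ac)
  qed
  ultimately have "(\<lambda>n. of_real (pochhammer (real B) n / fact n) * w ^ n) sums (1 / (1 - w) ^ B)" by simp
  from sums_mult[OF this, of "of_real (Gamma (real B))"]
  have "(\<lambda>n. of_real (Gamma (real B)) * (of_real (pochhammer (real B) n / fact n) * w ^ n)) sums (of_real (Gamma (real B)) / (1 - w) ^ B)"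
    by simp
  moreover have "Gamma (real B) * (pochhammer (real B) n / fact n) = gamma_ratio (real B - 1) n" for n
  proof -
    have "real B \<notin> \<int>\<^sub>\<le>\<^sub>0" using B by (auto elim!: nonpos_Ints_cases)
    moreover have "Gamma (real B) \<noteq> 0" using B Gamma_real_pos[of "real B"] by linarith
    ultimately show ?thesis by (simp add: gamma_ratio_def pochhammer_Gamma add.commute)
  qed
  then have "of_real (Gamma (real B)) * (of_real (pochhammer (real B) n / fact n) * w ^ n) = of_real (gamma_ratio (real B - 1) n) * w ^ n" for n
    by (simp only: of_real_mult[symmetric] mult.assoc[symmetric])
  ultimately show ?thesis by simp
qed

context
  fixes e :: "nat \<Rightarrow> real" and B :: nat
  assumes e0: "\<And>k. 0 \<le> e k" and se: "summable e" and B: "1 < B"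
begin

private definition \<rho> :: "nat \<Rightarrow> real" where "\<rho> k = 1 - (1/2) ^ Suc k"

private definition T :: "nat \<Rightarrow> complex \<Rightarrow> complex" where
  "T k z = of_real (e k) * (of_real (Gamma (real B)) / (1 - of_real (\<rho> k) * z) ^ B)"

text \<open>
  The \<open>k\<close>-th summand peaks at 1 on the scale \<open>2 ^ - k\<close>, and its coefficients of order about \<open>2 ^ k\<close> are comparable
  to \<open>e k * 2 ^ (k * (B - 1))\<close>. All coefficients are positive, so the summands do not cancel.
\<close>

definition kernel_sum :: "complex \<Rightarrow> complex" where
  "kernel_sum z = (\<Sum>k. of_real (e k) * (of_real (Gamma (real B)) / (1 - of_real (1 - (1/2) ^ Suc k) * z) ^ B))"

text \<open>Size at distance \<open>x\<close> from 1: the base of the \<open>k\<close>-th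
  denominator has modulus at least \<open>(1/2) ^ Suc k\<close> and at least
  \<open>x / 2\<close>.\<close>

definition kernel_majorant :: "real \<Rightarrow> real" where
  "kernel_majorant x = (\<Sum>k. e k * (Gamma (real B) * (min (2 ^ Suc k) (2 / x)) ^ B))"

private lemma kernel_sum_eq: "kernel_sum z = (\<Sum>k. T k z)"
  by (simp add: kernel_sum_def T_def \<rho>_def)

section \<open>Pointwise bounds and boundary values of the test functions\<close>

private lemma \<rho>: "0 \<le> \<rho> k" "\<rho> k < 1" "1 - \<rho> k = (1/2) ^ Suc k"
  by (auto simp: \<rho>_def power_le_one simp del: power_Suc)

private lemma Gp: "0 < Gamma (real B)"
  using B by (intro Gamma_real_pos) auto

text \<open>The defect \<open>1 - \<rho> k\<close> bounds the modulus from below and also bounds the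
  displacement from \<open>z\<close> to \<open>\<rho> k * z\<close>, whence the factor 2.\<close>

private lemma denom:
  fixes z :: complex
  assumes "norm z \<le> 1"
  shows "(1/2) ^ Suc k \<le> norm (1 - of_real (\<rho> k) * z)" "norm (1 - z) \<le> 2 * norm (1 - of_real (\<rho> k) * z)"
proof -
  have "norm (of_real (\<rho> k) * z) \<le> \<rho> k * 1"
    unfolding norm_mult norm_of_real using assms \<rho>[of k] by (intro mult_mono) auto
  moreover have "norm (1::complex) - norm (of_real (\<rho> k) * z) \<le> norm (1 - of_real (\<rho> k) * z)" by (rule norm_triangle_ineq2)
  ultimately show 1: "(1/2) ^ Suc k \<le> norm (1 - of_real (\<rho> k) * z)" using \<rho>(3)[of k] by simp
  have "norm (1 - z) \<le> norm (1 - of_real (\<rho> k) * z) + norm (of_real (\<rho> k) * z - z)"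
    using norm_triangle_ineq[of "1 - of_real (\<rho> k) * z" "of_real (\<rho> k) * z - z"] by simp
  also have "of_real (\<rho> k) * z - z = - of_real (1 - \<rho> k) * z" by (simp add: algebra_simps)
  also have "norm \<dots> \<le> (1 - \<rho> k) * 1"
    unfolding norm_mult norm_minus_cancel norm_of_real using assms \<rho>[of k] by (intro mult_mono) auto
  finally show "norm (1 - z) \<le> 2 * norm (1 - of_real (\<rho> k) * z)" using 1 \<rho>(3)[of k] by simp
qed

private lemma T_le:
  assumes z: "norm z \<le> 1" and x: "0 < x" "x \<le> norm (1 - z)"
  shows "norm (T k z) \<le> e k * (Gamma (real B) * (min (2 ^ Suc k) (2 / x)) ^ B)"
proof -
  let ?d = "norm (1 - of_real (\<rho> k) * z)"
  have p: "0 < (1/2::real) ^ Suc k" by simp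
  have d: "0 < ?d" using denom(1)[OF z, of k] p by linarith
  have "1 / ?d \<le> 1 / (1/2) ^ Suc k" using denom(1)[OF z, of k] p by (intro divide_left_mono mult_pos_pos d) auto
  also have "\<dots> = 2 ^ Suc k" by (simp add: power_one_over)
  finally have 1: "1 / ?d \<le> 2 ^ Suc k" .
  have "x \<le> 2 * ?d" using denom(2)[OF z, of k] x by linarith
  then have 2: "1 / ?d \<le> 2 / x" using d x by (simp add: field_simps)
  have "norm (T k z) = e k * (Gamma (real B) * (1 / ?d) ^ B)"
    using e0[of k] Gp by (simp add: T_def norm_mult norm_divide norm_power power_one_over)
  also have "\<dots> \<le> e k * (Gamma (real B) * (min (2 ^ Suc k) (2 / x)) ^ B)"
    using 1 2 e0[of k] Gp by (intro mult_left_mono power_mono) auto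
  finally show ?thesis .
qed

private lemma majorant_term:
  assumes "0 < x"
  shows "0 \<le> e k * (Gamma (real B) * (min (2 ^ Suc k) (2 / x)) ^ B)"
    "e k * (Gamma (real B) * (min (2 ^ Suc k) (2 / x)) ^ B) \<le> e k * (Gamma (real B) * (2 / x) ^ B)"
  using assms e0[of k] Gp by (auto intro!: mult_left_mono mult_nonneg_nonneg power_mono zero_le_power)

private lemma majorant_summable:
  assumes "0 < x"
  shows "summable (\<lambda>k. e k * (Gamma (real B) * (min (2 ^ Suc k) (2 / x)) ^ B))"
  by (rule summable_comparison_test'[OF summable_mult2[OF se, of "Gamma (real B) * (2 / x) ^ B"], of 0])
     (use majorant_term[OF assms] in auto)

private lemma norm_kernel_sum_le:
  assumes z: "norm z \<le> 1" and x: "0 < x" "x \<le> norm (1 - z)"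
  shows "summable (\<lambda>k. norm (T k z))" "norm (kernel_sum z) \<le> kernel_majorant x"
proof -
  show s: "summable (\<lambda>k. norm (T k z))"
    by (rule summable_comparison_test'[OF majorant_summable[OF x(1)], of 0]) (use T_le[OF z x] in auto)
  have "norm (kernel_sum z) \<le> (\<Sum>k. norm (T k z))" unfolding kernel_sum_eq by (rule summable_norm[OF s])
  also have "\<dots> \<le> kernel_majorant x"
    unfolding kernel_majorant_def by (intro suminf_le s majorant_summable x T_le z)
  finally show "norm (kernel_sum z) \<le> kernel_majorant x" .
qed

private lemma kernel_majorant_le:
  assumes "0 < x"
  shows "kernel_majorant x \<le> (suminf e * Gamma (real B)) * (2 / x) ^ B"
proof -
  have "kernel_majorant x \<le> (\<Sum>k. e k * (Gamma (real B) * (2 / x) ^ B))"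
    unfolding kernel_majorant_def
    by (intro suminf_le majorant_summable assms majorant_term summable_mult2 se)
  also have "\<dots> = suminf e * (Gamma (real B) * (2 / x) ^ B)" by (rule suminf_mult2[OF se, symmetric])
  finally show ?thesis by (simp add: mult.assoc)
qed

text \<open>Away from 1 the series converges uniformly on the closed disk, so at every other
  boundary point the boundary value is given by the same series.\<close>

private lemma kernel_sum_continuous:
  assumes "0 < x"
  shows "continuous_on {z \<in> cball 0 1. x \<le> norm (1 - z)} kernel_sum"
proof (rule uniform_limit_theorem)
  let ?S = "{z \<in> cball 0 1. x \<le> norm (1 - z)}"
  have "uniform_limit ?S (\<lambda>n z. \<Sum>k<n. T k z) (\<lambda>z. \<Sum>k. T k z) sequentially"
    by (rule Weierstrass_m_test[OF _ majorant_summable[OF assms]]) (use T_le assms in auto)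
  then show "uniform_limit ?S (\<lambda>n z. \<Sum>k<n. T k z) kernel_sum sequentially"
    unfolding kernel_sum_eq .
  have "continuous_on ?S (T k)" for k
  proof -
    have "1 - of_real (\<rho> k) * z \<noteq> 0" if "norm z \<le> 1" for z :: complex
    proof
      assume "1 - of_real (\<rho> k) * z = 0"
      then have "norm (1 - of_real (\<rho> k) * z) = 0" by simp
      moreover have "0 < (1/2::real) ^ Suc k" by simp
      ultimately show False using denom(1)[OF that, of k] by linarith
    qed
    then show ?thesis unfolding T_def[abs_def] by (intro continuous_intros) auto
  qed
  then show "eventually (\<lambda>n. continuous_on ?S (\<lambda>z. \<Sum>k<n. T k z)) sequentially"
    by (intro always_eventually allI continuous_on_sum)
qed simp

private lemma kernel_sum_nontangential:
  assumes \<zeta>: "norm \<zeta> = 1" "\<zeta> \<noteq> 1"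
  shows "has_nontangential_limit kernel_sum \<zeta> (kernel_sum \<zeta>)"
proof -
  define \<eta> where "\<eta> = norm (1 - \<zeta>) / 2"
  have \<eta>: "0 < \<eta>" using \<zeta> by (simp add: \<eta>_def)
  let ?S = "{z \<in> cball 0 1. \<eta> \<le> norm (1 - z)}"
  have \<zeta>S: "\<zeta> \<in> ?S" using \<zeta> by (simp add: \<eta>_def)
  have "(kernel_sum \<longlongrightarrow> kernel_sum \<zeta>) (at \<zeta> within ?S)"
    using kernel_sum_continuous[OF \<eta>] \<zeta>S unfolding continuous_on_def by blast
  also have "at \<zeta> within ?S = at \<zeta> within cball 0 1"
  proof (rule at_within_nhd[where S = "ball \<zeta> \<eta>"])
    have "\<eta> \<le> norm (1 - z)" if "z \<in> ball \<zeta> \<eta>" for z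
    proof -
      have "norm (1 - \<zeta>) \<le> norm (1 - z) + norm (\<zeta> - z)"
        using norm_triangle_ineq4[of "1 - z" "\<zeta> - z"] by simp
      then show ?thesis using that by (simp add: \<eta>_def dist_norm)
    qed
    then show "?S \<inter> ball \<zeta> \<eta> - {\<zeta>} = cball 0 1 \<inter> ball \<zeta> \<eta> - {\<zeta>}" by blast
  qed (use \<eta> in auto)
  finally have "(kernel_sum \<longlongrightarrow> kernel_sum \<zeta>) (at \<zeta> within cball 0 1)" .
  moreover have "stolz_region \<kappa> \<zeta> \<subseteq> cball 0 1" for \<kappa> by (auto simp: stolz_region_def)
  ultimately show ?thesis unfolding has_nontangential_limit_def using tendsto_within_subset by blast
qed

text \<open>Each kernel is expanded in powers and the order of the double series is exchanged;
  \<open>\<rho> k \<le> 1\<close> and the summability of \<open>e\<close> give absolute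
  summability.\<close>

private lemma kernel_sum_power_series:
  assumes z: "norm z < 1"
  shows "(\<lambda>n. of_real (\<Sum>k. e k * (gamma_ratio (real B - 1) n * \<rho> k ^ n)) * z ^ n) sums kernel_sum z"
    and "summable (\<lambda>k. e k * (gamma_ratio (real B - 1) n * \<rho> k ^ n))"
proof -
  let ?g = "gamma_ratio (real B - 1)"
  have g0: "0 < ?g n" for n using B by (intro gamma_ratio_pos) auto
  show ss: "summable (\<lambda>k. e k * (?g n * \<rho> k ^ n))" for n
    by (rule summable_comparison_test'[OF summable_mult2[OF se, of "?g n"], of 0])
       (use e0 \<rho> g0 in \<open>auto simp: abs_mult less_imp_le intro!: mult_left_mono mult_right_le_one_le power_le_one\<close>)
  define t where "t k n = of_real (e k) * (of_real (?g n) * (of_real (\<rho> k) * z) ^ n)" for k n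
  have nz: "norm (of_real (\<rho> k) * z) < 1" for k
  proof -
    have "norm (of_real (\<rho> k) * z) \<le> 1 * norm z"
      unfolding norm_mult norm_of_real using \<rho>[of k] by (intro mult_right_mono) auto
    then show ?thesis using z by simp
  qed
  have nt: "norm (t k n) = e k * (?g n * (\<rho> k * norm z) ^ n)" for k n
    using e0[of k] g0[of n] \<rho>[of k] by (simp add: t_def norm_mult norm_power)
  have rowT: "(\<lambda>n. t k n) sums T k z" for k
    unfolding t_def T_def by (intro sums_mult power_series_inverse_power nz B)
  have row: "summable (\<lambda>n. norm (t k n))" for k
  proof -
    have "\<rho> k * norm z < 1" using nz[of k] \<rho>[of k] by (simp add: norm_mult)
    then show ?thesis unfolding nt using B \<rho>[of k] by (intro summable_mult summable_gamma_ratio) auto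
  qed
  have colle: "(\<Sum>n. norm (t k n)) \<le> e k * (\<Sum>n. ?g n * norm z ^ n)" for k
  proof -
    have sg: "summable (\<lambda>n. ?g n * norm z ^ n)" using B z by (intro summable_gamma_ratio) auto
    have "(\<Sum>n. norm (t k n)) \<le> (\<Sum>n. e k * (?g n * norm z ^ n))"
      using e0[of k] g0 \<rho>[of k]
      by (intro suminf_le row summable_mult sg)
         (auto simp: nt less_imp_le intro!: mult_left_mono power_mono mult_left_le_one_le)
    then show ?thesis by (simp add: suminf_mult[OF sg])
  qed
  have isum: "infsum (\<lambda>n. norm (t k n)) UNIV = (\<Sum>n. norm (t k n))" for k
    using row by (intro infsumI norm_summable_imp_has_sum summable_sums) auto
  have "(\<lambda>x. norm (case x of (k, n) \<Rightarrow> t k n)) summable_on UNIV \<times> UNIV"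
  proof (rule iffD2[OF Infinite_Sum.abs_summable_on_Sigma_iff], intro conjI ballI)
    fix k :: nat
    show "(\<lambda>n. norm (case (k, n) of (k, n) \<Rightarrow> t k n)) summable_on UNIV"
      using row[of k] by (simp add: summable_on_UNIV_nonneg_real_iff)
  next
    have "summable (\<lambda>k. \<Sum>n. norm (t k n))"
      by (rule summable_comparison_test'[OF summable_mult2[OF se, of "\<Sum>n. ?g n * norm z ^ n"], of 0])
         (use colle row in \<open>auto simp: suminf_nonneg\<close>)
    then show "(\<lambda>k. norm (infsum (\<lambda>n. norm (case (k, n) of (k, n) \<Rightarrow> t k n)) UNIV)) summable_on UNIV"
      using row by (simp add: isum summable_on_UNIV_nonneg_real_iff suminf_nonneg)
  qed
  then have sum2: "(\<lambda>(k, n). t k n) summable_on UNIV \<times> UNIV" by (rule abs_summable_summable)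
  have hk: "infsum (\<lambda>n. t k n) UNIV = T k z" for k
    by (rule infsumI[OF norm_summable_imp_has_sum[OF row rowT]])
  have col: "infsum (\<lambda>k. t k n) UNIV = of_real (\<Sum>k. e k * (?g n * \<rho> k ^ n)) * z ^ n" for n
  proof (rule infsumI[OF norm_summable_imp_has_sum])
    have "(\<lambda>k. of_real (e k * (?g n * \<rho> k ^ n)) * z ^ n) sums (of_real (\<Sum>k. e k * (?g n * \<rho> k ^ n)) * z ^ n)"
      by (intro sums_mult2 sums_of_real summable_sums ss)
    then show "(\<lambda>k. t k n) sums (of_real (\<Sum>k. e k * (?g n * \<rho> k ^ n)) * z ^ n)"
      by (simp add: t_def power_mult_distrib mult_ac)
    have "summable (\<lambda>k. e k * (?g n * \<rho> k ^ n) * norm z ^ n)" by (intro summable_mult2 ss)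
    then show "summable (\<lambda>k. norm (t k n))" by (simp add: nt power_mult_distrib mult_ac)
  qed
  have "infsum (\<lambda>n. infsum (\<lambda>k. t k n) UNIV) UNIV = infsum (\<lambda>k. infsum (\<lambda>n. t k n) UNIV) UNIV"
    by (rule infsum_swap_banach[OF sum2, symmetric])
  also have "\<dots> = infsum (\<lambda>k. T k z) UNIV" by (simp add: hk)
  also have "\<dots> = kernel_sum z"
  proof -
    have "0 < norm (1 - z)" using z by auto
    note s = norm_kernel_sum_le(1)[OF less_imp_le[OF z] this order_refl]
    show ?thesis unfolding kernel_sum_eq
      by (rule infsumI[OF norm_summable_imp_has_sum[OF s summable_sums[OF summable_norm_cancel[OF s]]]])
  qed
  finally have eq: "infsum (\<lambda>n. of_real (\<Sum>k. e k * (?g n * \<rho> k ^ n)) * z ^ n) UNIV = kernel_sum z" by (simp only: col)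
  have "(\<lambda>(n, k). t k n) summable_on UNIV \<times> UNIV"
    using sum2 by (subst summable_on_swap) (simp add: case_prod_unfold)
  then have "(\<lambda>n. infsum (\<lambda>k. t k n) UNIV) summable_on UNIV"
    using summable_on_Sigma_banach[of "\<lambda>n k. t k n" UNIV "\<lambda>_. UNIV"] by simp
  then have "((\<lambda>n. of_real (\<Sum>k. e k * (?g n * \<rho> k ^ n)) * z ^ n) has_sum kernel_sum z) UNIV"
    using eq by (simp only: col has_sum_iff simp_thms)
  then show "(\<lambda>n. of_real (\<Sum>k. e k * (?g n * \<rho> k ^ n)) * z ^ n) sums kernel_sum z" by (rule has_sum_imp_sums)
qed

lemma kernel_sum_holomorphic: "kernel_sum holomorphic_on ball 0 1"
  and kernel_sum_coeff: "taylor_coeff kernel_sum n = of_real (\<Sum>k. e k * (gamma_ratio (real B - 1) n * \<rho> k ^ n))"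
  using power_series_on_disk[OF kernel_sum_power_series(1)] by auto

lemma kernel_sum_coeff_ge:
  assumes "n < 2 ^ Suc k"
  shows "e k * gamma_ratio (real B - 1) n / 4 \<le> norm (taylor_coeff kernel_sum n)"
proof -
  let ?g = "gamma_ratio (real B - 1)"
  have g0: "0 < ?g n" using B by (intro gamma_ratio_pos) auto
  have t0: "0 \<le> e k * (?g n * \<rho> k ^ n)" for k using e0[of k] g0 \<rho>[of k] by simp
  have "e k * (?g n * (1/4)) \<le> e k * (?g n * \<rho> k ^ n)"
    unfolding \<rho>_def using e0[of k] g0 by (intro mult_left_mono one_minus_half_power_ge assms) auto
  also have "\<dots> \<le> (\<Sum>k. e k * (?g n * \<rho> k ^ n))"
    using sum_le_suminf[OF kernel_sum_power_series(2)[of 0 n], of "{k}"] t0 by simp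
  also have "\<dots> \<le> norm (taylor_coeff kernel_sum n)"
    unfolding kernel_sum_coeff norm_of_real by simp
  finally show ?thesis by simp
qed

text \<open>\<open>W \<zeta>\<close> is essentially the binary logarithm of the reciprocal distance of \<open>\<zeta>\<close> to 1.\<close>

private definition W :: "complex \<Rightarrow> ennreal" where
  "W \<zeta> = (\<Sum>j. indicator {z. norm (1 - z) < (1/2) ^ j} \<zeta>)"

private lemma W_measurable [measurable]: "W \<in> borel_measurable circle_measure"
proof -
  have [measurable]: "(indicator {z. norm (1 - z) < (1/2) ^ j} :: complex \<Rightarrow> ennreal) \<in> borel_measurable circle_measure" for j
  proof (rule borel_measurable_indicator')
    show "{x \<in> space circle_measure. x \<in> {z. norm (1 - z) < (1/2) ^ j}} \<in> sets circle_measure"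
      unfolding mem_Collect_eq by measurable
  qed
  show ?thesis unfolding W_def[abs_def] by measurable
qed

private lemma near_1_measurable: "{\<zeta> \<in> sphere 0 1. norm (1 - \<zeta>) < x} \<in> sets circle_measure"
proof -
  have "{\<zeta> \<in> space circle_measure. norm (1 - \<zeta>) < x} \<in> sets circle_measure" by measurable
  then show ?thesis by (simp only: space_circle_measure)
qed

text \<open>The neighbourhoods of 1 have geometrically decreasing measure: a logarithmic singularity
  is integrable on the circle.\<close>

private lemma W_integral: "(\<integral>\<^sup>+\<zeta>. W \<zeta> \<partial>circle_measure) < \<infinity>"
proof -
  have "(\<integral>\<^sup>+\<zeta>. W \<zeta> \<partial>circle_measure) = (\<integral>\<^sup>+\<zeta>. (\<Sum>j. indicator {z \<in> sphere 0 1. norm (1 - z) < (1/2) ^ j} \<zeta>) \<partial>circle_measure)"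
    unfolding W_def by (intro nn_integral_cong suminf_cong) (auto simp: indicator_def space_circle_measure)
  also have "\<dots> = (\<Sum>j. \<integral>\<^sup>+\<zeta>. indicator {z \<in> sphere 0 1. norm (1 - z) < (1/2) ^ j} \<zeta> \<partial>circle_measure)"
    by (intro nn_integral_suminf borel_measurable_indicator near_1_measurable)
  also have "\<dots> = (\<Sum>j. emeasure circle_measure {z \<in> sphere 0 1. norm (1 - z) < (1/2) ^ j})"
    by (intro suminf_cong nn_integral_indicator near_1_measurable)
  also have "\<dots> \<le> (\<Sum>j. ennreal ((1/2) ^ j))"
  proof (rule suminf_le)
    fix j
    show "emeasure circle_measure {z \<in> sphere 0 1. norm (1 - z) < (1/2) ^ j} \<le> ennreal ((1/2) ^ j)"
      unfolding circle.emeasure_eq_measure by (intro ennreal_leI measure_circle_near_1) simp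
  qed auto
  also have "\<dots> = ennreal (\<Sum>j. (1/2) ^ j)" by (intro suminf_ennreal2 summable_geometric) auto
  also have "\<dots> < \<infinity>" by simp
  finally show ?thesis .
qed

private lemma W_ge:
  assumes "\<And>i. i < m \<Longrightarrow> norm (1 - \<zeta>) < (1/2) ^ i"
  shows "of_nat m \<le> W \<zeta>"
proof -
  have "(of_nat m :: ennreal) = (\<Sum>i<m. indicator {z. norm (1 - z) < (1/2) ^ i} \<zeta>)"
    using assms by simp
  also have "\<dots> \<le> W \<zeta>" unfolding W_def by (intro sum_le_suminf) auto
  finally show ?thesis .
qed

text \<open>The singularity at 1 is at most a power of the distance, uniformly in \<open>r\<close>,
  so its \<open>log_plus\<close> is at most logarithmic; \<open>W\<close> provides an integrable
  majorant on all circles at once.\<close>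

private lemma log_plus_le:
  obtains K where "0 \<le> K" "\<And>r \<zeta>. norm \<zeta> = 1 \<Longrightarrow> 0 \<le> r \<Longrightarrow> r \<le> 1 \<Longrightarrow> \<zeta> \<noteq> 1 \<Longrightarrow>
    ennreal (log_plus (norm (kernel_sum (of_real r * \<zeta>)))) \<le> ennreal K + ennreal K * W \<zeta>"
proof -
  define C where "C = max 1 (suminf e * Gamma (real B) * 4 ^ B)"
  define K where "K = max (ln C) (real B * ln 2)"
  have C: "1 \<le> C" by (simp add: C_def)
  have K: "0 \<le> K" using C by (simp add: K_def le_max_iff_disj)
  have main: "ennreal (log_plus (norm (kernel_sum (of_real r * \<zeta>)))) \<le> ennreal K + ennreal K * W \<zeta>"
    if n1: "norm \<zeta> = 1" and r: "0 \<le> r" "r \<le> 1" and ne: "\<zeta> \<noteq> 1" for r and \<zeta> :: complex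
  proof -
    note \<zeta> = n1 ne
    let ?z = "of_real r * \<zeta>"
    let ?x = "norm (1 - \<zeta>)"
    have x: "0 < ?x" using \<zeta> by simp
    have z: "norm ?z \<le> 1" using \<zeta> r by (simp add: norm_mult)
    have "?x \<le> norm (1 - ?z) + norm (?z - \<zeta>)" using norm_triangle_ineq[of "1 - ?z" "?z - \<zeta>"] by simp
    moreover have "norm (?z - \<zeta>) = 1 - r" by (rule norm_dilate_diff[OF \<zeta>(1) r(2)])
    moreover have "1 - r \<le> norm (1 - ?z)"
      using norm_triangle_ineq2[of 1 ?z] \<zeta> r by (simp add: norm_mult)
    \<comment> \<open>Points on the radius to \<zeta> keep at least half of the distance of \<zeta>
      from 1, which is why the majorant does not depend on \<open>r\<close>.\<close>
    ultimately have xz: "?x / 2 \<le> norm (1 - ?z)" by linarith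
    define m where "m = (LEAST j. (1/2) ^ j \<le> ?x)"
    obtain n where "(1/2::real) ^ n < ?x" using real_arch_pow_inv[OF x, of "1/2"] by auto
    then have "(1/2) ^ n \<le> ?x" by simp
    then have m: "(1/2) ^ m \<le> ?x" unfolding m_def by (rule LeastI[of "\<lambda>j. (1/2) ^ j \<le> ?x" n])
    have "?x < (1/2) ^ i" if "i < m" for i
      using not_less_Least[of i "\<lambda>j. (1/2) ^ j \<le> ?x"] that by (simp add: m_def not_le)
    then have Wm: "of_nat m \<le> W \<zeta>" by (rule W_ge)
    have "norm (kernel_sum ?z) \<le> kernel_majorant (?x / 2)"
      by (rule norm_kernel_sum_le(2)[OF z _ xz]) (use x in simp)
    also have "\<dots> \<le> (suminf e * Gamma (real B)) * (2 / (?x / 2)) ^ B"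
      by (rule kernel_majorant_le) (use x in simp)
    also have "\<dots> = suminf e * Gamma (real B) * 4 ^ B * (1 / ?x) ^ B"
      by (simp add: power_divide)
    also have "\<dots> \<le> C * (2 ^ m) ^ B"
    proof (intro mult_mono power_mono)
      show "1 / ?x \<le> 2 ^ m" using m x by (simp add: power_one_over field_simps)
    qed (use x C in \<open>auto simp: C_def\<close>)
    finally have "max 1 (norm (kernel_sum ?z)) \<le> C * (2 ^ m) ^ B"
      using C mult_mono[of 1 C 1 "(2 ^ m) ^ B"] by simp
    then have "log_plus (norm (kernel_sum ?z)) \<le> ln (C * (2 ^ m) ^ B)"
      unfolding log_plus_def using C by (intro ln_mono) auto
    also have "\<dots> = ln C + real m * (real B * ln 2)"
      using C by (simp add: ln_mult ln_realpow)
    also have "\<dots> \<le> K + real m * K"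
      unfolding K_def by (intro add_mono mult_left_mono) auto
    finally have "ennreal (log_plus (norm (kernel_sum ?z))) \<le> ennreal (K + K * real m)"
      by (intro ennreal_leI) (simp add: mult.commute)
    also have "\<dots> = ennreal K + ennreal K * of_nat m"
      using K by (simp add: ennreal_mult ennreal_of_nat_eq_real_of_nat)
    also have "\<dots> \<le> ennreal K + ennreal K * W \<zeta>" by (intro add_left_mono mult_left_mono Wm) auto
    finally show ?thesis .
  qed
  show ?thesis by (rule that[OF K main])
qed

text \<open>\<open>W\<close> is infinite at 1 but integrable, so the point 1 is null.\<close>

private lemma AE_not_1: "AE \<zeta> in circle_measure. \<zeta> \<noteq> 1"
proof -
  have "W 1 = \<infinity>"
  proof -
    have le: "of_nat m \<le> W 1" for m by (rule W_ge) simp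
    show ?thesis
    proof (rule ccontr)
      assume "W 1 \<noteq> \<infinity>"
      then have "W 1 < top" unfolding infinity_ennreal_def less_top .
      then obtain n where "W 1 < of_nat n" using ennreal_Ex_less_of_nat by blast
      then show False using le[of n] by simp
    qed
  qed
  moreover have "AE \<zeta> in circle_measure. W \<zeta> \<noteq> \<infinity>"
    using W_integral by (intro nn_integral_PInf_AE) auto
  ultimately show ?thesis by (auto elim!: eventually_mono)
qed

text \<open>The integrable majorant from \<open>log_plus_le\<close> bounds all the means and, by
  dominated convergence along sequences of radii, makes them converge to the boundary
  integral.\<close>

lemma kernel_sum_smirnov: "kernel_sum \<in> smirnov"
proof -
  obtain K where K: "0 \<le> K" "\<And>r \<zeta>. norm \<zeta> = 1 \<Longrightarrow> 0 \<le> r \<Longrightarrow> r \<le> 1 \<Longrightarrow> \<zeta> \<noteq> 1 \<Longrightarrow>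
    ennreal (log_plus (norm (kernel_sum (of_real r * \<zeta>)))) \<le> ennreal K + ennreal K * W \<zeta>"
    by (rule log_plus_le) blast
  let ?w = "\<lambda>\<zeta>. ennreal K + ennreal K * W \<zeta>"
  let ?I = "\<lambda>r. \<integral>\<^sup>+\<zeta>. ennreal (log_plus (norm (kernel_sum (of_real r * \<zeta>)))) \<partial>circle_measure"
  note hol = kernel_sum_holomorphic
  have wfin: "(\<integral>\<^sup>+\<zeta>. ?w \<zeta> \<partial>circle_measure) < \<infinity>"
    using W_integral by (simp add: nn_integral_add nn_integral_cmult ennreal_mult_less_top)
  have bound: "AE \<zeta> in circle_measure. ennreal (log_plus (norm (kernel_sum (of_real r * \<zeta>)))) \<le> ?w \<zeta>" if "0 \<le> r" "r \<le> 1" for r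
    using AE_not_1 AE_space by eventually_elim (use that in \<open>auto intro!: K simp: space_circle_measure\<close>)
  have bm [measurable]: "boundary_fun kernel_sum \<in> borel_measurable circle_measure"
    by (rule boundary_fun_measurable[OF hol])
  have "kernel_sum \<in> nevanlinna"
  proof -
    have "(SUP r\<in>{0<..<1}. ?I r) \<le> (\<integral>\<^sup>+\<zeta>. ?w \<zeta> \<partial>circle_measure)"
      by (intro SUP_least nn_integral_mono_AE bound) auto
    also note wfin
    finally show ?thesis using hol by (simp add: nevanlinna_def disk_holomorphic_def)
  qed
  moreover have "(?I \<longlongrightarrow> (\<integral>\<^sup>+\<zeta>. ennreal (log_plus (norm (boundary_fun kernel_sum \<zeta>))) \<partial>circle_measure)) (at_left 1)"
  proof (rule tendsto_at_left_sequentially[where b = 0])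
    fix S :: "nat \<Rightarrow> real"
    assume S: "\<And>n. S n < 1" "\<And>n. 0 < S n" "S \<longlonglongrightarrow> 1"
    show "(\<lambda>n. ?I (S n)) \<longlonglongrightarrow> (\<integral>\<^sup>+\<zeta>. ennreal (log_plus (norm (boundary_fun kernel_sum \<zeta>))) \<partial>circle_measure)"
    proof (rule nn_integral_dominated_convergence[where w = ?w])
      fix n
      have [measurable]: "(\<lambda>\<zeta>. kernel_sum (of_real (S n) * \<zeta>)) \<in> borel_measurable circle_measure"
        using S(1)[of n] S(2)[of n] by (intro dilate_measurable hol) (auto simp: less_imp_le)
      show "(\<lambda>\<zeta>. ennreal (log_plus (norm (kernel_sum (of_real (S n) * \<zeta>))))) \<in> borel_measurable circle_measure"
        by measurable
      show "AE \<zeta> in circle_measure. ennreal (log_plus (norm (kernel_sum (of_real (S n) * \<zeta>)))) \<le> ?w \<zeta>"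
        using S(1)[of n] S(2)[of n] by (intro bound) auto
    next
      show "AE \<zeta> in circle_measure. (\<lambda>n. ennreal (log_plus (norm (kernel_sum (of_real (S n) * \<zeta>)))))
         \<longlonglongrightarrow> ennreal (log_plus (norm (boundary_fun kernel_sum \<zeta>)))"
        using AE_not_1 AE_space
      proof eventually_elim
        case (elim \<zeta>)
        then have n1: "norm \<zeta> = 1" by (simp add: space_circle_measure)
        note nt = kernel_sum_nontangential[OF n1 elim(1)]
        have "filterlim S (at_left 1) sequentially"
          unfolding filterlim_at using S by (auto intro!: always_eventually simp: less_imp_neq)
        from filterlim_compose[OF nontangential_radial[OF nt n1] this]
        have l: "(\<lambda>n. kernel_sum (of_real (S n) * \<zeta>)) \<longlonglongrightarrow> kernel_sum \<zeta>" .
        have "isCont (\<lambda>w. log_plus (norm w)) (kernel_sum \<zeta>)"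
          using continuous_on_log_plus[OF continuous_on_norm_id, of "UNIV :: complex set"] by (simp add: continuous_on_eq_continuous_at)
        from isCont_tendsto_compose[OF this l] show ?case
          unfolding boundary_fun_eq[OF nt n1] by (intro tendsto_ennrealI)
      qed
    qed (use wfin in auto)
  qed simp
  ultimately show ?thesis by (simp add: smirnov_def)
qed

text \<open>Boundary values above \<open>kernel_majorant s\<close> occur only within distance
  \<open>s\<close> of 1, on a set of measure at most \<open>s\<close>.\<close>

private lemma rearrangement_le:
  shows "0 < s \<Longrightarrow> s < 1 \<Longrightarrow> 0 \<le> decreasing_rearrangement (boundary_fun kernel_sum) s \<and>
      decreasing_rearrangement (boundary_fun kernel_sum) s \<le> kernel_majorant s"
    and "1 \<le> s \<Longrightarrow> decreasing_rearrangement (boundary_fun kernel_sum) s = 0"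
proof -
  let ?g = "boundary_fun kernel_sum"
  have gm: "?g \<in> borel_measurable circle_measure" by (rule boundary_fun_measurable[OF kernel_sum_holomorphic])
  have bdd: "bdd_below {t. 0 \<le> t \<and> distribution_fun ?g t \<le> s}" for s
    by (rule bdd_belowI[of _ 0]) simp
  show "0 \<le> decreasing_rearrangement ?g s \<and> decreasing_rearrangement ?g s \<le> kernel_majorant s" if s: "0 < s" "s < 1"
  proof
    show "0 \<le> decreasing_rearrangement ?g s" by (rule decreasing_rearrangement_props(2)[OF gm s(1)])
    have "{\<zeta> \<in> sphere 0 1. norm (?g \<zeta>) > kernel_majorant s} \<subseteq> {\<zeta> \<in> sphere 0 1. norm (1 - \<zeta>) < s}"
    proof safe
      fix \<zeta> :: complex assume \<zeta>: "\<zeta> \<in> sphere 0 1" "norm (?g \<zeta>) > kernel_majorant s"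
      then have n1: "norm \<zeta> = 1" by simp
      show "norm (1 - \<zeta>) < s"
      proof (rule ccontr)
        assume "\<not> ?thesis"
        then have le: "s \<le> norm (1 - \<zeta>)" by simp
        then have "\<zeta> \<noteq> 1" using s by auto
        then have "?g \<zeta> = kernel_sum \<zeta>" by (intro boundary_fun_eq kernel_sum_nontangential n1)
        then show False using norm_kernel_sum_le(2)[of \<zeta> s] n1 s le \<zeta>(2) by simp
      qed
    qed
    then have "distribution_fun ?g (kernel_majorant s) \<le> measure circle_measure {\<zeta> \<in> sphere 0 1. norm (1 - \<zeta>) < s}"
      unfolding distribution_fun_def by (intro circle.finite_measure_mono near_1_measurable)
    also have "\<dots> \<le> s" by (rule measure_circle_near_1[OF s(1)])
    finally have "distribution_fun ?g (kernel_majorant s) \<le> s" .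
    moreover have "0 \<le> kernel_majorant s"
      unfolding kernel_majorant_def by (intro suminf_nonneg majorant_summable majorant_term s)
    ultimately show "decreasing_rearrangement ?g s \<le> kernel_majorant s"
      unfolding decreasing_rearrangement_def by (intro cInf_lower bdd) simp
  qed
  show "decreasing_rearrangement ?g s = 0" if s: "1 \<le> s"
  proof -
    have "distribution_fun ?g 0 \<le> 1"
      unfolding distribution_fun_def using circle.bounded_measure by simp
    then show ?thesis
      unfolding decreasing_rearrangement_def using s by (intro cInf_eq_minimum) auto
  qed
qed

text \<open>The \<open>k\<close>-th kernel has height about \<open>2 ^ (k * B)\<close> on an arc of
  measure about \<open>2 ^ - k\<close>, hence size about \<open>2 ^ (k * (B - 1 / p))\<close>, which
  the weights divide out. On the \<open>j\<close>-th dyadic interval its share decays with exponent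
  \<open>B - 1 / p \<ge> 1\<close> for \<open>k > j\<close> and \<open>1 / p \<ge> 1\<close> for
  \<open>k < j\<close>, so a convolution with ratio 1/2 dominates.\<close>

lemma kernel_sum_hardy_lorentz:
  assumes p: "0 < p" "p < 1" and q: "0 < q" and Bp: "1 / p + 1 \<le> real B"
    and c: "lseq (recip q) c" "\<And>k. 0 \<le> c k" and e: "\<And>k. e k = c k * 2 powr (- (real k * (real B - 1 / p)))"
  shows "kernel_sum \<in> hardy_lorentz p q"
proof -
  let ?w = "\<lambda>j. \<Sum>k. (1/2) ^ index_dist j k * c k"
  define D where "D = Gamma (real B) * 4 ^ B"
  define \<phi> where "\<phi> j = D * 2 powr (real j / p) * ?w j" for j
  have D: "0 \<le> D" using Gp by (simp add: D_def)
  have p1: "1 \<le> 1 / p" using p by simp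
  note conv = lseq_convolution[of "1/2", OF _ _ c(1) recip_nonneg c(2)]
  have cs: "summable (\<lambda>k. (1/2) ^ index_dist j k * c k)" for j by (rule conv(1)) auto
  have "decreasing_rearrangement (boundary_fun kernel_sum) s \<le> \<phi> j" if s: "s \<in> {(1/2) ^ Suc j..<(1/2) ^ j}" for s j
  proof -
    note b = dyadic_point_bounds[OF s]
    have "s < 1" using s power_le_one[of "1/2::real" j] by simp
    then have "decreasing_rearrangement (boundary_fun kernel_sum) s \<le> kernel_majorant s" using rearrangement_le(1) b(1) by blast
    also have "\<dots> \<le> (\<Sum>k. D * 2 powr (real j / p) * ((1/2) ^ index_dist j k * c k))"
      unfolding kernel_majorant_def
    proof (intro suminf_le majorant_summable b summable_mult cs)
      fix k
      \<comment> \<open>On the \<open>j\<close>-th interval the kernels of scale finer than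
        \<open>2 ^ - j\<close> are seen only from a distance and are capped at the height of scale
        \<open>j\<close>.\<close>
      have "min (2 ^ Suc k) (2 / s) \<le> 4 * 2 powr real (min j k)"
      proof (cases "j \<le> k")
        case True
        have "2 / s \<le> 4 * 2 ^ j" using b(5) by simp
        then show ?thesis using True by (simp add: powr_realpow)
      qed (simp add: powr_realpow min_le_iff_disj)
      moreover have "0 \<le> min (2 ^ Suc k) (2 / s)" using b(1) by simp
      ultimately have "min (2 ^ Suc k) (2 / s) ^ B \<le> (4 * 2 powr real (min j k)) ^ B" by (rule power_mono)
      also have "\<dots> = 4 ^ B * 2 powr (real (min j k) * real B)"
        by (simp add: power_mult_distrib powr_realpow[symmetric] powr_powr)
      finally have "e k * (Gamma (real B) * min (2 ^ Suc k) (2 / s) ^ B) \<le> e k * (Gamma (real B) * (4 ^ B * 2 powr (real (min j k) * real B)))"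
        using e0 Gp by (intro mult_left_mono) auto
      also have "\<dots> = D * c k * 2 powr (real (min j k) * real B - real k * (real B - 1 / p))"
      proof -
        have "2 powr (real (min j k) * real B - real k * (real B - 1 / p)) =
          2 powr (real (min j k) * real B) * 2 powr (- (real k * (real B - 1 / p)))"
          by (simp add: powr_add[symmetric])
        then show ?thesis by (simp only: e D_def mult_ac)
      qed
      also have "\<dots> \<le> D * c k * 2 powr (real j / p - real (index_dist j k))"
      proof (intro mult_left_mono powr_mono)
        show "real (min j k) * real B - real k * (real B - 1 / p) \<le> real j / p - real (index_dist j k)"
        proof (cases "j \<le> k")
          case True
          have "real (k - j) * 1 \<le> real (k - j) * (real B - 1 / p)" using Bp by (intro mult_left_mono) auto
          then show ?thesis using True by (simp add: index_dist_def of_nat_diff algebra_simps)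
        next
          case False
          have "real (j - k) * 1 \<le> real (j - k) * (1 / p)" using p1 by (intro mult_left_mono) auto
          then show ?thesis using False by (simp add: index_dist_def of_nat_diff algebra_simps)
        qed
      qed (use D c(2) in auto)
      also have "\<dots> = D * 2 powr (real j / p) * ((1/2) ^ index_dist j k * c k)"
        by (simp add: powr_diff powr_realpow power_one_over)
      finally show "e k * (Gamma (real B) * min (2 ^ Suc k) (2 / s) ^ B) \<le> D * 2 powr (real j / p) * ((1/2) ^ index_dist j k * c k)" .
    qed
    also have "\<dots> = \<phi> j" unfolding \<phi>_def by (rule suminf_mult[OF cs])
    finally show ?thesis .
  qed
  moreover have "0 \<le> decreasing_rearrangement (boundary_fun kernel_sum) s" if "s \<in> {(1/2) ^ Suc j..<(1/2) ^ j}" for s j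
    using dyadic_point_bounds(1)[OF that] by (intro decreasing_rearrangement_props(2) boundary_fun_measurable kernel_sum_holomorphic)
  moreover have "lseq (recip q) (\<lambda>j. \<phi> j * ((1/2) ^ j) powr (1/p))"
  proof -
    have "\<phi> j * ((1/2) ^ j) powr (1/p) = D * ?w j" for j
    proof -
      have "((1/2::real) ^ j) powr (1/p) = 2 powr (- (real j / p))"
      proof -
        have "(1/2::real) ^ j = 2 powr (- real j)" by (simp add: powr_minus powr_realpow power_one_over inverse_eq_divide)
        then show ?thesis by (simp add: powr_powr)
      qed
      then have "\<phi> j * ((1/2) ^ j) powr (1/p) = D * ?w j * (2 powr (real j / p) * 2 powr (- (real j / p)))" by (simp add: \<phi>_def)
      also have "2 powr (real j / p) * 2 powr (- (real j / p)) = (1::real)" by (simp add: powr_add[symmetric])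
      finally show ?thesis by simp
    qed
    moreover have "0 \<le> ?w j" for j by (intro suminf_nonneg cs) (simp add: c(2))
    ultimately show ?thesis using lseq_cmult[OF conv(2) D] by simp
  qed
  ultimately have "lorentz_norm p q (boundary_fun kernel_sum) < \<infinity>"
    by (intro lseq_imp_lorentz_finite[OF p(1) q, of _ \<phi>] rearrangement_le(2)) auto
  then show ?thesis using kernel_sum_smirnov by (simp add: hardy_lorentz_def)
qed

end

section \<open>The multiplier theorem\<close>

text \<open>On block \<open>k\<close> the multiplier \<open>gamma_ratio\<close> has order
  \<open>2 ^ (k * (B - 1))\<close>, from which the normalization leaves
  \<open>2 ^ (k * (\<beta> - 1))\<close>. The constant does not depend on \<open>d\<close>, so it
  can be fixed before the test sequence is chosen.\<close>

lemma kernel_sum_coeff_lower: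
  assumes \<beta>: "1 \<le> \<beta>" and B: "\<beta> + 1 \<le> real B"
  shows "\<exists>C>0. \<forall>d k n. (\<forall>k. 0 \<le> d k) \<longrightarrow> summable (\<lambda>k. d k * 2 powr (- (real k * (real B - \<beta>)))) \<longrightarrow> n \<in> {2 ^ k..<2 ^ Suc k} \<longrightarrow>
     d k * (2 ^ k) powr (\<beta> - 1) \<le> C * norm (taylor_coeff (kernel_sum (\<lambda>k. d k * 2 powr (- (real k * (real B - \<beta>)))) B) n)"
proof -
  have B1: "1 < B" using assms by linarith
  obtain c where c: "0 < c" "\<And>n. 1 \<le> n \<Longrightarrow> c * real n powr (real B - 1) \<le> gamma_ratio (real B - 1) n"
    using Gamma_ratio_bounds[of "real B - 1"] B1 unfolding gamma_ratio_def[symmetric] by auto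
  have "d k * (2 ^ k) powr (\<beta> - 1) \<le> 4 / c * norm (taylor_coeff (kernel_sum (\<lambda>k. d k * 2 powr (- (real k * (real B - \<beta>)))) B) n)"
    if d: "\<forall>k. 0 \<le> d k" and s: "summable (\<lambda>k. d k * 2 powr (- (real k * (real B - \<beta>))))" and n: "n \<in> {2 ^ k..<2 ^ Suc k}" for d k n
  proof -
    let ?e = "\<lambda>k. d k * 2 powr (- (real k * (real B - \<beta>)))"
    have e0: "0 \<le> ?e k" for k using d by simp
    have n1: "1 \<le> n" using n one_le_power[of "2::nat" k] by (simp del: one_le_power)
    have "(2::real) ^ k \<le> real n" using n by (metis atLeastLessThan_iff of_nat_le_iff of_nat_numeral of_nat_power)
    then have "c * (2 ^ k) powr (real B - 1) \<le> c * real n powr (real B - 1)"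
      using c B1 by (intro mult_left_mono powr_mono2) auto
    also have "\<dots> \<le> gamma_ratio (real B - 1) n" by (rule c(2)[OF n1])
    finally have "?e k * (c * (2 ^ k) powr (real B - 1)) / 4 \<le> ?e k * gamma_ratio (real B - 1) n / 4"
      using e0 by (intro divide_right_mono mult_left_mono) auto
    also have "\<dots> \<le> norm (taylor_coeff (kernel_sum ?e B) n)"
      using n by (intro kernel_sum_coeff_ge[OF e0 s B1]) auto
    also have "?e k * (c * (2 ^ k) powr (real B - 1)) / 4 = c / 4 * (d k * (2 ^ k) powr (\<beta> - 1))"
    proof -
      have "2 powr (- (real k * (real B - \<beta>))) * (2 ^ k) powr (real B - 1) = (2 ^ k) powr (\<beta> - 1)"
        by (simp add: powr_realpow[symmetric] powr_powr powr_add[symmetric] algebra_simps)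
      then show ?thesis by (simp add: mult_ac)
    qed
    finally show ?thesis using c by (simp add: field_simps)
  qed
  then show ?thesis using c by (intro exI[of _ "4 / c"]) auto
qed

theorem theorem7p1:
  fixes p :: real and q :: ennreal
  assumes "0 < p" and "p < 1" and "0 < q"
  shows "multipliers (seq_space (hardy_lorentz p q)) (seq_space hardy_H2) =
         seq_space (mixed_norm_deriv_space 2 (star2 q) 1 (1 / p))"
proof (rule set_eqI)
  fix l :: "nat \<Rightarrow> complex"
  let ?\<beta> = "1 / p"
  let ?\<theta> = "2 * recip q"
  let ?v = "block_weight ?\<beta> l"
  have \<beta>: "1 \<le> ?\<beta>" using assms by simp
  have \<theta>: "0 \<le> ?\<theta>" using recip_nonneg by simp
  have "2 * recip (star2 q) = max 0 (1 - ?\<theta>)" unfolding recip_star2[OF assms(3)] by (simp add: max_def)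
  then have rhs: "l \<in> seq_space (mixed_norm_deriv_space 2 (star2 q) 1 (1 / p)) \<longleftrightarrow> lseq (max 0 (1 - ?\<theta>)) ?v"
    using mixed_norm_deriv_space_iff[OF star2_pos[OF assms(3)] \<beta>] by simp
  have "l \<in> multipliers (seq_space (hardy_lorentz p q)) (seq_space hardy_H2) \<longleftrightarrow> lseq (max 0 (1 - ?\<theta>)) ?v"
  proof
    assume l: "l \<in> multipliers (seq_space (hardy_lorentz p q)) (seq_space hardy_H2)"
    obtain B :: nat where B: "?\<beta> + 1 \<le> real B" using real_arch_simple by blast
    have B1: "1 < B" using B \<beta> by linarith
    obtain C where C: "0 < C" "\<And>d k n. \<forall>k. 0 \<le> d k \<Longrightarrow> summable (\<lambda>k. d k * 2 powr (- (real k * (real B - ?\<beta>)))) \<Longrightarrow> n \<in> {2 ^ k..<2 ^ Suc k} \<Longrightarrow>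
     d k * (2 ^ k) powr (?\<beta> - 1) \<le> C * norm (taylor_coeff (kernel_sum (\<lambda>k. d k * 2 powr (- (real k * (real B - ?\<beta>)))) B) n)"
      using kernel_sum_coeff_lower[OF \<beta> B] by blast
    show "lseq (max 0 (1 - ?\<theta>)) ?v"
    proof (rule lseq_converse_holder[OF block_weight_nonneg \<theta>])
      fix c :: "nat \<Rightarrow> real" assume c0: "\<And>k. 0 \<le> c k" and lc: "lseq ?\<theta> c"
      \<comment> \<open>A test sequence of exponent \<open>q / 2\<close> is the square of one of
        exponent \<open>q\<close>, from which the test function is built.\<close>
      define d where "d k = sqrt (c k)" for k
      have d0: "0 \<le> d k" and dc: "(d k)\<^sup>2 = c k" for k using c0 by (simp_all add: d_def)
      have ld: "lseq (recip q) d" using lseq_square_iff[OF recip_nonneg d0] lc by (simp add: dc)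
      define e where "e k = d k * 2 powr (- (real k * (real B - ?\<beta>)))" for k
      have e0: "0 \<le> e k" for k by (simp add: e_def d0)
      obtain D where D: "0 \<le> D" "\<And>k. d k \<le> D" using lseq_imp_bounded[OF ld recip_nonneg d0] by blast
      \<comment> \<open>Boundedness of \<open>d\<close> suffices, because \<open>B\<close> exceeds
        \<open>1 / p\<close> by at least 1.\<close>
      have se: "summable e"
      proof (rule summable_comparison_test'[of _ 0])
        have "(2::real) powr (- (real B - ?\<beta>)) < 2 powr 0" using B by (intro powr_less_mono) auto
        then show "summable (\<lambda>k. D * (2 powr (- (real B - ?\<beta>))) ^ k)"
          by (intro summable_mult summable_geometric) auto
        fix k
        have "(2 powr (- (real B - ?\<beta>))) ^ k = (2::real) powr (- (real k * (real B - ?\<beta>)))"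
          by (simp add: powr_realpow[symmetric] powr_powr algebra_simps)
        then show "norm (e k) \<le> D * (2 powr (- (real B - ?\<beta>))) ^ k"
          using D(2)[of k] d0[of k] by (simp add: e_def abs_mult mult_right_mono)
      qed
      define F where "F = kernel_sum e B"
      have "F \<in> hardy_lorentz p q"
        unfolding F_def by (rule kernel_sum_hardy_lorentz[OF e0 se B1 assms B ld d0 e_def])
      then have "(\<lambda>n. l n * taylor_coeff F n) \<in> seq_space hardy_H2"
        using l by (auto simp: multipliers_def seq_space_def)
      then have "summable (\<lambda>n. (norm (l n * taylor_coeff F n))\<^sup>2)" by (simp only: hardy_H2_iff)
      then have sb: "summable (\<lambda>k. \<Sum>n\<in>{2 ^ k..<2 ^ Suc k}. (norm (l n * taylor_coeff F n))\<^sup>2)"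
        by (intro summable_dyadic_blocks(1)) auto
      show "summable (\<lambda>k. c k * ?v k)"
      proof (rule summable_comparison_test'[OF summable_mult[OF sb, of "C\<^sup>2"], of 0])
        fix k
        have "c k * ?v k = (\<Sum>n\<in>{2 ^ k..<2 ^ Suc k}. (d k * (2 ^ k) powr (?\<beta> - 1))\<^sup>2 * (norm (l n))\<^sup>2)"
          by (simp add: block_weight_def dc[symmetric] sum_distrib_left power_mult_distrib mult.assoc)
        also have "\<dots> \<le> (\<Sum>n\<in>{2 ^ k..<2 ^ Suc k}. (C * norm (taylor_coeff F n))\<^sup>2 * (norm (l n))\<^sup>2)"
        proof (intro sum_mono mult_right_mono power_mono)
          fix n :: nat assume "n \<in> {2 ^ k..<2 ^ Suc k}"
          then show "d k * (2 ^ k) powr (?\<beta> - 1) \<le> C * norm (taylor_coeff F n)"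
            unfolding F_def e_def[abs_def] using d0 se[unfolded e_def[abs_def]] by (intro C(2)) auto
        qed (auto simp: d0)
        also have "\<dots> = C\<^sup>2 * (\<Sum>n\<in>{2 ^ k..<2 ^ Suc k}. (norm (l n * taylor_coeff F n))\<^sup>2)"
          by (simp add: sum_distrib_left norm_mult power_mult_distrib mult_ac)
        finally show "norm (c k * ?v k) \<le> C\<^sup>2 * (\<Sum>n\<in>{2 ^ k..<2 ^ Suc k}. (norm (l n * taylor_coeff F n))\<^sup>2)"
          using c0[of k] block_weight_nonneg[of ?\<beta> l k] by (simp add: abs_mult)
      qed
    qed
  next
    assume v: "lseq (max 0 (1 - ?\<theta>)) ?v"
    have "(\<lambda>n. l n * taylor_coeff f n) \<in> seq_space hardy_H2" if f: "f \<in> hardy_lorentz p q" for f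
    proof -
      obtain x where x: "lseq (recip q) x" "\<And>k. 0 \<le> x k"
        "\<And>k n. n \<in> {2 ^ k..<2 ^ Suc k} \<Longrightarrow> norm (taylor_coeff f n) \<le> (2 ^ k) powr (?\<beta> - 1) * x k"
        using hardy_lorentz_coeff[OF assms f] by blast
      have "lseq ?\<theta> (\<lambda>k. (x k)\<^sup>2)" using lseq_square_iff[OF recip_nonneg x(2)] x(1) by simp
      \<comment> \<open>Hoelder's inequality with the exponent \<open>q / 2\<close> for the squares
        and its dual for the block weights.\<close>
      then have s: "summable (\<lambda>k. (x k)\<^sup>2 * ?v k)" by (rule lseq_holder[OF _ _ v block_weight_nonneg \<theta>]) simp
      have "summable (\<lambda>k. \<Sum>n\<in>{2 ^ k..<2 ^ Suc k}. (norm (l n * taylor_coeff f n))\<^sup>2)"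
      proof (rule summable_comparison_test'[OF s, of 0])
        fix k
        have "(\<Sum>n\<in>{2 ^ k..<2 ^ Suc k}. (norm (l n * taylor_coeff f n))\<^sup>2) \<le>
          (\<Sum>n\<in>{2 ^ k..<2 ^ Suc k}. (norm (l n))\<^sup>2 * ((2 ^ k) powr (?\<beta> - 1) * x k)\<^sup>2)"
          unfolding norm_mult power_mult_distrib[of "norm (l _)"]
          by (intro sum_mono mult_left_mono power_mono x(3)) auto
        also have "\<dots> = (x k)\<^sup>2 * ?v k"
          by (simp add: block_weight_def sum_distrib_left power_mult_distrib mult_ac)
        finally show "norm (\<Sum>n\<in>{2 ^ k..<2 ^ Suc k}. (norm (l n * taylor_coeff f n))\<^sup>2) \<le> (x k)\<^sup>2 * ?v k"
          by (simp add: sum_nonneg)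
      qed
      then show ?thesis unfolding hardy_H2_iff by (rule summable_dyadic_blocks(2)[rotated]) simp
    qed
    then show "l \<in> multipliers (seq_space (hardy_lorentz p q)) (seq_space hardy_H2)"
      by (auto simp: multipliers_def seq_space_def)
  qed
  then show "l \<in> multipliers (seq_space (hardy_lorentz p q)) (seq_space hardy_H2) \<longleftrightarrow>
    l \<in> seq_space (mixed_norm_deriv_space 2 (star2 q) 1 (1 / p))"
    using rhs by simp
qed

end
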